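(* For any symmetric monoidal categories $\mathcal A,\mathcal B,\mathcal C$, there exists a 2-cell in $\mathrm{SMC}$ (that is, a monoidal natural transformation) $$A_{\mathcal A,\mathcal B,\mathcal C}\circ A'_{\mathcal A,\mathcal B,\mathcal C}\to1:(\mathcal A\otimes\mathcal B)\otimes\mathcal C\to(\mathcal A\otimes\mathcal B)\otimes\mathcal C.$$
   Context: **Basics.** All symmetric monoidal categories are small, with tensor $\otimes$, unit $I$ and natural isomorphisms $ass_{a,b,c}:a\otimes(b\otimes c)\to(a\otimes b)\otimes c$, $r_a:a\otimes I\to a$, $l_a:I\otimes a\to a$, $s_{a,b}:a\otimes b\to b\otimes a$ satisfying the usual coherence axioms. A symmetric monoidal functor $F:\mathcal A\to\mathcal B$ is a lax one: a functor with an arrow $F^0:I\to F(I)$ and a natural family $F^2_{x,y}:Fx\otimes Fy\to F(x\otimes y)$ satisfying the usual associativity, unit and symmetry axioms; it is strict (resp. strong) if $F^0$ and all $F^2_{x,y}$ are identities (resp. isomorphisms). $\mathrm{SMC}$ is the 2-category of symmetric monoidal categories, symmetric monoidal functors and monoidal natural transformations. **Internal hom.** $[\mathcal A,\mathcal B]$ is the category $\mathrm{SMC}(\mathcal A,\mathcal B)$ with the pointwise symmetric monoidal structure: $(F\Box G)(a)=Fa\otimes Ga$, $(F\Box G)^0$ is $I\cong I\otimes I\xrightarrow{F^0\otimes G^0}F(I)\otimes G(I)$, $(F\Box G)^2_{a,b}$ is the canonical interchange $(Fa\otimes Ga)\otimes(Fb\otimes Gb)\cong(Fa\otimes Fb)\otimes(Ga\otimes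 Gb)$ followed by $F^2_{a,b}\otimes G^2_{a,b}$; $(\sigma\Box\tau)_a=\sigma_a\otimes\tau_a$; the unit is the constant functor at $I_{\mathcal B}$ (with $I\to I$ the identity and $I\otimes I\to I$ the canonical arrow); $ass,r,l,s$ are pointwise. For $F:\mathcal B\to\mathcal C$, $[\mathcal A,F]:[\mathcal A,\mathcal B]\to[\mathcal A,\mathcal C]$ is $H\mapsto F\circ H$, $\theta\mapsto F*\theta$, with $[\mathcal A,F]^0$ having all components $F^0$ and $[\mathcal A,F]^2_{H,K}$ having component $F^2_{Ha,Ka}$ at $a$; for a 2-cell $\sigma$, $[\mathcal A,\sigma]_H=\sigma*H$. **Tensor.** $\mathcal A\otimes\mathcal B$ is the following symmetric monoidal category. Its objects are the formal words freely generated from a constant $I$ and symbols $a\otimes b$ ($a$ in $\mathcal A$, $b$ in $\mathcal B$) under a formal binary operation $X\otimes Y$. Its arrows are freely generated, under composition and the operations $p\mapsto X\otimes p$, $p\mapsto p\otimes X$ for objects $X$, by formal arrows $ass,r,l$ (with formal inverses) and $s$ for all objects, and by arrows $\alpha_b:I\to I_{\mathcal A}\otimes b$; $\beta_a:I\to a\otimes I_{\mathcal B}$; $\gamma_{a,a',b}:(a\otimes b)\otimes(a'\otimes b)\to(a\otimes a')\otimes b$; $\delta_{a,b,b'}:(a\otimes b)\otimes(a\otimes b')\to a\otimes(b\otimes b')$; $a\otimes g:a\otimes b\to a\otimes b'$ for $g:b\to b'$ in $\mathcal B$; $f\otimes b:a\otimes b\to a'\otimes b$ for $f:a\to a'$ in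 $\mathcal A$; modulo the smallest congruence, compatible with all $X\otimes-$ and $-\otimes X$, such that: (i) $\otimes$ is a bifunctor and $\otimes,I,ass,r,l,s$ form a symmetric monoidal structure; (ii) for each $a$, $b\mapsto a\otimes b$, $g\mapsto a\otimes g$ with structure $\beta_a$, $\delta_{a,-,-}$ is a symmetric monoidal functor $\eta(a):\mathcal B\to\mathcal A\otimes\mathcal B$; (iii) for each $b$, $a\mapsto a\otimes b$, $f\mapsto f\otimes b$ with structure $\alpha_b$, $\gamma_{-,-,b}$ is a symmetric monoidal functor $\mathcal A\to\mathcal A\otimes\mathcal B$; (iv) for each $f:a\to a'$ the family $(f\otimes b)_b$, and for each $g:b\to b'$ the family $(a\otimes g)_a$, is a monoidal natural transformation between the corresponding functors of (ii), resp. (iii); (v) with $c:I\otimes I\to I$ canonical, $\alpha_{b\otimes b'}\circ c=\delta_{I_{\mathcal A},b,b'}\circ(\alpha_b\otimes\alpha_{b'})$, $\beta_{a\otimes a'}\circ c=\gamma_{a,a',I_{\mathcal B}}\circ(\beta_a\otimes\beta_{a'})$, and $\beta_{I_{\mathcal A}}=\alpha_{I_{\mathcal B}}$; (vi) $\gamma_{a,a',b\otimes b'}\circ(\delta_{a,b,b'}\otimes\delta_{a',b,b'})=\delta_{a\otimes a',b,b'}\circ(\gamma_{a,a',b}\otimes\gamma_{a,a',b'})\circ m$, where $m$ is the canonical isomorphism exchanging the two middle factors $a\otimes b'$ and $a'\otimes b$. The symmetric monoidal functor $\eta:\mathcal A\to[\mathcal B,\mathcal A\otimes\mathcal B]$ is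 $a\mapsto\eta(a)$, $\eta(f)_b=f\otimes b$, $(\eta^0)_b=\alpha_b$, $(\eta^2_{a,a'})_b=\gamma_{a,a',b}$. **$En$ and $Rn$.** For $F:\mathcal A\to[\mathcal B,\mathcal C]$, $En(F):\mathcal A\otimes\mathcal B\to\mathcal C$ is the strict symmetric monoidal functor with $a\otimes b\mapsto F(a)(b)$, $\alpha_b\mapsto(F^0)_b$, $\beta_a\mapsto(Fa)^0$, $\gamma_{a,a',b}\mapsto(F^2_{a,a'})_b$, $\delta_{a,b,b'}\mapsto(Fa)^2_{b,b'}$, $f\otimes b\mapsto F(f)_b$, $a\otimes g\mapsto F(a)(g)$. For a 2-cell $\sigma:F\to G$, $En(\sigma)_I=1$, $En(\sigma)_{a\otimes b}=(\sigma_a)_b$, $En(\sigma)_{X\otimes Y}=En(\sigma)_X\otimes En(\sigma)_Y$. $Rn:[\mathcal A\otimes\mathcal B,\mathcal C]\to[\mathcal A,[\mathcal B,\mathcal C]]$ is the strict symmetric monoidal functor $F\mapsto[\mathcal B,F]\circ\eta$, $\sigma\mapsto[\mathcal B,\sigma]*\eta$. One has $Rn\circ En=1$ and a natural $\epsilon_F:En(Rn(F))\to F$ with $(\epsilon_F)_{a\otimes b}=1$, $(\epsilon_F)_I=F^0$, $(\epsilon_F)_{X\otimes Y}=F^2_{X,Y}\circ((\epsilon_F)_X\otimes(\epsilon_F)_Y)$. $En:[\mathcal A,[\mathcal B,\mathcal C]]\to[\mathcal A\otimes\mathcal B,\mathcal C]$ is a (strong) symmetric monoidal functor with $En^2_{F,G}$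 the inverse of $\epsilon_{En(F)\Box En(G)}:En(F\Box G)\to En(F)\Box En(G)$ and $En^0$ the inverse of $\epsilon$ at the unit of $[\mathcal A\otimes\mathcal B,\mathcal C]$. **Associativity arrows.** $A_{\mathcal A,\mathcal B,\mathcal C}:\mathcal A\otimes(\mathcal B\otimes\mathcal C)\to(\mathcal A\otimes\mathcal B)\otimes\mathcal C$ is $En$ of the composite $\mathcal A\xrightarrow{\eta}[\mathcal B,\mathcal A\otimes\mathcal B]\xrightarrow{[\mathcal B,\eta]}[\mathcal B,[\mathcal C,(\mathcal A\otimes\mathcal B)\otimes\mathcal C]]\xrightarrow{En}[\mathcal B\otimes\mathcal C,(\mathcal A\otimes\mathcal B)\otimes\mathcal C]$. $A'_{\mathcal A,\mathcal B,\mathcal C}:(\mathcal A\otimes\mathcal B)\otimes\mathcal C\to\mathcal A\otimes(\mathcal B\otimes\mathcal C)$ is $En(En(K))$ where $K$ is the composite $\mathcal A\xrightarrow{\eta}[\mathcal B\otimes\mathcal C,\mathcal A\otimes(\mathcal B\otimes\mathcal C)]\xrightarrow{Rn}[\mathcal B,[\mathcal C,\mathcal A\otimes(\mathcal B\otimes\mathcal C)]]$. *)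

theory Defs
  imports Main "HOL-Library.FuncSet"
begin

section \<open>Symmetric monoidal categories\<close>

text \<open>
  A small category is given by a carrier set of objects and a carrier set of arrows.
  Composition is written in the applicative order: \<open>g \<cdot> f\<close> is \<open>g\<close> after \<open>f\<close>.
  The operations are total functions whose values outside the carriers
  (or on non-composable arrows) are irrelevant.
\<close>

record ('o, 'm) smcat =
  Obj :: "'o set"
  Arr :: "'m set"
  Dom :: "'m \<Rightarrow> 'o"
  Cod :: "'m \<Rightarrow> 'o"
  Id :: "'o \<Rightarrow> 'm"
  Comp :: "'m \<Rightarrow> 'm \<Rightarrow> 'm"  (infixr "\<cdot>\<index>" 55)
  Unit :: 'o
  TensO :: "'o \<Rightarrow> 'o \<Rightarrow> 'o"  (infixr "\<otimes>\<index>" 70)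
  TensM :: "'m \<Rightarrow> 'm \<Rightarrow> 'm"  (infixr "\<boxtimes>\<index>" 70)
  ass :: "'o \<Rightarrow> 'o \<Rightarrow> 'o \<Rightarrow> 'm"
  runit :: "'o \<Rightarrow> 'm"
  lunit :: "'o \<Rightarrow> 'm"
  symm :: "'o \<Rightarrow> 'o \<Rightarrow> 'm"

definition Hom :: "('o, 'm) smcat \<Rightarrow> 'o \<Rightarrow> 'o \<Rightarrow> 'm set" where
  "Hom C a b = {f \<in> Arr C. Dom C f = a \<and> Cod C f = b}"

definition inverse_arrs :: "('o, 'm) smcat \<Rightarrow> 'm \<Rightarrow> 'm \<Rightarrow> bool" where
  "inverse_arrs C f g \<longleftrightarrow> f \<in> Arr C \<and> g \<in> Hom C (Cod C f) (Dom C f) \<and>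
     Comp C g f = Id C (Dom C f) \<and> Comp C f g = Id C (Cod C f)"

definition is_iso :: "('o, 'm) smcat \<Rightarrow> 'm \<Rightarrow> bool" where
  "is_iso C f \<longleftrightarrow> (\<exists>g. inverse_arrs C f g)"

definition inv_arr :: "('o, 'm) smcat \<Rightarrow> 'm \<Rightarrow> 'm" where
  "inv_arr C f = (THE g. inverse_arrs C f g)"

locale sym_mon_cat =
  fixes C :: "('o, 'm) smcat" (structure)
  assumes Dom_closed: "f \<in> Arr C \<Longrightarrow> Dom C f \<in> Obj C"
    and Cod_closed: "f \<in> Arr C \<Longrightarrow> Cod C f \<in> Obj C"
    and Id_closed: "a \<in> Obj C \<Longrightarrow> Id C a \<in> Hom C a a"
    and Comp_closed: "f \<in> Hom C a b \<Longrightarrow> g \<in> Hom C b c \<Longrightarrow> g \<cdot> f \<in> Hom C a c"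
    and Comp_Id: "f \<in> Hom C a b \<Longrightarrow> f \<cdot> Id C a = f"
    and Id_Comp: "f \<in> Hom C a b \<Longrightarrow> Id C b \<cdot> f = f"
    and Comp_assoc: "f \<in> Hom C a b \<Longrightarrow> g \<in> Hom C b c \<Longrightarrow> h \<in> Hom C c d \<Longrightarrow>
      (h \<cdot> g) \<cdot> f = h \<cdot> (g \<cdot> f)"
    and Unit_closed: "Unit C \<in> Obj C"
    and TensO_closed: "a \<in> Obj C \<Longrightarrow> b \<in> Obj C \<Longrightarrow> a \<otimes> b \<in> Obj C"
    and TensM_closed: "f \<in> Hom C a a' \<Longrightarrow> g \<in> Hom C b b' \<Longrightarrow>
      f \<boxtimes> g \<in> Hom C (a \<otimes> b) (a' \<otimes> b')"
    and TensM_Id: "a \<in> Obj C \<Longrightarrow> b \<in> Obj C \<Longrightarrow> Id C a \<boxtimes> Id C b = Id C (a \<otimes> b)"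
    and TensM_Comp: "f \<in> Hom C a a' \<Longrightarrow> f' \<in> Hom C a' a'' \<Longrightarrow>
      g \<in> Hom C b b' \<Longrightarrow> g' \<in> Hom C b' b'' \<Longrightarrow>
      (f' \<cdot> f) \<boxtimes> (g' \<cdot> g) = (f' \<boxtimes> g') \<cdot> (f \<boxtimes> g)"
    and ass_closed: "a \<in> Obj C \<Longrightarrow> b \<in> Obj C \<Longrightarrow> c \<in> Obj C \<Longrightarrow>
      ass C a b c \<in> Hom C (a \<otimes> (b \<otimes> c)) ((a \<otimes> b) \<otimes> c)"
    and ass_iso: "a \<in> Obj C \<Longrightarrow> b \<in> Obj C \<Longrightarrow> c \<in> Obj C \<Longrightarrow> is_iso C (ass C a b c)"
    and ass_natural: "f \<in> Hom C a a' \<Longrightarrow> g \<in> Hom C b b' \<Longrightarrow> h \<in> Hom C c c' \<Longrightarrow>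
      ass C a' b' c' \<cdot> (f \<boxtimes> (g \<boxtimes> h)) = ((f \<boxtimes> g) \<boxtimes> h) \<cdot> ass C a b c"
    and runit_closed: "a \<in> Obj C \<Longrightarrow> runit C a \<in> Hom C (a \<otimes> Unit C) a"
    and runit_iso: "a \<in> Obj C \<Longrightarrow> is_iso C (runit C a)"
    and runit_natural: "f \<in> Hom C a a' \<Longrightarrow>
      runit C a' \<cdot> (f \<boxtimes> Id C (Unit C)) = f \<cdot> runit C a"
    and lunit_closed: "a \<in> Obj C \<Longrightarrow> lunit C a \<in> Hom C (Unit C \<otimes> a) a"
    and lunit_iso: "a \<in> Obj C \<Longrightarrow> is_iso C (lunit C a)"
    and lunit_natural: "f \<in> Hom C a a' \<Longrightarrow>
      lunit C a' \<cdot> (Id C (Unit C) \<boxtimes> f) = f \<cdot> lunit C a"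
    and symm_closed: "a \<in> Obj C \<Longrightarrow> b \<in> Obj C \<Longrightarrow> symm C a b \<in> Hom C (a \<otimes> b) (b \<otimes> a)"
    and symm_natural: "f \<in> Hom C a a' \<Longrightarrow> g \<in> Hom C b b' \<Longrightarrow>
      symm C a' b' \<cdot> (f \<boxtimes> g) = (g \<boxtimes> f) \<cdot> symm C a b"
    and symm_symm: "a \<in> Obj C \<Longrightarrow> b \<in> Obj C \<Longrightarrow> symm C b a \<cdot> symm C a b = Id C (a \<otimes> b)"
    and pentagon: "a \<in> Obj C \<Longrightarrow> b \<in> Obj C \<Longrightarrow> c \<in> Obj C \<Longrightarrow> d \<in> Obj C \<Longrightarrow>
      ass C (a \<otimes> b) c d \<cdot> ass C a b (c \<otimes> d) =
      (ass C a b c \<boxtimes> Id C d) \<cdot> ass C a (b \<otimes> c) d \<cdot> (Id C a \<boxtimes> ass C b c d)"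
    and triangle: "a \<in> Obj C \<Longrightarrow> c \<in> Obj C \<Longrightarrow>
      (runit C a \<boxtimes> Id C c) \<cdot> ass C a (Unit C) c = Id C a \<boxtimes> lunit C c"
    and hexagon: "a \<in> Obj C \<Longrightarrow> b \<in> Obj C \<Longrightarrow> c \<in> Obj C \<Longrightarrow>
      ass C c a b \<cdot> symm C (a \<otimes> b) c \<cdot> ass C a b c =
      (symm C a c \<boxtimes> Id C b) \<cdot> ass C a c b \<cdot> (Id C a \<boxtimes> symm C b c)"
    and symm_unit: "a \<in> Obj C \<Longrightarrow> lunit C a \<cdot> symm C a (Unit C) = runit C a"

text \<open>The canonical isomorphism \<open>(a \<otimes> b) \<otimes> (c \<otimes> d) \<rightarrow> (a \<otimes> c) \<otimes> (b \<otimes> d)\<close>.\<close>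

definition interchange :: "('o, 'm) smcat \<Rightarrow> 'o \<Rightarrow> 'o \<Rightarrow> 'o \<Rightarrow> 'o \<Rightarrow> 'm" where
  "interchange C a b c d =
     (let ot = TensO C; tm = TensM C; cmp = Comp C in
      cmp (ass C a c (ot b d))
     (cmp (tm (Id C a) (inv_arr C (ass C c b d)))
     (cmp (tm (Id C a) (tm (symm C b c) (Id C d)))
     (cmp (tm (Id C a) (ass C b c d))
          (inv_arr C (ass C a b (ot c d)))))))"


section \<open>Symmetric monoidal functors and monoidal natural transformations\<close>

text \<open>
  Functors are lax. All components of functors and natural transformations are required
  to be \<^const>\<open>extensional\<close>, i.e. fixed to \<^const>\<open>undefined\<close> outside the carriers, so that
  equality in HOL is equality of functors and transformations; this matters because
  they are the objects and arrows of internal homs.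
\<close>

record ('oa, 'ma, 'ob, 'mb) smfun =
  fobj :: "'oa \<Rightarrow> 'ob"
  farr :: "'ma \<Rightarrow> 'mb"
  funit :: "'mb"
  ftens :: "'oa \<times> 'oa \<Rightarrow> 'mb"

locale sym_mon_functor = A: sym_mon_cat A + B: sym_mon_cat B
  for A :: "('oa, 'ma) smcat" and B :: "('ob, 'mb) smcat" +
  fixes F :: "('oa, 'ma, 'ob, 'mb) smfun"
  assumes fobj_ext: "fobj F \<in> extensional (Obj A)"
    and farr_ext: "farr F \<in> extensional (Arr A)"
    and ftens_ext: "ftens F \<in> extensional (Obj A \<times> Obj A)"
    and fobj_closed: "a \<in> Obj A \<Longrightarrow> fobj F a \<in> Obj B"
    and farr_closed: "f \<in> Hom A a a' \<Longrightarrow> farr F f \<in> Hom B (fobj F a) (fobj F a')"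
    and farr_Id: "a \<in> Obj A \<Longrightarrow> farr F (Id A a) = Id B (fobj F a)"
    and farr_Comp: "f \<in> Hom A a a' \<Longrightarrow> g \<in> Hom A a' a'' \<Longrightarrow>
      farr F (g \<cdot>\<^bsub>A\<^esub> f) = farr F g \<cdot>\<^bsub>B\<^esub> farr F f"
    and funit_closed: "funit F \<in> Hom B (Unit B) (fobj F (Unit A))"
    and ftens_closed: "a \<in> Obj A \<Longrightarrow> b \<in> Obj A \<Longrightarrow>
      ftens F (a, b) \<in> Hom B (fobj F a \<otimes>\<^bsub>B\<^esub> fobj F b) (fobj F (a \<otimes>\<^bsub>A\<^esub> b))"
    and ftens_natural: "f \<in> Hom A a a' \<Longrightarrow> g \<in> Hom A b b' \<Longrightarrow>
      farr F (f \<boxtimes>\<^bsub>A\<^esub> g) \<cdot>\<^bsub>B\<^esub> ftens F (a, b) =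
      ftens F (a', b') \<cdot>\<^bsub>B\<^esub> (farr F f \<boxtimes>\<^bsub>B\<^esub> farr F g)"
    and ftens_ass: "a \<in> Obj A \<Longrightarrow> b \<in> Obj A \<Longrightarrow> c \<in> Obj A \<Longrightarrow>
      farr F (ass A a b c) \<cdot>\<^bsub>B\<^esub> ftens F (a, b \<otimes>\<^bsub>A\<^esub> c) \<cdot>\<^bsub>B\<^esub> (Id B (fobj F a) \<boxtimes>\<^bsub>B\<^esub> ftens F (b, c)) =
      ftens F (a \<otimes>\<^bsub>A\<^esub> b, c) \<cdot>\<^bsub>B\<^esub> (ftens F (a, b) \<boxtimes>\<^bsub>B\<^esub> Id B (fobj F c)) \<cdot>\<^bsub>B\<^esub>
        ass B (fobj F a) (fobj F b) (fobj F c)"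
    and ftens_runit: "a \<in> Obj A \<Longrightarrow>
      farr F (runit A a) \<cdot>\<^bsub>B\<^esub> ftens F (a, Unit A) \<cdot>\<^bsub>B\<^esub> (Id B (fobj F a) \<boxtimes>\<^bsub>B\<^esub> funit F) =
      runit B (fobj F a)"
    and ftens_lunit: "a \<in> Obj A \<Longrightarrow>
      farr F (lunit A a) \<cdot>\<^bsub>B\<^esub> ftens F (Unit A, a) \<cdot>\<^bsub>B\<^esub> (funit F \<boxtimes>\<^bsub>B\<^esub> Id B (fobj F a)) =
      lunit B (fobj F a)"
    and ftens_symm: "a \<in> Obj A \<Longrightarrow> b \<in> Obj A \<Longrightarrow>
      farr F (symm A a b) \<cdot>\<^bsub>B\<^esub> ftens F (a, b) =
      ftens F (b, a) \<cdot>\<^bsub>B\<^esub> symm B (fobj F a) (fobj F b)"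

record ('oa, 'ma, 'ob, 'mb) mnt =
  ndom :: "('oa, 'ma, 'ob, 'mb) smfun"
  ncod :: "('oa, 'ma, 'ob, 'mb) smfun"
  ncomp :: "'oa \<Rightarrow> 'mb"

locale mon_nat_trans =
  F: sym_mon_functor A B "ndom \<sigma>" + G: sym_mon_functor A B "ncod \<sigma>"
  for A :: "('oa, 'ma) smcat" and B :: "('ob, 'mb) smcat"
    and \<sigma> :: "('oa, 'ma, 'ob, 'mb) mnt" +
  assumes ncomp_ext: "ncomp \<sigma> \<in> extensional (Obj A)"
    and ncomp_closed: "a \<in> Obj A \<Longrightarrow> ncomp \<sigma> a \<in> Hom B (fobj (ndom \<sigma>) a) (fobj (ncod \<sigma>) a)"
    and ncomp_natural: "f \<in> Hom A a a' \<Longrightarrow>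
      farr (ncod \<sigma>) f \<cdot>\<^bsub>B\<^esub> ncomp \<sigma> a = ncomp \<sigma> a' \<cdot>\<^bsub>B\<^esub> farr (ndom \<sigma>) f"
    and ncomp_unit: "ncomp \<sigma> (Unit A) \<cdot>\<^bsub>B\<^esub> funit (ndom \<sigma>) = funit (ncod \<sigma>)"
    and ncomp_tens: "a \<in> Obj A \<Longrightarrow> b \<in> Obj A \<Longrightarrow>
      ncomp \<sigma> (a \<otimes>\<^bsub>A\<^esub> b) \<cdot>\<^bsub>B\<^esub> ftens (ndom \<sigma>) (a, b) =
      ftens (ncod \<sigma>) (a, b) \<cdot>\<^bsub>B\<^esub> (ncomp \<sigma> a \<boxtimes>\<^bsub>B\<^esub> ncomp \<sigma> b)"

definition smf_id :: "('oa, 'ma) smcat \<Rightarrow> ('oa, 'ma, 'oa, 'ma) smfun" where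
  "smf_id A = \<lparr> fobj = (\<lambda>a\<in>Obj A. a), farr = (\<lambda>f\<in>Arr A. f), funit = Id A (Unit A),
     ftens = restrict (\<lambda>(a, b). Id A (a \<otimes>\<^bsub>A\<^esub> b)) (Obj A \<times> Obj A) \<rparr>"

text \<open>\<open>smf_comp A C G F\<close> is \<open>G \<circ> F : A \<rightarrow> C\<close>.\<close>

definition smf_comp :: "('oa, 'ma) smcat \<Rightarrow> ('oc, 'mc) smcat \<Rightarrow> ('ob, 'mb, 'oc, 'mc) smfun \<Rightarrow>
    ('oa, 'ma, 'ob, 'mb) smfun \<Rightarrow> ('oa, 'ma, 'oc, 'mc) smfun" where
  "smf_comp A C G F = \<lparr>
     fobj = (\<lambda>a\<in>Obj A. fobj G (fobj F a)),
     farr = (\<lambda>f\<in>Arr A. farr G (farr F f)),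
     funit = farr G (funit F) \<cdot>\<^bsub>C\<^esub> funit G,
     ftens = restrict (\<lambda>(a, b). farr G (ftens F (a, b)) \<cdot>\<^bsub>C\<^esub> ftens G (fobj F a, fobj F b))
       (Obj A \<times> Obj A) \<rparr>"

text \<open>Whiskerings \<open>F * \<theta>\<close> (for \<open>\<theta>\<close> between functors \<open>A \<rightarrow> B\<close> and \<open>F : B \<rightarrow> C\<close>)
  and \<open>\<sigma> * H\<close> (for \<open>H : A \<rightarrow> B\<close> and \<open>\<sigma>\<close> between functors \<open>B \<rightarrow> C\<close>).\<close>

definition whisker_l :: "('oa, 'ma) smcat \<Rightarrow> ('oc, 'mc) smcat \<Rightarrow> ('ob, 'mb, 'oc, 'mc) smfun \<Rightarrow>
    ('oa, 'ma, 'ob, 'mb) mnt \<Rightarrow> ('oa, 'ma, 'oc, 'mc) mnt" where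
  "whisker_l A C F \<theta> = \<lparr> ndom = smf_comp A C F (ndom \<theta>), ncod = smf_comp A C F (ncod \<theta>),
     ncomp = (\<lambda>a\<in>Obj A. farr F (ncomp \<theta> a)) \<rparr>"

definition whisker_r :: "('oa, 'ma) smcat \<Rightarrow> ('oc, 'mc) smcat \<Rightarrow> ('ob, 'mb, 'oc, 'mc) mnt \<Rightarrow>
    ('oa, 'ma, 'ob, 'mb) smfun \<Rightarrow> ('oa, 'ma, 'oc, 'mc) mnt" where
  "whisker_r A C \<sigma> H = \<lparr> ndom = smf_comp A C (ndom \<sigma>) H, ncod = smf_comp A C (ncod \<sigma>) H,
     ncomp = (\<lambda>a\<in>Obj A. ncomp \<sigma> (fobj H a)) \<rparr>"


section \<open>The internal hom\<close>

definition hom_unit :: "('oa, 'ma) smcat \<Rightarrow> ('ob, 'mb) smcat \<Rightarrow> ('oa, 'ma, 'ob, 'mb) smfun" where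
  "hom_unit A B = \<lparr> fobj = (\<lambda>a\<in>Obj A. Unit B), farr = (\<lambda>f\<in>Arr A. Id B (Unit B)),
     funit = Id B (Unit B), ftens = restrict (\<lambda>(a, b). lunit B (Unit B)) (Obj A \<times> Obj A) \<rparr>"

definition hom_tens :: "('oa, 'ma) smcat \<Rightarrow> ('ob, 'mb) smcat \<Rightarrow> ('oa, 'ma, 'ob, 'mb) smfun \<Rightarrow>
    ('oa, 'ma, 'ob, 'mb) smfun \<Rightarrow> ('oa, 'ma, 'ob, 'mb) smfun" where
  "hom_tens A B F G = \<lparr>
     fobj = (\<lambda>a\<in>Obj A. fobj F a \<otimes>\<^bsub>B\<^esub> fobj G a),
     farr = (\<lambda>f\<in>Arr A. farr F f \<boxtimes>\<^bsub>B\<^esub> farr G f),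
     funit = (funit F \<boxtimes>\<^bsub>B\<^esub> funit G) \<cdot>\<^bsub>B\<^esub> inv_arr B (lunit B (Unit B)),
     ftens = restrict (\<lambda>(a, b). (ftens F (a, b) \<boxtimes>\<^bsub>B\<^esub> ftens G (a, b)) \<cdot>\<^bsub>B\<^esub>
         interchange B (fobj F a) (fobj G a) (fobj F b) (fobj G b))
       (Obj A \<times> Obj A) \<rparr>"

definition hom_cat :: "('oa, 'ma) smcat \<Rightarrow> ('ob, 'mb) smcat \<Rightarrow>
    (('oa, 'ma, 'ob, 'mb) smfun, ('oa, 'ma, 'ob, 'mb) mnt) smcat" where
  "hom_cat A B = \<lparr>
     Obj = {F. sym_mon_functor A B F},
     Arr = {\<sigma>. mon_nat_trans A B \<sigma>},
     Dom = ndom,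
     Cod = ncod,
     Id = (\<lambda>F. \<lparr> ndom = F, ncod = F, ncomp = (\<lambda>a\<in>Obj A. Id B (fobj F a)) \<rparr>),
     Comp = (\<lambda>\<tau> \<sigma>. \<lparr> ndom = ndom \<sigma>, ncod = ncod \<tau>,
        ncomp = (\<lambda>a\<in>Obj A. ncomp \<tau> a \<cdot>\<^bsub>B\<^esub> ncomp \<sigma> a) \<rparr>),
     Unit = hom_unit A B,
     TensO = hom_tens A B,
     TensM = (\<lambda>\<sigma> \<tau>. \<lparr> ndom = hom_tens A B (ndom \<sigma>) (ndom \<tau>),
        ncod = hom_tens A B (ncod \<sigma>) (ncod \<tau>),
        ncomp = (\<lambda>a\<in>Obj A. ncomp \<sigma> a \<boxtimes>\<^bsub>B\<^esub> ncomp \<tau> a) \<rparr>),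
     ass = (\<lambda>F G H. \<lparr> ndom = hom_tens A B F (hom_tens A B G H),
        ncod = hom_tens A B (hom_tens A B F G) H,
        ncomp = (\<lambda>a\<in>Obj A. ass B (fobj F a) (fobj G a) (fobj H a)) \<rparr>),
     runit = (\<lambda>F. \<lparr> ndom = hom_tens A B F (hom_unit A B), ncod = F,
        ncomp = (\<lambda>a\<in>Obj A. runit B (fobj F a)) \<rparr>),
     lunit = (\<lambda>F. \<lparr> ndom = hom_tens A B (hom_unit A B) F, ncod = F,
        ncomp = (\<lambda>a\<in>Obj A. lunit B (fobj F a)) \<rparr>),
     symm = (\<lambda>F G. \<lparr> ndom = hom_tens A B F G, ncod = hom_tens A B G F,
        ncomp = (\<lambda>a\<in>Obj A. symm B (fobj F a) (fobj G a)) \<rparr>) \<rparr>"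

text \<open>The functor \<open>[A, F] : [A, B] \<rightarrow> [A, C]\<close> for \<open>F : B \<rightarrow> C\<close>, and the transformation
  \<open>[A, \<sigma>] : [A, F] \<rightarrow> [A, G]\<close> for \<open>\<sigma> : F \<rightarrow> G\<close>.\<close>

definition hom_post :: "('oa, 'ma) smcat \<Rightarrow> ('ob, 'mb) smcat \<Rightarrow> ('oc, 'mc) smcat \<Rightarrow>
    ('ob, 'mb, 'oc, 'mc) smfun \<Rightarrow>
    (('oa, 'ma, 'ob, 'mb) smfun, ('oa, 'ma, 'ob, 'mb) mnt,
     ('oa, 'ma, 'oc, 'mc) smfun, ('oa, 'ma, 'oc, 'mc) mnt) smfun" where
  "hom_post A B C F = \<lparr>
     fobj = (\<lambda>H\<in>Obj (hom_cat A B). smf_comp A C F H),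
     farr = (\<lambda>\<theta>\<in>Arr (hom_cat A B). whisker_l A C F \<theta>),
     funit = \<lparr> ndom = hom_unit A C, ncod = smf_comp A C F (hom_unit A B),
       ncomp = (\<lambda>a\<in>Obj A. funit F) \<rparr>,
     ftens = restrict (\<lambda>(H, K).
         \<lparr> ndom = hom_tens A C (smf_comp A C F H) (smf_comp A C F K),
           ncod = smf_comp A C F (hom_tens A B H K),
           ncomp = (\<lambda>a\<in>Obj A. ftens F (fobj H a, fobj K a)) \<rparr>)
       (Obj (hom_cat A B) \<times> Obj (hom_cat A B)) \<rparr>"

definition hom_post_nt :: "('oa, 'ma) smcat \<Rightarrow> ('ob, 'mb) smcat \<Rightarrow> ('oc, 'mc) smcat \<Rightarrow>
    ('ob, 'mb, 'oc, 'mc) mnt \<Rightarrow>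
    (('oa, 'ma, 'ob, 'mb) smfun, ('oa, 'ma, 'ob, 'mb) mnt,
     ('oa, 'ma, 'oc, 'mc) smfun, ('oa, 'ma, 'oc, 'mc) mnt) mnt" where
  "hom_post_nt A B C \<sigma> = \<lparr> ndom = hom_post A B C (ndom \<sigma>), ncod = hom_post A B C (ncod \<sigma>),
     ncomp = (\<lambda>H\<in>Obj (hom_cat A B). whisker_r A C \<sigma> H) \<rparr>"


section \<open>The tensor product\<close>

datatype ('oa, 'ob) word =
    WUnit
  | WGen 'oa 'ob
  | WTens "('oa, 'ob) word" "('oa, 'ob) word"  (infixr "\<odot>" 70)

text \<open>
  Raw arrow expressions. \<open>TLeft X p\<close> is \<open>X \<otimes> p\<close> and \<open>TRight p X\<close> is \<open>p \<otimes> X\<close>;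
  \<open>TAss'\<close>, \<open>TR'\<close>, \<open>TL'\<close> are the formal inverses of \<open>TAss\<close>, \<open>TR\<close>, \<open>TL\<close>;
  \<open>TGenL f b\<close> is \<open>f \<otimes> b\<close> and \<open>TGenR a g\<close> is \<open>a \<otimes> g\<close> (generators).
\<close>

datatype ('oa, 'ma, 'ob, 'mb) texp =
    TId "('oa, 'ob) word"
  | TComp "('oa, 'ma, 'ob, 'mb) texp" "('oa, 'ma, 'ob, 'mb) texp"  (infixr "\<bullet>" 55)
  | TLeft "('oa, 'ob) word" "('oa, 'ma, 'ob, 'mb) texp"
  | TRight "('oa, 'ma, 'ob, 'mb) texp" "('oa, 'ob) word"
  | TAss "('oa, 'ob) word" "('oa, 'ob) word" "('oa, 'ob) word"
  | TAss' "('oa, 'ob) word" "('oa, 'ob) word" "('oa, 'ob) word"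
  | TR "('oa, 'ob) word"
  | TR' "('oa, 'ob) word"
  | TL "('oa, 'ob) word"
  | TL' "('oa, 'ob) word"
  | TS "('oa, 'ob) word" "('oa, 'ob) word"
  | TAlpha 'ob
  | TBeta 'oa
  | TGamma 'oa 'oa 'ob
  | TDelta 'oa 'ob 'ob
  | TGenL 'ma 'ob
  | TGenR 'oa 'mb

primrec is_word :: "('oa, 'ma) smcat \<Rightarrow> ('ob, 'mb) smcat \<Rightarrow> ('oa, 'ob) word \<Rightarrow> bool" where
  "is_word A B WUnit \<longleftrightarrow> True"
| "is_word A B (WGen a b) \<longleftrightarrow> a \<in> Obj A \<and> b \<in> Obj B"
| "is_word A B (X \<odot> Y) \<longleftrightarrow> is_word A B X \<and> is_word A B Y"

primrec tdom :: "('oa, 'ma) smcat \<Rightarrow> ('ob, 'mb) smcat \<Rightarrow>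
    ('oa, 'ma, 'ob, 'mb) texp \<Rightarrow> ('oa, 'ob) word" where
  "tdom A B (TId X) = X"
| "tdom A B (t \<bullet> u) = tdom A B u"
| "tdom A B (TLeft X t) = X \<odot> tdom A B t"
| "tdom A B (TRight t X) = tdom A B t \<odot> X"
| "tdom A B (TAss X Y Z) = X \<odot> (Y \<odot> Z)"
| "tdom A B (TAss' X Y Z) = (X \<odot> Y) \<odot> Z"
| "tdom A B (TR X) = X \<odot> WUnit"
| "tdom A B (TR' X) = X"
| "tdom A B (TL X) = WUnit \<odot> X"
| "tdom A B (TL' X) = X"
| "tdom A B (TS X Y) = X \<odot> Y"
| "tdom A B (TAlpha b) = WUnit"
| "tdom A B (TBeta a) = WUnit"
| "tdom A B (TGamma a a' b) = WGen a b \<odot> WGen a' b"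
| "tdom A B (TDelta a b b') = WGen a b \<odot> WGen a b'"
| "tdom A B (TGenL f b) = WGen (Dom A f) b"
| "tdom A B (TGenR a g) = WGen a (Dom B g)"

primrec tcod :: "('oa, 'ma) smcat \<Rightarrow> ('ob, 'mb) smcat \<Rightarrow>
    ('oa, 'ma, 'ob, 'mb) texp \<Rightarrow> ('oa, 'ob) word" where
  "tcod A B (TId X) = X"
| "tcod A B (t \<bullet> u) = tcod A B t"
| "tcod A B (TLeft X t) = X \<odot> tcod A B t"
| "tcod A B (TRight t X) = tcod A B t \<odot> X"
| "tcod A B (TAss X Y Z) = (X \<odot> Y) \<odot> Z"
| "tcod A B (TAss' X Y Z) = X \<odot> (Y \<odot> Z)"
| "tcod A B (TR X) = X"
| "tcod A B (TR' X) = X \<odot> WUnit"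
| "tcod A B (TL X) = X"
| "tcod A B (TL' X) = WUnit \<odot> X"
| "tcod A B (TS X Y) = Y \<odot> X"
| "tcod A B (TAlpha b) = WGen (Unit A) b"
| "tcod A B (TBeta a) = WGen a (Unit B)"
| "tcod A B (TGamma a a' b) = WGen (a \<otimes>\<^bsub>A\<^esub> a') b"
| "tcod A B (TDelta a b b') = WGen a (b \<otimes>\<^bsub>B\<^esub> b')"
| "tcod A B (TGenL f b) = WGen (Cod A f) b"
| "tcod A B (TGenR a g) = WGen a (Cod B g)"

primrec twf :: "('oa, 'ma) smcat \<Rightarrow> ('ob, 'mb) smcat \<Rightarrow>
    ('oa, 'ma, 'ob, 'mb) texp \<Rightarrow> bool" where
  "twf A B (TId X) \<longleftrightarrow> is_word A B X"
| "twf A B (t \<bullet> u) \<longleftrightarrow> twf A B t \<and> twf A B u \<and> tcod A B u = tdom A B t"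
| "twf A B (TLeft X t) \<longleftrightarrow> is_word A B X \<and> twf A B t"
| "twf A B (TRight t X) \<longleftrightarrow> twf A B t \<and> is_word A B X"
| "twf A B (TAss X Y Z) \<longleftrightarrow> is_word A B X \<and> is_word A B Y \<and> is_word A B Z"
| "twf A B (TAss' X Y Z) \<longleftrightarrow> is_word A B X \<and> is_word A B Y \<and> is_word A B Z"
| "twf A B (TR X) \<longleftrightarrow> is_word A B X"
| "twf A B (TR' X) \<longleftrightarrow> is_word A B X"
| "twf A B (TL X) \<longleftrightarrow> is_word A B X"
| "twf A B (TL' X) \<longleftrightarrow> is_word A B X"
| "twf A B (TS X Y) \<longleftrightarrow> is_word A B X \<and> is_word A B Y"
| "twf A B (TAlpha b) \<longleftrightarrow> b \<in> Obj B"
| "twf A B (TBeta a) \<longleftrightarrow> a \<in> Obj A"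
| "twf A B (TGamma a a' b) \<longleftrightarrow> a \<in> Obj A \<and> a' \<in> Obj A \<and> b \<in> Obj B"
| "twf A B (TDelta a b b') \<longleftrightarrow> a \<in> Obj A \<and> b \<in> Obj B \<and> b' \<in> Obj B"
| "twf A B (TGenL f b) \<longleftrightarrow> f \<in> Arr A \<and> b \<in> Obj B"
| "twf A B (TGenR a g) \<longleftrightarrow> a \<in> Obj A \<and> g \<in> Arr B"

text \<open>\<open>p \<otimes> q\<close> for expressions \<open>p : X \<rightarrow> X'\<close> and \<open>q : Y \<rightarrow> Y'\<close>, as \<open>(p \<otimes> Y') \<circ> (X \<otimes> q)\<close>.\<close>

definition ttens :: "('oa, 'ma) smcat \<Rightarrow> ('ob, 'mb) smcat \<Rightarrow>
    ('oa, 'ma, 'ob, 'mb) texp \<Rightarrow> ('oa, 'ma, 'ob, 'mb) texp \<Rightarrow> ('oa, 'ma, 'ob, 'mb) texp" where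
  "ttens A B p q = TRight p (tcod A B q) \<bullet> TLeft (tdom A B p) q"

text \<open>The canonical exchange \<open>(X \<otimes> Y) \<otimes> (Z \<otimes> W) \<rightarrow> (X \<otimes> Z) \<otimes> (Y \<otimes> W)\<close>.\<close>

definition texch :: "('oa, 'ob) word \<Rightarrow> ('oa, 'ob) word \<Rightarrow> ('oa, 'ob) word \<Rightarrow>
    ('oa, 'ob) word \<Rightarrow> ('oa, 'ma, 'ob, 'mb) texp" where
  "texch X Y Z W = TAss X Z (Y \<odot> W) \<bullet> TLeft X (TAss' Z Y W) \<bullet> TLeft X (TRight (TS Y Z) W) \<bullet>
     TLeft X (TAss Y Z W) \<bullet> TAss' X Y (Z \<odot> W)"

text \<open>
  The basic relations. They are imposed only between well-formed expressions
  (rule \<open>base\<close> of \<open>tcong\<close> below), so no side conditions are listed here.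
\<close>

context
  fixes A :: "('oa, 'ma) smcat" and B :: "('ob, 'mb) smcat"
begin

private abbreviation (input) dm :: "('oa, 'ma, 'ob, 'mb) texp \<Rightarrow> ('oa, 'ob) word" where "dm \<equiv> tdom A B"
private abbreviation (input) cd :: "('oa, 'ma, 'ob, 'mb) texp \<Rightarrow> ('oa, 'ob) word" where "cd \<equiv> tcod A B"
private abbreviation (input) tt :: "('oa, 'ma, 'ob, 'mb) texp \<Rightarrow> ('oa, 'ma, 'ob, 'mb) texp \<Rightarrow>
    ('oa, 'ma, 'ob, 'mb) texp" (infixr "\<otimes>\<^sub>t" 70) where "tt \<equiv> ttens A B"

inductive trel :: "('oa, 'ma, 'ob, 'mb) texp \<Rightarrow> ('oa, 'ma, 'ob, 'mb) texp \<Rightarrow> bool"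
  (infix "\<approx>" 50) where
  \<comment> \<open>category\<close>
  "TId (cd t) \<bullet> t \<approx> t"
| "t \<bullet> TId (dm t) \<approx> t"
| "(t \<bullet> u) \<bullet> v \<approx> t \<bullet> (u \<bullet> v)"
  \<comment> \<open>(i) bifunctoriality and symmetric monoidal structure\<close>
| "TLeft X (TId Y) \<approx> TId (X \<odot> Y)"
| "TLeft X (t \<bullet> u) \<approx> TLeft X t \<bullet> TLeft X u"
| "TRight (TId X) Y \<approx> TId (X \<odot> Y)"
| "TRight (t \<bullet> u) Y \<approx> TRight t Y \<bullet> TRight u Y"
| "TRight t (cd u) \<bullet> TLeft (dm t) u \<approx> TLeft (cd t) u \<bullet> TRight t (dm u)"
| "TAss X Y Z \<bullet> TAss' X Y Z \<approx> TId ((X \<odot> Y) \<odot> Z)"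
| "TAss' X Y Z \<bullet> TAss X Y Z \<approx> TId (X \<odot> (Y \<odot> Z))"
| "TR X \<bullet> TR' X \<approx> TId X"
| "TR' X \<bullet> TR X \<approx> TId (X \<odot> WUnit)"
| "TL X \<bullet> TL' X \<approx> TId X"
| "TL' X \<bullet> TL X \<approx> TId (WUnit \<odot> X)"
| "TS Y X \<bullet> TS X Y \<approx> TId (X \<odot> Y)"
| "TAss (cd t) (cd u) (cd v) \<bullet> (t \<otimes>\<^sub>t (u \<otimes>\<^sub>t v)) \<approx> ((t \<otimes>\<^sub>t u) \<otimes>\<^sub>t v) \<bullet> TAss (dm t) (dm u) (dm v)"
| "TR (cd t) \<bullet> TRight t WUnit \<approx> t \<bullet> TR (dm t)"
| "TL (cd t) \<bullet> TLeft WUnit t \<approx> t \<bullet> TL (dm t)"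
| "TS (cd t) (cd u) \<bullet> (t \<otimes>\<^sub>t u) \<approx> (u \<otimes>\<^sub>t t) \<bullet> TS (dm t) (dm u)"
| "TAss (X \<odot> Y) Z W \<bullet> TAss X Y (Z \<odot> W) \<approx>
   TRight (TAss X Y Z) W \<bullet> TAss X (Y \<odot> Z) W \<bullet> TLeft X (TAss Y Z W)"
| "TRight (TR X) Z \<bullet> TAss X WUnit Z \<approx> TLeft X (TL Z)"
| "TAss Z X Y \<bullet> TS (X \<odot> Y) Z \<bullet> TAss X Y Z \<approx>
   TRight (TS X Z) Y \<bullet> TAss X Z Y \<bullet> TLeft X (TS Y Z)"
| "TL X \<bullet> TS X WUnit \<approx> TR X"
  \<comment> \<open>(ii) \<open>a \<otimes> -\<close> is a symmetric monoidal functor\<close>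
| "TGenR a (Id B b) \<approx> TId (WGen a b)"
| "TGenR a (g' \<cdot>\<^bsub>B\<^esub> g) \<approx> TGenR a g' \<bullet> TGenR a g"
| "TGenR a (g \<boxtimes>\<^bsub>B\<^esub> g') \<bullet> TDelta a (Dom B g) (Dom B g') \<approx>
   TDelta a (Cod B g) (Cod B g') \<bullet> (TGenR a g \<otimes>\<^sub>t TGenR a g')"
| "TGenR a (ass B b b' b'') \<bullet> TDelta a b (b' \<otimes>\<^bsub>B\<^esub> b'') \<bullet> TLeft (WGen a b) (TDelta a b' b'') \<approx>
   TDelta a (b \<otimes>\<^bsub>B\<^esub> b') b'' \<bullet> TRight (TDelta a b b') (WGen a b'') \<bullet>
     TAss (WGen a b) (WGen a b') (WGen a b'')"
| "TGenR a (runit B b) \<bullet> TDelta a b (Unit B) \<bullet> TLeft (WGen a b) (TBeta a) \<approx> TR (WGen a b)"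
| "TGenR a (lunit B b) \<bullet> TDelta a (Unit B) b \<bullet> TRight (TBeta a) (WGen a b) \<approx> TL (WGen a b)"
| "TGenR a (symm B b b') \<bullet> TDelta a b b' \<approx> TDelta a b' b \<bullet> TS (WGen a b) (WGen a b')"
  \<comment> \<open>(iii) \<open>- \<otimes> b\<close> is a symmetric monoidal functor\<close>
| "TGenL (Id A a) b \<approx> TId (WGen a b)"
| "TGenL (f' \<cdot>\<^bsub>A\<^esub> f) b \<approx> TGenL f' b \<bullet> TGenL f b"
| "TGenL (f \<boxtimes>\<^bsub>A\<^esub> f') b \<bullet> TGamma (Dom A f) (Dom A f') b \<approx>
   TGamma (Cod A f) (Cod A f') b \<bullet> (TGenL f b \<otimes>\<^sub>t TGenL f' b)"
| "TGenL (ass A a a' a'') b \<bullet> TGamma a (a' \<otimes>\<^bsub>A\<^esub> a'') b \<bullet> TLeft (WGen a b) (TGamma a' a'' b) \<approx>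
   TGamma (a \<otimes>\<^bsub>A\<^esub> a') a'' b \<bullet> TRight (TGamma a a' b) (WGen a'' b) \<bullet>
     TAss (WGen a b) (WGen a' b) (WGen a'' b)"
| "TGenL (runit A a) b \<bullet> TGamma a (Unit A) b \<bullet> TLeft (WGen a b) (TAlpha b) \<approx> TR (WGen a b)"
| "TGenL (lunit A a) b \<bullet> TGamma (Unit A) a b \<bullet> TRight (TAlpha b) (WGen a b) \<approx> TL (WGen a b)"
| "TGenL (symm A a a') b \<bullet> TGamma a a' b \<approx> TGamma a' a b \<bullet> TS (WGen a b) (WGen a' b)"
  \<comment> \<open>(iv) \<open>f \<otimes> -\<close> and \<open>- \<otimes> g\<close> are monoidal natural transformations\<close>
| "TGenL f (Cod B g) \<bullet> TGenR (Dom A f) g \<approx> TGenR (Cod A f) g \<bullet> TGenL f (Dom B g)"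
| "TGenL f (Unit B) \<bullet> TBeta (Dom A f) \<approx> TBeta (Cod A f)"
| "TGenL f (b \<otimes>\<^bsub>B\<^esub> b') \<bullet> TDelta (Dom A f) b b' \<approx>
   TDelta (Cod A f) b b' \<bullet> (TGenL f b \<otimes>\<^sub>t TGenL f b')"
| "TGenR (Unit A) g \<bullet> TAlpha (Dom B g) \<approx> TAlpha (Cod B g)"
| "TGenR (a \<otimes>\<^bsub>A\<^esub> a') g \<bullet> TGamma a a' (Dom B g) \<approx>
   TGamma a a' (Cod B g) \<bullet> (TGenR a g \<otimes>\<^sub>t TGenR a' g)"
  \<comment> \<open>(v)\<close>
| "TAlpha (b \<otimes>\<^bsub>B\<^esub> b') \<bullet> TL WUnit \<approx> TDelta (Unit A) b b' \<bullet> (TAlpha b \<otimes>\<^sub>t TAlpha b')"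
| "TBeta (a \<otimes>\<^bsub>A\<^esub> a') \<bullet> TL WUnit \<approx> TGamma a a' (Unit B) \<bullet> (TBeta a \<otimes>\<^sub>t TBeta a')"
| "TBeta (Unit A) \<approx> TAlpha (Unit B)"
  \<comment> \<open>(vi)\<close>
| "TGamma a a' (b \<otimes>\<^bsub>B\<^esub> b') \<bullet> (TDelta a b b' \<otimes>\<^sub>t TDelta a' b b') \<approx>
   TDelta (a \<otimes>\<^bsub>A\<^esub> a') b b' \<bullet> (TGamma a a' b \<otimes>\<^sub>t TGamma a a' b') \<bullet>
     texch (WGen a b) (WGen a b') (WGen a' b) (WGen a' b')"

inductive tcong :: "('oa, 'ma, 'ob, 'mb) texp \<Rightarrow> ('oa, 'ma, 'ob, 'mb) texp \<Rightarrow> bool" where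
  base: "trel t u \<Longrightarrow> twf A B t \<Longrightarrow> twf A B u \<Longrightarrow> tcong t u"
| refl: "twf A B t \<Longrightarrow> tcong t t"
| sym: "tcong t u \<Longrightarrow> tcong u t"
| trans: "tcong t u \<Longrightarrow> tcong u v \<Longrightarrow> tcong t v"
| comp: "tcong t t' \<Longrightarrow> tcong u u' \<Longrightarrow> twf A B (t \<bullet> u) \<Longrightarrow> tcong (t \<bullet> u) (t' \<bullet> u')"
| left: "tcong t u \<Longrightarrow> is_word A B X \<Longrightarrow> tcong (TLeft X t) (TLeft X u)"
| right: "tcong t u \<Longrightarrow> is_word A B X \<Longrightarrow> tcong (TRight t X) (TRight u X)"

end

definition tclass :: "('oa, 'ma) smcat \<Rightarrow> ('ob, 'mb) smcat \<Rightarrow>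
    ('oa, 'ma, 'ob, 'mb) texp \<Rightarrow> ('oa, 'ma, 'ob, 'mb) texp set" where
  "tclass A B t = {u. tcong A B t u}"

definition trep :: "('oa, 'ma, 'ob, 'mb) texp set \<Rightarrow> ('oa, 'ma, 'ob, 'mb) texp" where
  "trep p = (SOME t. t \<in> p)"

definition tensor_cat :: "('oa, 'ma) smcat \<Rightarrow> ('ob, 'mb) smcat \<Rightarrow>
    (('oa, 'ob) word, ('oa, 'ma, 'ob, 'mb) texp set) smcat" where
  "tensor_cat A B = \<lparr>
     Obj = {X. is_word A B X},
     Arr = tclass A B ` {t. twf A B t},
     Dom = (\<lambda>p. tdom A B (trep p)),
     Cod = (\<lambda>p. tcod A B (trep p)),
     Id = (\<lambda>X. tclass A B (TId X)),
     Comp = (\<lambda>p q. tclass A B (trep p \<bullet> trep q)),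
     Unit = WUnit,
     TensO = (\<odot>),
     TensM = (\<lambda>p q. tclass A B (ttens A B (trep p) (trep q))),
     ass = (\<lambda>X Y Z. tclass A B (TAss X Y Z)),
     runit = (\<lambda>X. tclass A B (TR X)),
     lunit = (\<lambda>X. tclass A B (TL X)),
     symm = (\<lambda>X Y. tclass A B (TS X Y)) \<rparr>"

text \<open>\<open>\<eta>(a) : B \<rightarrow> A \<otimes> B\<close> and \<open>\<eta> : A \<rightarrow> [B, A \<otimes> B]\<close>.\<close>

definition eta_at :: "('oa, 'ma) smcat \<Rightarrow> ('ob, 'mb) smcat \<Rightarrow> 'oa \<Rightarrow>
    ('ob, 'mb, ('oa, 'ob) word, ('oa, 'ma, 'ob, 'mb) texp set) smfun" where
  "eta_at A B a = \<lparr>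
     fobj = (\<lambda>b\<in>Obj B. WGen a b),
     farr = (\<lambda>g\<in>Arr B. tclass A B (TGenR a g)),
     funit = tclass A B (TBeta a),
     ftens = restrict (\<lambda>(b, b'). tclass A B (TDelta a b b')) (Obj B \<times> Obj B) \<rparr>"

definition eta :: "('oa, 'ma) smcat \<Rightarrow> ('ob, 'mb) smcat \<Rightarrow>
    ('oa, 'ma,
     ('ob, 'mb, ('oa, 'ob) word, ('oa, 'ma, 'ob, 'mb) texp set) smfun,
     ('ob, 'mb, ('oa, 'ob) word, ('oa, 'ma, 'ob, 'mb) texp set) mnt) smfun" where
  "eta A B = \<lparr>
     fobj = (\<lambda>a\<in>Obj A. eta_at A B a),
     farr = (\<lambda>f\<in>Arr A. \<lparr> ndom = eta_at A B (Dom A f), ncod = eta_at A B (Cod A f),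
        ncomp = (\<lambda>b\<in>Obj B. tclass A B (TGenL f b)) \<rparr>),
     funit = \<lparr> ndom = hom_unit B (tensor_cat A B), ncod = eta_at A B (Unit A),
        ncomp = (\<lambda>b\<in>Obj B. tclass A B (TAlpha b)) \<rparr>,
     ftens = restrict (\<lambda>(a, a').
         \<lparr> ndom = hom_tens B (tensor_cat A B) (eta_at A B a) (eta_at A B a'),
           ncod = eta_at A B (a \<otimes>\<^bsub>A\<^esub> a'),
           ncomp = (\<lambda>b\<in>Obj B. tclass A B (TGamma a a' b)) \<rparr>)
       (Obj A \<times> Obj A) \<rparr>"


section \<open>The functors En and Rn\<close>

primrec en_obj :: "('oc, 'mc) smcat \<Rightarrow>
    ('oa, 'ma, ('ob, 'mb, 'oc, 'mc) smfun, ('ob, 'mb, 'oc, 'mc) mnt) smfun \<Rightarrow>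
    ('oa, 'ob) word \<Rightarrow> 'oc" where
  "en_obj C F WUnit = Unit C"
| "en_obj C F (WGen a b) = fobj (fobj F a) b"
| "en_obj C F (X \<odot> Y) = en_obj C F X \<otimes>\<^bsub>C\<^esub> en_obj C F Y"

primrec en_exp :: "('oc, 'mc) smcat \<Rightarrow>
    ('oa, 'ma, ('ob, 'mb, 'oc, 'mc) smfun, ('ob, 'mb, 'oc, 'mc) mnt) smfun \<Rightarrow>
    ('oa, 'ma, 'ob, 'mb) texp \<Rightarrow> 'mc" where
  "en_exp C F (TId X) = Id C (en_obj C F X)"
| "en_exp C F (t \<bullet> u) = en_exp C F t \<cdot>\<^bsub>C\<^esub> en_exp C F u"
| "en_exp C F (TLeft X t) = Id C (en_obj C F X) \<boxtimes>\<^bsub>C\<^esub> en_exp C F t"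
| "en_exp C F (TRight t X) = en_exp C F t \<boxtimes>\<^bsub>C\<^esub> Id C (en_obj C F X)"
| "en_exp C F (TAss X Y Z) = ass C (en_obj C F X) (en_obj C F Y) (en_obj C F Z)"
| "en_exp C F (TAss' X Y Z) = inv_arr C (ass C (en_obj C F X) (en_obj C F Y) (en_obj C F Z))"
| "en_exp C F (TR X) = runit C (en_obj C F X)"
| "en_exp C F (TR' X) = inv_arr C (runit C (en_obj C F X))"
| "en_exp C F (TL X) = lunit C (en_obj C F X)"
| "en_exp C F (TL' X) = inv_arr C (lunit C (en_obj C F X))"
| "en_exp C F (TS X Y) = symm C (en_obj C F X) (en_obj C F Y)"
| "en_exp C F (TAlpha b) = ncomp (funit F) b"
| "en_exp C F (TBeta a) = funit (fobj F a)"
| "en_exp C F (TGamma a a' b) = ncomp (ftens F (a, a')) b"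
| "en_exp C F (TDelta a b b') = ftens (fobj F a) (b, b')"
| "en_exp C F (TGenL f b) = ncomp (farr F f) b"
| "en_exp C F (TGenR a g) = farr (fobj F a) g"

text \<open>\<open>En(F) : A \<otimes> B \<rightarrow> C\<close> for \<open>F : A \<rightarrow> [B, C]\<close>.\<close>

definition En_obj :: "('oa, 'ma) smcat \<Rightarrow> ('ob, 'mb) smcat \<Rightarrow> ('oc, 'mc) smcat \<Rightarrow>
    ('oa, 'ma, ('ob, 'mb, 'oc, 'mc) smfun, ('ob, 'mb, 'oc, 'mc) mnt) smfun \<Rightarrow>
    (('oa, 'ob) word, ('oa, 'ma, 'ob, 'mb) texp set, 'oc, 'mc) smfun" where
  "En_obj A B C F = \<lparr>
     fobj = (\<lambda>X\<in>Obj (tensor_cat A B). en_obj C F X),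
     farr = (\<lambda>p\<in>Arr (tensor_cat A B). en_exp C F (trep p)),
     funit = Id C (Unit C),
     ftens = restrict (\<lambda>(X, Y). Id C (en_obj C F X \<otimes>\<^bsub>C\<^esub> en_obj C F Y))
       (Obj (tensor_cat A B) \<times> Obj (tensor_cat A B)) \<rparr>"

primrec en_nt :: "('oc, 'mc) smcat \<Rightarrow>
    ('oa, 'ma, ('ob, 'mb, 'oc, 'mc) smfun, ('ob, 'mb, 'oc, 'mc) mnt) mnt \<Rightarrow>
    ('oa, 'ob) word \<Rightarrow> 'mc" where
  "en_nt C \<sigma> WUnit = Id C (Unit C)"
| "en_nt C \<sigma> (WGen a b) = ncomp (ncomp \<sigma> a) b"
| "en_nt C \<sigma> (X \<odot> Y) = en_nt C \<sigma> X \<boxtimes>\<^bsub>C\<^esub> en_nt C \<sigma> Y"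

definition En_arr :: "('oa, 'ma) smcat \<Rightarrow> ('ob, 'mb) smcat \<Rightarrow> ('oc, 'mc) smcat \<Rightarrow>
    ('oa, 'ma, ('ob, 'mb, 'oc, 'mc) smfun, ('ob, 'mb, 'oc, 'mc) mnt) mnt \<Rightarrow>
    (('oa, 'ob) word, ('oa, 'ma, 'ob, 'mb) texp set, 'oc, 'mc) mnt" where
  "En_arr A B C \<sigma> = \<lparr> ndom = En_obj A B C (ndom \<sigma>), ncod = En_obj A B C (ncod \<sigma>),
     ncomp = (\<lambda>X\<in>Obj (tensor_cat A B). en_nt C \<sigma> X) \<rparr>"

text \<open>\<open>Rn(F) : A \<rightarrow> [B, C]\<close> for \<open>F : A \<otimes> B \<rightarrow> C\<close>, and the strict functor
  \<open>Rn : [A \<otimes> B, C] \<rightarrow> [A, [B, C]]\<close>.\<close>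

definition Rn_obj :: "('oa, 'ma) smcat \<Rightarrow> ('ob, 'mb) smcat \<Rightarrow> ('oc, 'mc) smcat \<Rightarrow>
    (('oa, 'ob) word, ('oa, 'ma, 'ob, 'mb) texp set, 'oc, 'mc) smfun \<Rightarrow>
    ('oa, 'ma, ('ob, 'mb, 'oc, 'mc) smfun, ('ob, 'mb, 'oc, 'mc) mnt) smfun" where
  "Rn_obj A B C F =
     smf_comp A (hom_cat B C) (hom_post B (tensor_cat A B) C F) (eta A B)"

definition Rn :: "('oa, 'ma) smcat \<Rightarrow> ('ob, 'mb) smcat \<Rightarrow> ('oc, 'mc) smcat \<Rightarrow>
    ((('oa, 'ob) word, ('oa, 'ma, 'ob, 'mb) texp set, 'oc, 'mc) smfun,
     (('oa, 'ob) word, ('oa, 'ma, 'ob, 'mb) texp set, 'oc, 'mc) mnt,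
     ('oa, 'ma, ('ob, 'mb, 'oc, 'mc) smfun, ('ob, 'mb, 'oc, 'mc) mnt) smfun,
     ('oa, 'ma, ('ob, 'mb, 'oc, 'mc) smfun, ('ob, 'mb, 'oc, 'mc) mnt) mnt) smfun" where
  "Rn A B C =
     (let S = hom_cat (tensor_cat A B) C; T = hom_cat A (hom_cat B C) in
      \<lparr> fobj = (\<lambda>F\<in>Obj S. Rn_obj A B C F),
        farr = (\<lambda>\<sigma>\<in>Arr S.
          whisker_r A (hom_cat B C) (hom_post_nt B (tensor_cat A B) C \<sigma>) (eta A B)),
        funit = Id T (Unit T),
        ftens = restrict (\<lambda>(F, G). Id T (Rn_obj A B C F \<otimes>\<^bsub>T\<^esub> Rn_obj A B C G)) (Obj S \<times> Obj S) \<rparr>)"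

text \<open>The transformation \<open>\<epsilon>\<^sub>F : En(Rn(F)) \<rightarrow> F\<close>.\<close>

primrec eps_comp :: "('oc, 'mc) smcat \<Rightarrow> (('oa, 'ob) word, 'm, 'oc, 'mc) smfun \<Rightarrow>
    ('oa, 'ob) word \<Rightarrow> 'mc" where
  "eps_comp C F WUnit = funit F"
| "eps_comp C F (WGen a b) = Id C (fobj F (WGen a b))"
| "eps_comp C F (X \<odot> Y) = ftens F (X, Y) \<cdot>\<^bsub>C\<^esub> (eps_comp C F X \<boxtimes>\<^bsub>C\<^esub> eps_comp C F Y)"

definition eps :: "('oa, 'ma) smcat \<Rightarrow> ('ob, 'mb) smcat \<Rightarrow> ('oc, 'mc) smcat \<Rightarrow>
    (('oa, 'ob) word, ('oa, 'ma, 'ob, 'mb) texp set, 'oc, 'mc) smfun \<Rightarrow>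
    (('oa, 'ob) word, ('oa, 'ma, 'ob, 'mb) texp set, 'oc, 'mc) mnt" where
  "eps A B C F = \<lparr> ndom = En_obj A B C (Rn_obj A B C F), ncod = F,
     ncomp = (\<lambda>X\<in>Obj (tensor_cat A B). eps_comp C F X) \<rparr>"

text \<open>The strong functor \<open>En : [A, [B, C]] \<rightarrow> [A \<otimes> B, C]\<close>.\<close>

definition En :: "('oa, 'ma) smcat \<Rightarrow> ('ob, 'mb) smcat \<Rightarrow> ('oc, 'mc) smcat \<Rightarrow>
    (('oa, 'ma, ('ob, 'mb, 'oc, 'mc) smfun, ('ob, 'mb, 'oc, 'mc) mnt) smfun,
     ('oa, 'ma, ('ob, 'mb, 'oc, 'mc) smfun, ('ob, 'mb, 'oc, 'mc) mnt) mnt,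
     (('oa, 'ob) word, ('oa, 'ma, 'ob, 'mb) texp set, 'oc, 'mc) smfun,
     (('oa, 'ob) word, ('oa, 'ma, 'ob, 'mb) texp set, 'oc, 'mc) mnt) smfun" where
  "En A B C =
     (let S = hom_cat A (hom_cat B C); T = hom_cat (tensor_cat A B) C in
      \<lparr> fobj = (\<lambda>F\<in>Obj S. En_obj A B C F),
        farr = (\<lambda>\<sigma>\<in>Arr S. En_arr A B C \<sigma>),
        funit = inv_arr T (eps A B C (Unit T)),
        ftens = restrict (\<lambda>(F, G).
            inv_arr T (eps A B C (En_obj A B C F \<otimes>\<^bsub>T\<^esub> En_obj A B C G)))
          (Obj S \<times> Obj S) \<rparr>)"


section \<open>The associativity arrows\<close>

type_synonym ('oa, 'ob, 'oc) lword = "(('oa, 'ob) word, 'oc) word"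
type_synonym ('oa, 'ob, 'oc) rword = "('oa, ('ob, 'oc) word) word"
type_synonym ('oa, 'ma, 'ob, 'mb, 'oc, 'mc) larr =
  "(('oa, 'ob) word, ('oa, 'ma, 'ob, 'mb) texp set, 'oc, 'mc) texp set"
type_synonym ('oa, 'ma, 'ob, 'mb, 'oc, 'mc) rarr =
  "('oa, 'ma, ('ob, 'oc) word, ('ob, 'mb, 'oc, 'mc) texp set) texp set"

text \<open>\<open>A\<^sub>A\<^sub>,\<^sub>B\<^sub>,\<^sub>C : A \<otimes> (B \<otimes> C) \<rightarrow> (A \<otimes> B) \<otimes> C\<close>.\<close>

definition assoc_fun :: "('oa, 'ma) smcat \<Rightarrow> ('ob, 'mb) smcat \<Rightarrow> ('oc, 'mc) smcat \<Rightarrow>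
    (('oa, 'ob, 'oc) rword, ('oa, 'ma, 'ob, 'mb, 'oc, 'mc) rarr,
     ('oa, 'ob, 'oc) lword, ('oa, 'ma, 'ob, 'mb, 'oc, 'mc) larr) smfun" where
  "assoc_fun A B C =
     (let AB = tensor_cat A B; BC = tensor_cat B C; D = tensor_cat AB C in
      En_obj A BC D
        (smf_comp A (hom_cat BC D) (En B C D)
          (smf_comp A (hom_cat B (hom_cat C D))
            (hom_post B AB (hom_cat C D) (eta AB C)) (eta A B))))"

text \<open>\<open>A'\<^sub>A\<^sub>,\<^sub>B\<^sub>,\<^sub>C : (A \<otimes> B) \<otimes> C \<rightarrow> A \<otimes> (B \<otimes> C)\<close>.\<close>

definition assoc_fun' :: "('oa, 'ma) smcat \<Rightarrow> ('ob, 'mb) smcat \<Rightarrow> ('oc, 'mc) smcat \<Rightarrow>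
    (('oa, 'ob, 'oc) lword, ('oa, 'ma, 'ob, 'mb, 'oc, 'mc) larr,
     ('oa, 'ob, 'oc) rword, ('oa, 'ma, 'ob, 'mb, 'oc, 'mc) rarr) smfun" where
  "assoc_fun' A B C =
     (let AB = tensor_cat A B; BC = tensor_cat B C; E = tensor_cat A BC;
          K = smf_comp A (hom_cat B (hom_cat C E)) (Rn B C E) (eta A BC)
      in En_obj AB C E (En_obj A B (hom_cat C E) K))"

end

theory Submission
  imports Defs
begin

text \<open>
  The transformation is \<open>En(\<epsilon>\<^sub>\<eta>)\<close>, where \<open>\<eta> : A \<otimes> B \<rightarrow> [C, (A \<otimes> B) \<otimes> C]\<close> and
  \<open>\<epsilon>\<^sub>\<eta> : En(Rn(\<eta>)) \<rightarrow> \<eta>\<close>. Its codomain is \<open>En(\<eta>) = 1\<close>. For its domain, note that \<open>En(Rn(G)) = G\<close>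
  for strict \<open>G\<close>, since all components of \<open>\<epsilon>\<^sub>G\<close> are then identities; hence
  \<open>P \<circ> En(F) = En([B, P] \<circ> F)\<close> for strict \<open>P\<close>. Writing \<open>P\<close> for the first associativity arrow,
  the second one followed by \<open>P\<close> is therefore \<open>En(En([B, [C, P]] \<circ> Rn \<circ> \<eta>))\<close>, and naturality of \<open>Rn\<close>
  together with \<open>Rn \<circ> En = 1\<close> reduces \<open>[B, [C, P]] \<circ> Rn \<circ> \<eta>\<close> to \<open>[B, \<eta>] \<circ> \<eta> = Rn(\<eta>)\<close>.
\<close>

section \<open>Calculus in a symmetric monoidal category\<close>

text \<open>The 2-cell has a direction because \<open>eta\<close> is only lax: the components of
  \<epsilon> at it are built from formal arrows \<alpha> and \<gamma>, for which the presentation of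
  the tensor imposes no inverses. All other comparisons are equalities. They hold as equalities of
  records because functors and transformations are extensional; the price is that every record on
  the way must be shown to be a genuine category, functor or transformation. Two devices carry this
  work. The structure of [A,B] rests on coherence of the interchange isomorphism, obtained from the
  axioms by cancelling invertible arrows. And the presentation of \<open>A \<otimes> B\<close> makes
  a transformation out of En(F) determined by its components at the generators. The structure arrows
  of En are inverses of instances of \<epsilon>, so they start at a tensor of functors and not at
  some En(H). Its laws are therefore checked for the inverse arrows, which do start at En(H) and are
  identities at the generators.\<close>

lemma in_Hom_iff: "f \<in> Hom C a b \<longleftrightarrow> f \<in> Arr C \<and> Dom C f = a \<and> Cod C f = b"
  by (simp add: Hom_def)

definition shuf :: "('o, 'm) smcat \<Rightarrow> 'o \<Rightarrow> 'o \<Rightarrow> 'o \<Rightarrow> 'm" where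
  "shuf C b c d = Comp C (inv_arr C (ass C c b d)) (Comp C (TensM C (symm C b c) (Id C d)) (ass C b c d))"

context sym_mon_cat
begin

lemmas arr_objs [simp] = Dom_closed Cod_closed
lemmas obj_closed [simp] = Unit_closed TensO_closed

lemma Id_simps [simp]:
  assumes "a \<in> Obj C"
  shows "Id C a \<in> Arr C" "Dom C (Id C a) = a" "Cod C (Id C a) = a"
  using Id_closed[OF assms] by (simp_all add: in_Hom_iff)

lemma Comp_simps [simp]:
  assumes "f \<in> Arr C" "g \<in> Arr C" "Dom C g = Cod C f"
  shows "g \<cdot> f \<in> Arr C" "Dom C (g \<cdot> f) = Dom C f" "Cod C (g \<cdot> f) = Cod C g"
  using Comp_closed[of f "Dom C f" "Cod C f" g "Cod C g"] assms by (simp_all add: in_Hom_iff)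

lemma TensM_simps [simp]:
  assumes "f \<in> Arr C" "g \<in> Arr C"
  shows "f \<boxtimes> g \<in> Arr C" "Dom C (f \<boxtimes> g) = Dom C f \<otimes> Dom C g"
    "Cod C (f \<boxtimes> g) = Cod C f \<otimes> Cod C g"
  using TensM_closed[of f "Dom C f" "Cod C f" g "Dom C g" "Cod C g"] assms
  by (simp_all add: in_Hom_iff)

lemma str_simps [simp]:
  assumes "a \<in> Obj C"
  shows "lunit C a \<in> Arr C" "Dom C (lunit C a) = Unit C \<otimes> a" "Cod C (lunit C a) = a"
    "runit C a \<in> Arr C" "Dom C (runit C a) = a \<otimes> Unit C" "Cod C (runit C a) = a"
  using lunit_closed[OF assms] runit_closed[OF assms] by (simp_all add: in_Hom_iff)

lemma symm_simps [simp]: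
  assumes "a \<in> Obj C" "b \<in> Obj C"
  shows "symm C a b \<in> Arr C" "Dom C (symm C a b) = a \<otimes> b" "Cod C (symm C a b) = b \<otimes> a"
  using symm_closed[OF assms] by (simp_all add: in_Hom_iff)

lemma ass_simps [simp]:
  assumes "a \<in> Obj C" "b \<in> Obj C" "c \<in> Obj C"
  shows "ass C a b c \<in> Arr C" "Dom C (ass C a b c) = a \<otimes> (b \<otimes> c)"
    "Cod C (ass C a b c) = (a \<otimes> b) \<otimes> c"
  using ass_closed[OF assms] by (simp_all add: in_Hom_iff)

lemma Comp_Id_simp [simp]: "f \<in> Arr C \<Longrightarrow> Dom C f = a \<Longrightarrow> f \<cdot> Id C a = f"
  using Comp_Id[of f a "Cod C f"] by (simp add: in_Hom_iff)

lemma Id_Comp_simp [simp]: "f \<in> Arr C \<Longrightarrow> Cod C f = a \<Longrightarrow> Id C a \<cdot> f = f"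
  using Id_Comp[of f "Dom C f" a] by (simp add: in_Hom_iff)

lemma Comp_assoc_simp [simp]:
  "f \<in> Arr C \<Longrightarrow> g \<in> Arr C \<Longrightarrow> h \<in> Arr C \<Longrightarrow> Dom C g = Cod C f \<Longrightarrow> Dom C h = Cod C g \<Longrightarrow>
   (h \<cdot> g) \<cdot> f = h \<cdot> g \<cdot> f"
  using Comp_assoc[of f "Dom C f" "Cod C f" g "Cod C g" h "Cod C h"] by (simp add: in_Hom_iff)

lemmas TensM_Id_simp [simp] = TensM_Id

lemma TensM_Comp_simp:
  "f \<in> Arr C \<Longrightarrow> f' \<in> Arr C \<Longrightarrow> g \<in> Arr C \<Longrightarrow> g' \<in> Arr C \<Longrightarrow>
   Dom C f' = Cod C f \<Longrightarrow> Dom C g' = Cod C g \<Longrightarrow>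
   (f' \<boxtimes> g') \<cdot> (f \<boxtimes> g) = (f' \<cdot> f) \<boxtimes> (g' \<cdot> g)"
  using TensM_Comp[of f _ _ f' _ g _ _ g'] by (simp add: in_Hom_iff)

text \<open>Composites are kept bracketed to the right, so an equation
  \<open>u \<cdot> v = w\<close> does not match inside a longer composite. This form, and
  \<open>ext3\<close> for three factors, supplies the tail \<open>x\<close>.\<close>

lemma ext2:
  assumes "u \<cdot> v = w" "u \<in> Arr C" "v \<in> Arr C" "Dom C u = Cod C v" "x \<in> Arr C" "Dom C v = Cod C x"
  shows "u \<cdot> v \<cdot> x = w \<cdot> x"
  using assms by (metis Comp_assoc_simp)

lemma ext3:
  assumes "u \<cdot> v \<cdot> v' = w" "u \<in> Arr C" "v \<in> Arr C" "v' \<in> Arr C" "Dom C u = Cod C v"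
    "Dom C v = Cod C v'" "x \<in> Arr C" "Dom C v' = Cod C x"
  shows "u \<cdot> v \<cdot> v' \<cdot> x = w \<cdot> x"
  using assms by (metis Comp_assoc_simp Comp_simps)

lemma TensM_Comp_ext:
  "f \<in> Arr C \<Longrightarrow> f' \<in> Arr C \<Longrightarrow> g \<in> Arr C \<Longrightarrow> g' \<in> Arr C \<Longrightarrow>
   Dom C f' = Cod C f \<Longrightarrow> Dom C g' = Cod C g \<Longrightarrow> x \<in> Arr C \<Longrightarrow> Dom C f \<otimes> Dom C g = Cod C x \<Longrightarrow>
   (f' \<boxtimes> g') \<cdot> (f \<boxtimes> g) \<cdot> x = ((f' \<cdot> f) \<boxtimes> (g' \<cdot> g)) \<cdot> x"
  by (subst ext2[OF TensM_Comp_simp]) auto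

text \<open>As a simp rule it runs against \<open>TensM_Comp_simp\<close>: a whiskered composite is
  split into whiskered factors. Where tensor factors have to be merged, it is deleted or bypassed by
  \<open>subst\<close>.\<close>

lemma whisker_comp [simp]:
  assumes "f \<in> Arr C" "g \<in> Arr C" "Dom C g = Cod C f" "a \<in> Obj C"
  shows "Id C a \<boxtimes> (g \<cdot> f) = (Id C a \<boxtimes> g) \<cdot> (Id C a \<boxtimes> f)"
    "(g \<cdot> f) \<boxtimes> Id C a = (g \<boxtimes> Id C a) \<cdot> (f \<boxtimes> Id C a)"
  using assms TensM_Comp_simp[of "Id C a" "Id C a" f g] TensM_Comp_simp[of f g "Id C a" "Id C a"]
  by auto

subsection \<open>Isomorphisms\<close>

lemma inverse_arrs_unique:
  assumes "inverse_arrs C f g" "inverse_arrs C f h"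
  shows "g = h"
proof -
  have "g = g \<cdot> f \<cdot> h"
    using assms by (auto simp: inverse_arrs_def in_Hom_iff)
  also have "\<dots> = (g \<cdot> f) \<cdot> h"
    using assms by (subst Comp_assoc_simp) (auto simp: inverse_arrs_def in_Hom_iff)
  also have "\<dots> = h"
    using assms by (auto simp: inverse_arrs_def in_Hom_iff)
  finally show ?thesis .
qed

lemma inv_arr_eqI: "inverse_arrs C f g \<Longrightarrow> inv_arr C f = g"
  unfolding inv_arr_def using inverse_arrs_unique by blast

lemma inverse_inv_arr: "is_iso C f \<Longrightarrow> inverse_arrs C f (inv_arr C f)"
  using inv_arr_eqI unfolding is_iso_def by auto

lemma is_isoI: "inverse_arrs C f g \<Longrightarrow> is_iso C f"
  by (auto simp: is_iso_def)

lemma is_iso_Arr: "is_iso C f \<Longrightarrow> f \<in> Arr C"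
  by (auto simp: is_iso_def inverse_arrs_def)

lemma inv_arr_simps [simp]:
  assumes "is_iso C f"
  shows "inv_arr C f \<in> Arr C" "Dom C (inv_arr C f) = Cod C f" "Cod C (inv_arr C f) = Dom C f"
    "inv_arr C f \<cdot> f = Id C (Dom C f)" "f \<cdot> inv_arr C f = Id C (Cod C f)"
  using inverse_inv_arr[OF assms] by (auto simp: inverse_arrs_def in_Hom_iff)

lemma inv_arr_ext [simp]:
  assumes "is_iso C f" "x \<in> Arr C"
  shows "Cod C x = Dom C f \<Longrightarrow> inv_arr C f \<cdot> f \<cdot> x = x"
    "Cod C x = Cod C f \<Longrightarrow> f \<cdot> inv_arr C f \<cdot> x = x"
  using assms is_iso_Arr[OF assms(1)] ext2[OF inv_arr_simps(4)[OF assms(1)], of x]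
    ext2[OF inv_arr_simps(5)[OF assms(1)], of x] by auto

lemma inverse_arrs_sym: "inverse_arrs C f g \<Longrightarrow> inverse_arrs C g f"
  by (auto simp: inverse_arrs_def in_Hom_iff)

lemma is_iso_inv [simp]: "is_iso C f \<Longrightarrow> is_iso C (inv_arr C f)"
  using inverse_inv_arr inverse_arrs_sym unfolding is_iso_def by blast

lemma inverse_arrs_Comp:
  assumes "is_iso C f" "is_iso C g" "Dom C g = Cod C f"
  shows "inverse_arrs C (g \<cdot> f) (inv_arr C f \<cdot> inv_arr C g)"
  using assms is_iso_Arr[OF assms(1)] is_iso_Arr[OF assms(2)]
  by (auto simp: inverse_arrs_def in_Hom_iff)

lemma is_iso_Comp [simp]: "is_iso C f \<Longrightarrow> is_iso C g \<Longrightarrow> Dom C g = Cod C f \<Longrightarrow> is_iso C (g \<cdot> f)"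
  by (rule is_isoI) (rule inverse_arrs_Comp)

lemma inverse_arrs_TensM:
  assumes "is_iso C f" "is_iso C g"
  shows "inverse_arrs C (f \<boxtimes> g) (inv_arr C f \<boxtimes> inv_arr C g)"
  using assms is_iso_Arr[OF assms(1)] is_iso_Arr[OF assms(2)]
  by (auto simp: inverse_arrs_def in_Hom_iff TensM_Comp_simp)

lemma is_iso_TensM [simp]: "is_iso C f \<Longrightarrow> is_iso C g \<Longrightarrow> is_iso C (f \<boxtimes> g)"
  by (rule is_isoI) (rule inverse_arrs_TensM)

lemma inv_Comp:
  "is_iso C f \<Longrightarrow> is_iso C g \<Longrightarrow> Dom C g = Cod C f \<Longrightarrow> inv_arr C (g \<cdot> f) = inv_arr C f \<cdot> inv_arr C g"
  by (rule inv_arr_eqI) (rule inverse_arrs_Comp)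

lemma inv_TensM: "is_iso C f \<Longrightarrow> is_iso C g \<Longrightarrow> inv_arr C (f \<boxtimes> g) = inv_arr C f \<boxtimes> inv_arr C g"
  by (rule inv_arr_eqI) (rule inverse_arrs_TensM)

lemma inverse_arrs_Id: "a \<in> Obj C \<Longrightarrow> inverse_arrs C (Id C a) (Id C a)"
  by (auto simp: inverse_arrs_def in_Hom_iff)

lemma inv_Id [simp]: "a \<in> Obj C \<Longrightarrow> inv_arr C (Id C a) = Id C a"
  by (rule inv_arr_eqI) (rule inverse_arrs_Id)

lemma is_iso_Id [simp]: "a \<in> Obj C \<Longrightarrow> is_iso C (Id C a)"
  by (rule is_isoI) (rule inverse_arrs_Id)

lemmas iso_simps [simp] = ass_iso runit_iso lunit_iso

lemma inverse_arrs_symm: "a \<in> Obj C \<Longrightarrow> b \<in> Obj C \<Longrightarrow> inverse_arrs C (symm C a b) (symm C b a)"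
  by (auto simp: inverse_arrs_def in_Hom_iff symm_symm)

lemma symm_is_iso [simp]: "a \<in> Obj C \<Longrightarrow> b \<in> Obj C \<Longrightarrow> is_iso C (symm C a b)"
  by (rule is_isoI) (rule inverse_arrs_symm)

lemma iso_monic:
  assumes "f \<cdot> x = f \<cdot> y" "is_iso C f" "x \<in> Arr C" "y \<in> Arr C" "Cod C x = Dom C f" "Cod C y = Dom C f"
  shows "x = y"
  using assms by (metis inv_arr_ext(1))

lemma iso_epic:
  assumes "x \<cdot> f = y \<cdot> f" "is_iso C f" "x \<in> Arr C" "y \<in> Arr C" "Dom C x = Cod C f" "Dom C y = Cod C f"
  shows "x = y"
proof -
  have "(x \<cdot> f) \<cdot> inv_arr C f = (y \<cdot> f) \<cdot> inv_arr C f"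
    using assms(1) by simp
  then show ?thesis
    using assms(2-) is_iso_Arr[OF assms(2)] by auto
qed

lemma inv_arr_move_left:
  assumes "f \<cdot> x = y" "is_iso C f" "x \<in> Arr C" "Cod C x = Dom C f"
  shows "x = inv_arr C f \<cdot> y"
  using assms by auto

text \<open>A commuting square with two opposite invertible sides is reflected along them. This
  carries naturality over to formal inverses, and oplax laws over to lax ones.\<close>

lemma inv_swap:
  assumes "q \<cdot> x = y \<cdot> p" "is_iso C p" "is_iso C q" "x \<in> Arr C" "y \<in> Arr C"
    "Dom C x = Dom C p" "Dom C y = Cod C p" "Cod C x = Dom C q" "Cod C y = Cod C q"
  shows "x \<cdot> inv_arr C p = inv_arr C q \<cdot> y"
proof -
  note p = is_iso_Arr[OF assms(2)] and q = is_iso_Arr[OF assms(3)]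
  have "x \<cdot> inv_arr C p = inv_arr C q \<cdot> (q \<cdot> x) \<cdot> inv_arr C p"
    using assms(2-) p q by simp
  also have "\<dots> = inv_arr C q \<cdot> (y \<cdot> p) \<cdot> inv_arr C p"
    by (simp only: assms(1))
  also have "\<dots> = inv_arr C q \<cdot> y"
    using assms(2-) p q by simp
  finally show ?thesis .
qed

subsection \<open>Unit coherence\<close>

lemma ass_nat:
  "f \<in> Arr C \<Longrightarrow> g \<in> Arr C \<Longrightarrow> h \<in> Arr C \<Longrightarrow> Cod C f = a \<Longrightarrow> Cod C g = b \<Longrightarrow> Cod C h = c \<Longrightarrow>
   ass C a b c \<cdot> (f \<boxtimes> g \<boxtimes> h) = ((f \<boxtimes> g) \<boxtimes> h) \<cdot> ass C (Dom C f) (Dom C g) (Dom C h)"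
  using ass_natural[of f "Dom C f" a g "Dom C g" b h "Dom C h" c] by (simp add: in_Hom_iff)

lemma ass_nat_ext:
  "f \<in> Arr C \<Longrightarrow> g \<in> Arr C \<Longrightarrow> h \<in> Arr C \<Longrightarrow> Cod C f = a \<Longrightarrow> Cod C g = b \<Longrightarrow> Cod C h = c \<Longrightarrow>
   x \<in> Arr C \<Longrightarrow> Cod C x = Dom C f \<otimes> Dom C g \<otimes> Dom C h \<Longrightarrow>
   ass C a b c \<cdot> (f \<boxtimes> g \<boxtimes> h) \<cdot> x = ((f \<boxtimes> g) \<boxtimes> h) \<cdot> ass C (Dom C f) (Dom C g) (Dom C h) \<cdot> x"
  by (subst ext2[OF ass_nat]) auto

lemma ass_nat_l:
  "f \<in> Arr C \<Longrightarrow> Dom C f = a \<Longrightarrow> b \<in> Obj C \<Longrightarrow> c \<in> Obj C \<Longrightarrow>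
   ((f \<boxtimes> Id C b) \<boxtimes> Id C c) \<cdot> ass C a b c = ass C (Cod C f) b c \<cdot> (f \<boxtimes> Id C (b \<otimes> c))"
  using ass_nat[of f "Id C b" "Id C c" "Cod C f" b c] by auto

lemma ass_nat_l_ext:
  "f \<in> Arr C \<Longrightarrow> Dom C f = a \<Longrightarrow> b \<in> Obj C \<Longrightarrow> c \<in> Obj C \<Longrightarrow> x \<in> Arr C \<Longrightarrow> Cod C x = a \<otimes> b \<otimes> c \<Longrightarrow>
   ((f \<boxtimes> Id C b) \<boxtimes> Id C c) \<cdot> ass C a b c \<cdot> x = ass C (Cod C f) b c \<cdot> (f \<boxtimes> Id C (b \<otimes> c)) \<cdot> x"
  by (subst ext2[OF ass_nat_l]) auto

lemma ass_nat_r: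
  "f \<in> Arr C \<Longrightarrow> Dom C f = c \<Longrightarrow> a \<in> Obj C \<Longrightarrow> b \<in> Obj C \<Longrightarrow>
   (Id C (a \<otimes> b) \<boxtimes> f) \<cdot> ass C a b c = ass C a b (Cod C f) \<cdot> (Id C a \<boxtimes> Id C b \<boxtimes> f)"
  using ass_nat[of "Id C a" "Id C b" f a b "Cod C f"] by auto

lemma ass_nat_r_ext:
  "f \<in> Arr C \<Longrightarrow> Dom C f = c \<Longrightarrow> a \<in> Obj C \<Longrightarrow> b \<in> Obj C \<Longrightarrow> x \<in> Arr C \<Longrightarrow> Cod C x = a \<otimes> b \<otimes> c \<Longrightarrow>
   (Id C (a \<otimes> b) \<boxtimes> f) \<cdot> ass C a b c \<cdot> x = ass C a b (Cod C f) \<cdot> (Id C a \<boxtimes> Id C b \<boxtimes> f) \<cdot> x"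
  by (subst ext2[OF ass_nat_r]) auto

lemma lunit_nat:
  "f \<in> Arr C \<Longrightarrow> Cod C f = a \<Longrightarrow> lunit C a \<cdot> (Id C (Unit C) \<boxtimes> f) = f \<cdot> lunit C (Dom C f)"
  using lunit_natural[of f "Dom C f" a] by (simp add: in_Hom_iff)

lemma runit_nat:
  "f \<in> Arr C \<Longrightarrow> Cod C f = a \<Longrightarrow> runit C a \<cdot> (f \<boxtimes> Id C (Unit C)) = f \<cdot> runit C (Dom C f)"
  using runit_natural[of f "Dom C f" a] by (simp add: in_Hom_iff)

lemma symm_nat:
  "f \<in> Arr C \<Longrightarrow> g \<in> Arr C \<Longrightarrow> Cod C f = a \<Longrightarrow> Cod C g = b \<Longrightarrow>
   symm C a b \<cdot> (f \<boxtimes> g) = (g \<boxtimes> f) \<cdot> symm C (Dom C f) (Dom C g)"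
  using symm_natural[of f "Dom C f" a g "Dom C g" b] by (simp add: in_Hom_iff)

text \<open>Tensoring with the unit is naturally isomorphic to the identity through the unitors,
  hence faithful. Unit coherence can therefore be tested after one more tensor with
  \<open>Unit C\<close>, where the pentagon becomes available.\<close>

lemma tens_unit_faithful:
  assumes "f \<in> Arr C" "g \<in> Arr C" "Dom C f = Dom C g" "Cod C f = Cod C g"
  shows "Id C (Unit C) \<boxtimes> f = Id C (Unit C) \<boxtimes> g \<Longrightarrow> f = g"
    "f \<boxtimes> Id C (Unit C) = g \<boxtimes> Id C (Unit C) \<Longrightarrow> f = g"
proof -
  assume "Id C (Unit C) \<boxtimes> f = Id C (Unit C) \<boxtimes> g"
  then have "f \<cdot> lunit C (Dom C f) = g \<cdot> lunit C (Dom C f)"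
    using assms lunit_nat[of f] lunit_nat[of g] by metis
  then show "f = g"
    by (rule iso_epic) (use assms in auto)
next
  assume "f \<boxtimes> Id C (Unit C) = g \<boxtimes> Id C (Unit C)"
  then have "f \<cdot> runit C (Dom C f) = g \<cdot> runit C (Dom C f)"
    using assms runit_nat[of f] runit_nat[of g] by metis
  then show "f = g"
    by (rule iso_epic) (use assms in auto)
qed

lemma pentagon':
  assumes "a \<in> Obj C" "b \<in> Obj C" "c \<in> Obj C" "d \<in> Obj C"
  shows "(ass C a b c \<boxtimes> Id C d) \<cdot> ass C a (b \<otimes> c) d \<cdot> (Id C a \<boxtimes> ass C b c d) =
    ass C (a \<otimes> b) c d \<cdot> ass C a b (c \<otimes> d)"
  using pentagon[OF assms] by simp

lemma pentagon_ext:
  assumes "a \<in> Obj C" "b \<in> Obj C" "c \<in> Obj C" "d \<in> Obj C" "x \<in> Arr C" "Cod C x = a \<otimes> b \<otimes> c \<otimes> d"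
  shows "(ass C a b c \<boxtimes> Id C d) \<cdot> ass C a (b \<otimes> c) d \<cdot> (Id C a \<boxtimes> ass C b c d) \<cdot> x =
    ass C (a \<otimes> b) c d \<cdot> ass C a b (c \<otimes> d) \<cdot> x"
  using assms by (subst ext3[OF pentagon']) auto

text \<open>Kelly's argument: after tensoring with \<open>Unit C\<close> on the left, the pentagon
  for I, I, b, c relates the two sides, since \<open>triangle\<close> trades a left-whiskered
  \<open>lunit\<close> for a right-whiskered \<open>runit\<close> after an associativity.\<close>

lemma lunit_tens:
  assumes "b \<in> Obj C" "c \<in> Obj C"
  shows "(lunit C b \<boxtimes> Id C c) \<cdot> ass C (Unit C) b c = lunit C (b \<otimes> c)"
proof (rule tens_unit_faithful(1))
  let ?I = "Unit C"
  have "ass C ?I b c \<cdot> (Id C ?I \<boxtimes> ((lunit C b \<boxtimes> Id C c) \<cdot> ass C ?I b c)) =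
     ((Id C ?I \<boxtimes> lunit C b) \<boxtimes> Id C c) \<cdot> ass C ?I (?I \<otimes> b) c \<cdot> (Id C ?I \<boxtimes> ass C ?I b c)"
    using assms by (simp add: ass_nat_ext)
  also have "\<dots> = ((runit C ?I \<boxtimes> Id C b) \<boxtimes> Id C c) \<cdot>
      (ass C ?I ?I b \<boxtimes> Id C c) \<cdot> ass C ?I (?I \<otimes> b) c \<cdot> (Id C ?I \<boxtimes> ass C ?I b c)"
    using assms by (simp flip: triangle)
  also have "\<dots> = ((runit C ?I \<boxtimes> Id C b) \<boxtimes> Id C c) \<cdot> ass C (?I \<otimes> ?I) b c \<cdot> ass C ?I ?I (b \<otimes> c)"
    using assms by (simp add: pentagon')
  also have "\<dots> = ass C ?I b c \<cdot> (runit C ?I \<boxtimes> Id C (b \<otimes> c)) \<cdot> ass C ?I ?I (b \<otimes> c)"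
    using assms by (simp add: ass_nat_l_ext)
  also have "\<dots> = ass C ?I b c \<cdot> (Id C ?I \<boxtimes> lunit C (b \<otimes> c))"
    using assms by (simp add: triangle)
  finally show "Id C ?I \<boxtimes> ((lunit C b \<boxtimes> Id C c) \<cdot> ass C ?I b c) = Id C ?I \<boxtimes> lunit C (b \<otimes> c)"
    by (rule iso_monic) (use assms in auto)
qed (use assms in auto)

text \<open>The mirror image, with the unit tensored on the right and the pentagon for a, b, I,
  I.\<close>

lemma runit_tens:
  assumes "a \<in> Obj C" "b \<in> Obj C"
  shows "runit C (a \<otimes> b) \<cdot> ass C a b (Unit C) = Id C a \<boxtimes> runit C b"
proof (rule tens_unit_faithful(2))
  let ?I = "Unit C"
  have "((runit C (a \<otimes> b) \<cdot> ass C a b ?I) \<boxtimes> Id C ?I) \<cdot> ass C a (b \<otimes> ?I) ?I \<cdot> (Id C a \<boxtimes> ass C b ?I ?I)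
      = (runit C (a \<otimes> b) \<boxtimes> Id C ?I) \<cdot> ass C (a \<otimes> b) ?I ?I \<cdot> ass C a b (?I \<otimes> ?I)"
    using assms by (simp add: pentagon')
  also have "\<dots> = (Id C (a \<otimes> b) \<boxtimes> lunit C ?I) \<cdot> ass C a b (?I \<otimes> ?I)"
    using assms by (simp add: ext2[OF triangle])
  also have "\<dots> = ass C a b ?I \<cdot> (Id C a \<boxtimes> Id C b \<boxtimes> lunit C ?I)"
    using assms by (simp add: ass_nat_r)
  also have "\<dots> = ass C a b ?I \<cdot> (Id C a \<boxtimes> (runit C b \<boxtimes> Id C ?I)) \<cdot> (Id C a \<boxtimes> ass C b ?I ?I)"
    using assms by (simp flip: triangle)
  also have "\<dots> = ((Id C a \<boxtimes> runit C b) \<boxtimes> Id C ?I) \<cdot> ass C a (b \<otimes> ?I) ?I \<cdot> (Id C a \<boxtimes> ass C b ?I ?I)"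
    using assms by (simp add: ass_nat_ext)
  finally show "((runit C (a \<otimes> b) \<cdot> ass C a b ?I) \<boxtimes> Id C ?I) = (Id C a \<boxtimes> runit C b) \<boxtimes> Id C ?I"
    by (rule iso_epic) (use assms in auto)
qed (use assms in auto)

text \<open>Naturality of \<open>lunit\<close> at \<open>lunit C (Unit C)\<close>, with
  \<open>lunit\<close> cancelled, gives \<open>lunit (I \<otimes> I) = I \<otimes> lunit I\<close>;
  then \<open>lunit_tens\<close> and \<open>triangle\<close> compute the two sides.\<close>

lemma lunit_Unit: "lunit C (Unit C) = runit C (Unit C)"
proof (rule tens_unit_faithful(2))
  let ?I = "Unit C"
  have "lunit C (?I \<otimes> ?I) = Id C ?I \<boxtimes> lunit C ?I"
    by (rule iso_monic[of "lunit C ?I"]) (auto simp: lunit_nat)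
  then have "(lunit C ?I \<boxtimes> Id C ?I) \<cdot> ass C ?I ?I ?I = (runit C ?I \<boxtimes> Id C ?I) \<cdot> ass C ?I ?I ?I"
    by (simp add: lunit_tens triangle)
  then show "lunit C ?I \<boxtimes> Id C ?I = runit C ?I \<boxtimes> Id C ?I"
    by (rule iso_epic) auto
qed auto

lemma symm_unit':
  assumes "a \<in> Obj C"
  shows "runit C a \<cdot> symm C (Unit C) a = lunit C a"
  using assms by (simp flip: symm_unit add: symm_symm)

subsection \<open>The interchange isomorphism\<close>

text \<open>The coherence properties of \<open>interchange\<close> reduce to those of the simpler isomorphism
  \<open>shuf b c d : b \<otimes> (c \<otimes> d) \<rightarrow> c \<otimes> (b \<otimes> d)\<close>, which is natural between the functors
  \<open>b \<otimes> (c \<otimes> -)\<close> and \<open>c \<otimes> (b \<otimes> -)\<close>; composites of such functors are strictly associative.\<close>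

lemma shuf_simps [simp]:
  assumes "b \<in> Obj C" "c \<in> Obj C" "d \<in> Obj C"
  shows "shuf C b c d \<in> Arr C" "Dom C (shuf C b c d) = b \<otimes> c \<otimes> d"
    "Cod C (shuf C b c d) = c \<otimes> b \<otimes> d" "is_iso C (shuf C b c d)"
  using assms by (auto simp: shuf_def)

lemma ass_shuf:
  assumes "b \<in> Obj C" "c \<in> Obj C" "d \<in> Obj C"
  shows "ass C c b d \<cdot> shuf C b c d = (symm C b c \<boxtimes> Id C d) \<cdot> ass C b c d"
  using assms by (simp add: shuf_def)

lemma shuf_shuf:
  assumes "b \<in> Obj C" "c \<in> Obj C" "d \<in> Obj C"
  shows "shuf C c b d \<cdot> shuf C b c d = Id C (b \<otimes> c \<otimes> d)"
  using assms ext2[OF TensM_Comp_simp, of "symm C b c" "symm C c b" "Id C d" "Id C d" "ass C b c d"]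
  by (simp add: shuf_def symm_symm)

lemma inv_shuf:
  "b \<in> Obj C \<Longrightarrow> c \<in> Obj C \<Longrightarrow> d \<in> Obj C \<Longrightarrow> inv_arr C (shuf C b c d) = shuf C c b d"
  by (rule inv_arr_eqI) (auto simp: inverse_arrs_def in_Hom_iff shuf_shuf)

lemma shuf_nat:
  assumes "f \<in> Arr C" "g \<in> Arr C" "h \<in> Arr C" "Cod C f = b" "Cod C g = c" "Cod C h = d"
  shows "shuf C b c d \<cdot> (f \<boxtimes> g \<boxtimes> h) = (g \<boxtimes> f \<boxtimes> h) \<cdot> shuf C (Dom C f) (Dom C g) (Dom C h)"
proof (rule iso_monic[of "ass C c b d"])
  have "ass C c b d \<cdot> shuf C b c d \<cdot> (f \<boxtimes> g \<boxtimes> h) =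
     (symm C b c \<boxtimes> Id C d) \<cdot> ((f \<boxtimes> g) \<boxtimes> h) \<cdot> ass C (Dom C f) (Dom C g) (Dom C h)" (is "?l = _")
    using assms by (auto simp: ext2[OF ass_shuf] ass_nat)
  also have "\<dots> = ((g \<boxtimes> f) \<boxtimes> h) \<cdot> (symm C (Dom C f) (Dom C g) \<boxtimes> Id C (Dom C h)) \<cdot> ass C (Dom C f) (Dom C g) (Dom C h)"
    using assms by (auto simp: TensM_Comp_ext symm_nat)
  also have "\<dots> = ass C c b d \<cdot> (g \<boxtimes> f \<boxtimes> h) \<cdot> shuf C (Dom C f) (Dom C g) (Dom C h)"
    using assms by (auto simp: ass_shuf ass_nat_ext)
  finally show "?l = \<dots>" .
qed (use assms in auto)

text \<open>\<open>shuf\<close> moves the first two factors only, so rebracketing what stands to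
  their right commutes with it. Cancelling an associativity turns \<open>shuf\<close> into
  \<open>symm\<close>; two pentagons and naturality remain.\<close>

lemma shuf_ass:
  assumes "b \<in> Obj C" "c \<in> Obj C" "d \<in> Obj C" "e \<in> Obj C"
  shows "(shuf C b c d \<boxtimes> Id C e) \<cdot> ass C b (c \<otimes> d) e \<cdot> (Id C b \<boxtimes> ass C c d e) =
    ass C c (b \<otimes> d) e \<cdot> (Id C c \<boxtimes> ass C b d e) \<cdot> shuf C b c (d \<otimes> e)"
proof (rule iso_monic[of "ass C c b d \<boxtimes> Id C e"])
  have "(ass C c b d \<boxtimes> Id C e) \<cdot> (shuf C b c d \<boxtimes> Id C e) \<cdot> ass C b (c \<otimes> d) e \<cdot> (Id C b \<boxtimes> ass C c d e)
    = ((ass C c b d \<cdot> shuf C b c d) \<boxtimes> Id C e) \<cdot> ass C b (c \<otimes> d) e \<cdot> (Id C b \<boxtimes> ass C c d e)" (is "?l = _")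
    using assms by simp
  also have "\<dots> = ((symm C b c \<boxtimes> Id C d) \<boxtimes> Id C e) \<cdot> ass C (b \<otimes> c) d e \<cdot> ass C b c (d \<otimes> e)"
    using assms by (simp add: ass_shuf pentagon' del: whisker_comp(2)) (simp add: pentagon')
  also have "\<dots> = ass C (c \<otimes> b) d e \<cdot> (symm C b c \<boxtimes> Id C (d \<otimes> e)) \<cdot> ass C b c (d \<otimes> e)"
    using assms by (simp add: ass_nat_l_ext)
  also have "\<dots> = (ass C c b d \<boxtimes> Id C e) \<cdot> ass C c (b \<otimes> d) e \<cdot> (Id C c \<boxtimes> ass C b d e) \<cdot> shuf C b c (d \<otimes> e)"
    using assms by (simp add: pentagon_ext ass_shuf)
  finally show "?l = \<dots>" .
qed (use assms in auto)

text \<open>This is the hexagon in terms of \<open>shuf\<close>: to carry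
  \<open>x \<otimes> y\<close> past \<open>c\<close>, carry \<open>y\<close> first and then
  \<open>x\<close>.\<close>

lemma shuf_tens_left:
  assumes "x \<in> Obj C" "y \<in> Obj C" "c \<in> Obj C" "d \<in> Obj C"
  shows "shuf C (x \<otimes> y) c d \<cdot> ass C x y (c \<otimes> d) =
    (Id C c \<boxtimes> ass C x y d) \<cdot> shuf C x c (y \<otimes> d) \<cdot> (Id C x \<boxtimes> shuf C y c d)"
proof (rule iso_monic[of "(ass C c x y \<boxtimes> Id C d) \<cdot> ass C c (x \<otimes> y) d"])
  have "(ass C c x y \<boxtimes> Id C d) \<cdot> ass C c (x \<otimes> y) d \<cdot> shuf C (x \<otimes> y) c d \<cdot> ass C x y (c \<otimes> d)
    = (ass C c x y \<boxtimes> Id C d) \<cdot> (symm C (x \<otimes> y) c \<boxtimes> Id C d) \<cdot> ass C (x \<otimes> y) c d \<cdot> ass C x y (c \<otimes> d)"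
    using assms by (simp add: ext2[OF ass_shuf])
  also have "\<dots> = ((ass C c x y \<cdot> symm C (x \<otimes> y) c \<cdot> ass C x y c) \<boxtimes> Id C d) \<cdot> ass C x (y \<otimes> c) d \<cdot> (Id C x \<boxtimes> ass C y c d)"
    using assms by (simp add: pentagon')
  also have "\<dots> = ((symm C x c \<boxtimes> Id C y) \<boxtimes> Id C d) \<cdot> (ass C x c y \<boxtimes> Id C d) \<cdot>
      ass C x (c \<otimes> y) d \<cdot> (Id C x \<boxtimes> (symm C y c \<boxtimes> Id C d)) \<cdot> (Id C x \<boxtimes> ass C y c d)"
    using assms by (subst hexagon) (auto simp: ass_nat_ext)
  also have "\<dots> = ((symm C x c \<boxtimes> Id C y) \<boxtimes> Id C d) \<cdot> (ass C x c y \<boxtimes> Id C d) \<cdot>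
      ass C x (c \<otimes> y) d \<cdot> (Id C x \<boxtimes> ass C c y d) \<cdot> (Id C x \<boxtimes> shuf C y c d)"
    using assms by (simp flip: whisker_comp add: ass_shuf)
  also have "\<dots> = ass C (c \<otimes> x) y d \<cdot> (symm C x c \<boxtimes> Id C (y \<otimes> d)) \<cdot> ass C x c (y \<otimes> d) \<cdot> (Id C x \<boxtimes> shuf C y c d)"
    using assms by (simp add: pentagon_ext ass_nat_l_ext)
  also have "\<dots> = (ass C c x y \<boxtimes> Id C d) \<cdot> ass C c (x \<otimes> y) d \<cdot>
      (Id C c \<boxtimes> ass C x y d) \<cdot> shuf C x c (y \<otimes> d) \<cdot> (Id C x \<boxtimes> shuf C y c d)"
    using assms by (simp add: pentagon_ext ext2[OF ass_shuf])
  finally show "((ass C c x y \<boxtimes> Id C d) \<cdot> ass C c (x \<otimes> y) d) \<cdot> shuf C (x \<otimes> y) c d \<cdot> ass C x y (c \<otimes> d)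
    = ((ass C c x y \<boxtimes> Id C d) \<cdot> ass C c (x \<otimes> y) d) \<cdot>
      (Id C c \<boxtimes> ass C x y d) \<cdot> shuf C x c (y \<otimes> d) \<cdot> (Id C x \<boxtimes> shuf C y c d)"
    using assms by simp
qed (use assms in auto)

text \<open>Follows from \<open>shuf_tens_left\<close> on passing to inverses, as exchanging the
  first two arguments of \<open>shuf\<close> inverts it.\<close>

lemma shuf_tens_right:
  assumes "x \<in> Obj C" "b \<in> Obj C" "c \<in> Obj C" "d \<in> Obj C"
  shows "shuf C x (b \<otimes> c) d \<cdot> (Id C x \<boxtimes> ass C b c d) =
    ass C b c (x \<otimes> d) \<cdot> (Id C b \<boxtimes> shuf C x c d) \<cdot> shuf C x b (c \<otimes> d)"
proof -
  let ?L = "shuf C (b \<otimes> c) x d \<cdot> ass C b c (x \<otimes> d)"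
  let ?g = "(Id C b \<boxtimes> shuf C x c d) \<cdot> shuf C x b (c \<otimes> d)"
  have "?L \<cdot> ?g = (Id C x \<boxtimes> ass C b c d) \<cdot> shuf C b x (c \<otimes> d) \<cdot>
     ((Id C b \<boxtimes> shuf C c x d) \<cdot> (Id C b \<boxtimes> shuf C x c d)) \<cdot> shuf C x b (c \<otimes> d)"
    using assms by (subst shuf_tens_left) auto
  also have "\<dots> = Id C x \<boxtimes> ass C b c d"
    using assms by (subst TensM_Comp_simp) (auto simp: shuf_shuf)
  finally have "shuf C (b \<otimes> c) x d \<cdot> ass C b c (x \<otimes> d) \<cdot> ?g = Id C x \<boxtimes> ass C b c d"
    using assms by simp
  from inv_arr_move_left[OF this] show ?thesis
    using assms by (simp add: inv_shuf)
qed

section \<open>Naturality, associativity, symmetry and unit laws of the interchange\<close>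

lemma interchange_eq:
  assumes "a \<in> Obj C" "b \<in> Obj C" "c \<in> Obj C" "d \<in> Obj C"
  shows "interchange C a b c d = ass C a c (b \<otimes> d) \<cdot> (Id C a \<boxtimes> shuf C b c d) \<cdot> inv_arr C (ass C a b (c \<otimes> d))"
  using assms by (simp add: interchange_def shuf_def Let_def)

lemma interchange_simps [simp]:
  assumes "a \<in> Obj C" "b \<in> Obj C" "c \<in> Obj C" "d \<in> Obj C"
  shows "interchange C a b c d \<in> Arr C" "Dom C (interchange C a b c d) = (a \<otimes> b) \<otimes> (c \<otimes> d)"
    "Cod C (interchange C a b c d) = (a \<otimes> c) \<otimes> (b \<otimes> d)" "is_iso C (interchange C a b c d)"
  using assms by (auto simp: interchange_eq)

lemma interchange_ass:
  assumes "a \<in> Obj C" "b \<in> Obj C" "c \<in> Obj C" "d \<in> Obj C"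
  shows "interchange C a b c d \<cdot> ass C a b (c \<otimes> d) = ass C a c (b \<otimes> d) \<cdot> (Id C a \<boxtimes> shuf C b c d)"
  using assms by (simp add: interchange_eq)

lemma interchange_ass_ext:
  assumes "a \<in> Obj C" "b \<in> Obj C" "c \<in> Obj C" "d \<in> Obj C" "x \<in> Arr C" "Cod C x = a \<otimes> b \<otimes> c \<otimes> d"
  shows "interchange C a b c d \<cdot> ass C a b (c \<otimes> d) \<cdot> x = ass C a c (b \<otimes> d) \<cdot> (Id C a \<boxtimes> shuf C b c d) \<cdot> x"
  using assms by (subst ext2[OF interchange_ass]) auto

lemma interchange_interchange:
  assumes "a \<in> Obj C" "b \<in> Obj C" "c \<in> Obj C" "d \<in> Obj C"
  shows "interchange C a c b d \<cdot> interchange C a b c d = Id C ((a \<otimes> b) \<otimes> (c \<otimes> d))"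
  using assms by (simp add: interchange_eq TensM_Comp_ext shuf_shuf)

lemma interchange_nat:
  assumes "f \<in> Arr C" "g \<in> Arr C" "h \<in> Arr C" "k \<in> Arr C"
    "Cod C f = a" "Cod C g = b" "Cod C h = c" "Cod C k = d"
  shows "interchange C a b c d \<cdot> ((f \<boxtimes> g) \<boxtimes> (h \<boxtimes> k)) =
    ((f \<boxtimes> h) \<boxtimes> (g \<boxtimes> k)) \<cdot> interchange C (Dom C f) (Dom C g) (Dom C h) (Dom C k)"
proof (rule iso_epic[of _ "ass C (Dom C f) (Dom C g) (Dom C h \<otimes> Dom C k)"])
  have "(interchange C a b c d \<cdot> ((f \<boxtimes> g) \<boxtimes> (h \<boxtimes> k))) \<cdot> ass C (Dom C f) (Dom C g) (Dom C h \<otimes> Dom C k)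
    = interchange C a b c d \<cdot> ass C a b (c \<otimes> d) \<cdot> (f \<boxtimes> g \<boxtimes> h \<boxtimes> k)" (is "?l = _")
    using assms by (auto simp: ass_nat)
  also have "\<dots> = ass C a c (b \<otimes> d) \<cdot> ((Id C a \<boxtimes> shuf C b c d) \<cdot> (f \<boxtimes> g \<boxtimes> h \<boxtimes> k))"
    using assms by (auto simp: interchange_ass_ext)
  also have "\<dots> = ass C a c (b \<otimes> d) \<cdot> (f \<boxtimes> h \<boxtimes> g \<boxtimes> k) \<cdot> (Id C (Dom C f) \<boxtimes> shuf C (Dom C g) (Dom C h) (Dom C k))"
    using assms by (auto simp: TensM_Comp_simp shuf_nat)
  also have "\<dots> = (((f \<boxtimes> h) \<boxtimes> (g \<boxtimes> k)) \<cdot> interchange C (Dom C f) (Dom C g) (Dom C h) (Dom C k)) \<cdot>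
      ass C (Dom C f) (Dom C g) (Dom C h \<otimes> Dom C k)"
    using assms by (auto simp: interchange_ass ass_nat_ext)
  finally show "?l = \<dots>" .
qed (use assms in auto)

text \<open>The coherence behind the associativity law of a pointwise tensor
  \<open>hom_tens\<close>. Both sides move \<open>a'\<close> past \<open>b\<close> and
  \<open>c\<close>, and \<open>b'\<close> past \<open>c\<close>; they agree because both reduce to
  the same three shuffles.\<close>

lemma interchange_hexagon:
  assumes "a \<in> Obj C" "a' \<in> Obj C" "b \<in> Obj C" "b' \<in> Obj C" "c \<in> Obj C" "c' \<in> Obj C"
  shows "(ass C a b c \<boxtimes> ass C a' b' c') \<cdot> interchange C a a' (b \<otimes> c) (b' \<otimes> c') \<cdot>
      (Id C (a \<otimes> a') \<boxtimes> interchange C b b' c c') =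
    interchange C (a \<otimes> b) (a' \<otimes> b') c c' \<cdot> (interchange C a a' b b' \<boxtimes> Id C (c \<otimes> c')) \<cdot>
      ass C (a \<otimes> a') (b \<otimes> b') (c \<otimes> c')" (is "?L = ?R")
proof (rule iso_epic)
  \<comment> \<open>\<open>?J\<close> starts at the six factors bracketed to the right, where
    \<open>interchange_ass\<close> turns an \<open>interchange\<close> into a whiskered
    \<open>shuf\<close>. \<open>?N\<close> below is the common value, shuffling \<open>b'\<close>
    past \<open>c\<close>, then \<open>a'\<close> past \<open>b\<close>, then \<open>a'\<close> past
    \<open>c\<close>.\<close>
  let ?J = "ass C a a' ((b \<otimes> b') \<otimes> (c \<otimes> c')) \<cdot> (Id C a \<boxtimes> Id C a' \<boxtimes> ass C b b' (c \<otimes> c'))"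
  let ?z = "b' \<otimes> c'" and ?w = "c \<otimes> c'"
  let ?N = "ass C (a \<otimes> b) c ((a' \<otimes> b') \<otimes> c') \<cdot> ass C a b (c \<otimes> (a' \<otimes> b') \<otimes> c') \<cdot>
    (Id C a \<boxtimes> Id C b \<boxtimes> Id C c \<boxtimes> ass C a' b' c') \<cdot> (Id C a \<boxtimes> Id C b \<boxtimes> shuf C a' c ?z) \<cdot>
    (Id C a \<boxtimes> shuf C a' b (c \<otimes> ?z)) \<cdot> (Id C a \<boxtimes> Id C a' \<boxtimes> Id C b \<boxtimes> shuf C b' c c')"
  have tt: "ass C a b c \<boxtimes> ass C a' b' c' =
      (Id C ((a \<otimes> b) \<otimes> c) \<boxtimes> ass C a' b' c') \<cdot> (ass C a b c \<boxtimes> Id C (a' \<otimes> ?z))"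
    using assms by (simp add: TensM_Comp_simp)
  have "?L \<cdot> ?J = (ass C a b c \<boxtimes> ass C a' b' c') \<cdot> interchange C a a' (b \<otimes> c) ?z \<cdot>
      ass C a a' ((b \<otimes> c) \<otimes> ?z) \<cdot> (Id C a \<boxtimes> Id C a' \<boxtimes> (interchange C b b' c c' \<cdot> ass C b b' (c \<otimes> c')))"
    using assms by (simp add: ass_nat_r_ext)
  also have "\<dots> = (ass C a b c \<boxtimes> ass C a' b' c') \<cdot> ass C a (b \<otimes> c) (a' \<otimes> ?z) \<cdot>
      (Id C a \<boxtimes> (shuf C a' (b \<otimes> c) ?z \<cdot> (Id C a' \<boxtimes> ass C b c ?z))) \<cdot>
      (Id C a \<boxtimes> Id C a' \<boxtimes> Id C b \<boxtimes> shuf C b' c c')"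
    using assms by (simp add: interchange_ass interchange_ass_ext)
  also have "\<dots> = (ass C a b c \<boxtimes> ass C a' b' c') \<cdot> ass C a (b \<otimes> c) (a' \<otimes> ?z) \<cdot>
      (Id C a \<boxtimes> ass C b c (a' \<otimes> ?z)) \<cdot> (Id C a \<boxtimes> Id C b \<boxtimes> shuf C a' c ?z) \<cdot>
      (Id C a \<boxtimes> shuf C a' b (c \<otimes> ?z)) \<cdot> (Id C a \<boxtimes> Id C a' \<boxtimes> Id C b \<boxtimes> shuf C b' c c')"
    using assms by (subst shuf_tens_right) auto
  also have "\<dots>     = (Id C ((a \<otimes> b) \<otimes> c) \<boxtimes> ass C a' b' c') \<cdot> ass C (a \<otimes> b) c (a' \<otimes> ?z) \<cdot> ass C a b (c \<otimes> a' \<otimes> ?z) \<cdot>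
      (Id C a \<boxtimes> Id C b \<boxtimes> shuf C a' c ?z) \<cdot>
      (Id C a \<boxtimes> shuf C a' b (c \<otimes> ?z)) \<cdot> (Id C a \<boxtimes> Id C a' \<boxtimes> Id C b \<boxtimes> shuf C b' c c')"
    using assms by (subst tt) (simp add: pentagon_ext)
  also have "\<dots> = ?N"
    using assms by (simp add: ass_nat_r_ext)
  finally have L: "?L \<cdot> ?J = ?N" .
  have "?R \<cdot> ?J = interchange C (a \<otimes> b) (a' \<otimes> b') c c' \<cdot> (interchange C a a' b b' \<boxtimes> Id C ?w) \<cdot>
     (ass C a a' (b \<otimes> b') \<boxtimes> Id C ?w) \<cdot> ass C a (a' \<otimes> b \<otimes> b') ?w \<cdot> (Id C a \<boxtimes> ass C a' (b \<otimes> b') ?w) \<cdot>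
     (Id C a \<boxtimes> Id C a' \<boxtimes> ass C b b' ?w)"
    using assms by (simp add: pentagon_ext)
  also have "\<dots> = interchange C (a \<otimes> b) (a' \<otimes> b') c c' \<cdot> ((interchange C a a' b b' \<cdot> ass C a a' (b \<otimes> b')) \<boxtimes> Id C ?w) \<cdot>
     ass C a (a' \<otimes> b \<otimes> b') ?w \<cdot> (Id C a \<boxtimes> ass C a' (b \<otimes> b') ?w) \<cdot>
     (Id C a \<boxtimes> Id C a' \<boxtimes> ass C b b' ?w)"
    using assms by simp
  also have "\<dots> = interchange C (a \<otimes> b) (a' \<otimes> b') c c' \<cdot> (ass C a b (a' \<otimes> b') \<boxtimes> Id C ?w) \<cdot>
     ((Id C a \<boxtimes> shuf C a' b b') \<boxtimes> Id C ?w) \<cdot>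
     ass C a (a' \<otimes> b \<otimes> b') ?w \<cdot> (Id C a \<boxtimes> (ass C a' (b \<otimes> b') ?w \<cdot> (Id C a' \<boxtimes> ass C b b' ?w)))"
    using assms by (subst interchange_ass) auto
  also have "\<dots> = interchange C (a \<otimes> b) (a' \<otimes> b') c c' \<cdot> (ass C a b (a' \<otimes> b') \<boxtimes> Id C ?w) \<cdot>
     ass C a (b \<otimes> a' \<otimes> b') ?w \<cdot>
     (Id C a \<boxtimes> ((shuf C a' b b' \<boxtimes> Id C ?w) \<cdot> ass C a' (b \<otimes> b') ?w \<cdot> (Id C a' \<boxtimes> ass C b b' ?w)))"
    using assms by (simp add: ass_nat_ext)
  also have "\<dots> = interchange C (a \<otimes> b) (a' \<otimes> b') c c' \<cdot> ass C (a \<otimes> b) (a' \<otimes> b') ?w \<cdot> ass C a b ((a' \<otimes> b') \<otimes> ?w) \<cdot>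
     (Id C a \<boxtimes> Id C b \<boxtimes> ass C a' b' ?w) \<cdot> (Id C a \<boxtimes> shuf C a' b (b' \<otimes> ?w))"
    using assms by (subst shuf_ass) (auto simp: pentagon_ext)
  also have "\<dots> = ass C (a \<otimes> b) c ((a' \<otimes> b') \<otimes> c') \<cdot> ass C a b (c \<otimes> (a' \<otimes> b') \<otimes> c') \<cdot>
     (Id C a \<boxtimes> Id C b \<boxtimes> (shuf C (a' \<otimes> b') c c' \<cdot> ass C a' b' ?w)) \<cdot> (Id C a \<boxtimes> shuf C a' b (b' \<otimes> ?w))"
    using assms by (simp add: interchange_ass_ext ass_nat_r_ext)
  also have "\<dots> = ass C (a \<otimes> b) c ((a' \<otimes> b') \<otimes> c') \<cdot> ass C a b (c \<otimes> (a' \<otimes> b') \<otimes> c') \<cdot>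
     (Id C a \<boxtimes> Id C b \<boxtimes> Id C c \<boxtimes> ass C a' b' c') \<cdot> (Id C a \<boxtimes> Id C b \<boxtimes> shuf C a' c ?z) \<cdot>
     (Id C a \<boxtimes> ((Id C b \<boxtimes> Id C a' \<boxtimes> shuf C b' c c') \<cdot> shuf C a' b (b' \<otimes> ?w)))"
    using assms by (subst shuf_tens_left) auto
  also have "(Id C b \<boxtimes> Id C a' \<boxtimes> shuf C b' c c') \<cdot> shuf C a' b (b' \<otimes> ?w) =
     shuf C a' b (c \<otimes> ?z) \<cdot> (Id C a' \<boxtimes> Id C b \<boxtimes> shuf C b' c c')"
    using assms by (subst shuf_nat) auto
  finally have R: "?R \<cdot> ?J = ?N"
    using assms by simp
  show "?L \<cdot> ?J = ?R \<cdot> ?J"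
    using L R by simp
qed (use assms in auto)

lemma symm_shuf:
  assumes "b \<in> Obj C" "c \<in> Obj C" "d \<in> Obj C"
  shows "symm C c (b \<otimes> d) \<cdot> shuf C b c d = ass C b d c \<cdot> (Id C b \<boxtimes> symm C c d)"
proof (rule iso_monic[of "symm C (b \<otimes> d) c"])
  have "ass C c b d \<cdot> symm C (b \<otimes> d) c \<cdot> ass C b d c \<cdot> (Id C b \<boxtimes> symm C c d) =
    ((symm C b c \<boxtimes> Id C d) \<cdot> ass C b c d \<cdot> (Id C b \<boxtimes> symm C d c)) \<cdot> (Id C b \<boxtimes> symm C c d)"
    using assms by (simp flip: hexagon)
  also have "\<dots> = ass C c b d \<cdot> shuf C b c d"
    using assms by (simp add: TensM_Comp_simp symm_symm ass_shuf)
  finally have "symm C (b \<otimes> d) c \<cdot> ass C b d c \<cdot> (Id C b \<boxtimes> symm C c d) = shuf C b c d"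
    by (rule iso_monic) (use assms in auto)
  then show "symm C (b \<otimes> d) c \<cdot> symm C c (b \<otimes> d) \<cdot> shuf C b c d =
     symm C (b \<otimes> d) c \<cdot> ass C b d c \<cdot> (Id C b \<boxtimes> symm C c d)"
    using assms by (simp add: ext2[OF symm_symm])
qed (use assms in auto)

lemma interchange_symm:
  assumes "a \<in> Obj C" "b \<in> Obj C" "c \<in> Obj C" "d \<in> Obj C"
  shows "symm C (a \<otimes> c) (b \<otimes> d) \<cdot> interchange C a b c d =
    interchange C b a d c \<cdot> (symm C a b \<boxtimes> symm C c d)"
proof (rule iso_epic)
  let ?J = "ass C a b (c \<otimes> d)"
  have "ass C (b \<otimes> d) a c \<cdot> (symm C (a \<otimes> c) (b \<otimes> d) \<cdot> interchange C a b c d) \<cdot> ?J =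
    ass C (b \<otimes> d) a c \<cdot> symm C (a \<otimes> c) (b \<otimes> d) \<cdot> ass C a c (b \<otimes> d) \<cdot> (Id C a \<boxtimes> shuf C b c d)"
    using assms by (simp add: interchange_ass)
  also have "\<dots> = (symm C a (b \<otimes> d) \<boxtimes> Id C c) \<cdot> ass C a (b \<otimes> d) c \<cdot> (Id C a \<boxtimes> (symm C c (b \<otimes> d) \<cdot> shuf C b c d))"
    using assms by (simp add: ext3[OF hexagon])
  also have "\<dots> = ((symm C a (b \<otimes> d) \<boxtimes> Id C c) \<cdot> ass C a (b \<otimes> d) c) \<cdot> (Id C a \<boxtimes> ass C b d c) \<cdot> (Id C a \<boxtimes> Id C b \<boxtimes> symm C c d)"
    using assms by (subst symm_shuf) auto
  also have "\<dots> = ass C (b \<otimes> d) a c \<cdot> shuf C a (b \<otimes> d) c \<cdot> (Id C a \<boxtimes> ass C b d c) \<cdot> (Id C a \<boxtimes> Id C b \<boxtimes> symm C c d)"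
    using assms by (subst ass_shuf[symmetric]) auto
  also have "\<dots> = ass C (b \<otimes> d) a c \<cdot> ass C b d (a \<otimes> c) \<cdot> (Id C b \<boxtimes> shuf C a d c) \<cdot> shuf C a b (d \<otimes> c) \<cdot> (Id C a \<boxtimes> Id C b \<boxtimes> symm C c d)"
    using assms by (simp add: ext2[OF shuf_tens_right])
  finally have L: "(symm C (a \<otimes> c) (b \<otimes> d) \<cdot> interchange C a b c d) \<cdot> ?J =
      ass C b d (a \<otimes> c) \<cdot> (Id C b \<boxtimes> shuf C a d c) \<cdot> shuf C a b (d \<otimes> c) \<cdot> (Id C a \<boxtimes> Id C b \<boxtimes> symm C c d)"
    by (rule iso_monic) (use assms in auto)
  have "symm C a b \<boxtimes> symm C c d = (symm C a b \<boxtimes> Id C (d \<otimes> c)) \<cdot> (Id C (a \<otimes> b) \<boxtimes> symm C c d)"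
    using assms by (simp add: TensM_Comp_simp)
  then have "(interchange C b a d c \<cdot> (symm C a b \<boxtimes> symm C c d)) \<cdot> ?J =
      interchange C b a d c \<cdot> ((symm C a b \<boxtimes> Id C (d \<otimes> c)) \<cdot> ass C a b (d \<otimes> c)) \<cdot> (Id C a \<boxtimes> Id C b \<boxtimes> symm C c d)"
    using assms by (simp add: ass_nat_r)
  also have "\<dots> = interchange C b a d c \<cdot> ass C b a (d \<otimes> c) \<cdot> shuf C a b (d \<otimes> c) \<cdot> (Id C a \<boxtimes> Id C b \<boxtimes> symm C c d)"
    using assms by (subst ass_shuf[symmetric]) auto
  also have "\<dots> = (symm C (a \<otimes> c) (b \<otimes> d) \<cdot> interchange C a b c d) \<cdot> ?J"
    using assms by (subst L) (simp add: interchange_ass_ext)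
  finally show "(symm C (a \<otimes> c) (b \<otimes> d) \<cdot> interchange C a b c d) \<cdot> ?J =
      (interchange C b a d c \<cdot> (symm C a b \<boxtimes> symm C c d)) \<cdot> ?J" by (simp only:)
qed (use assms in auto)

text \<open>Exchanging the two middle arguments of \<open>interchange\<close> inverts it, so a
  square with interchanges on two sides can be turned around. Both forms are used: one makes a
  pointwise tensor a functor, the other makes a pointwise structure arrow monoidal.\<close>

lemma interchange_conj:
  assumes "a \<in> Obj C" "b \<in> Obj C" "c \<in> Obj C" "d \<in> Obj C" "p \<in> Obj C" "q \<in> Obj C" "r \<in> Obj C" "s \<in> Obj C"
    and "x \<in> Arr C" "y \<in> Arr C" "Dom C x = (a \<otimes> c) \<otimes> (b \<otimes> d)" "Dom C y = (a \<otimes> b) \<otimes> (c \<otimes> d)"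
     "Cod C x = (p \<otimes> r) \<otimes> (q \<otimes> s)" "Cod C y = (p \<otimes> q) \<otimes> (r \<otimes> s)"
    and "interchange C p r q s \<cdot> x = y \<cdot> interchange C a c b d"
  shows "x \<cdot> interchange C a b c d = interchange C p q r s \<cdot> y"
proof -
  have "x \<cdot> interchange C a b c d = interchange C p q r s \<cdot> (interchange C p r q s \<cdot> x) \<cdot> interchange C a b c d"
    using assms(1-14) by (simp add: ext2[OF interchange_interchange])
  also have "\<dots> = interchange C p q r s \<cdot> y"
    unfolding assms(15) using assms(1-14) by (simp add: interchange_interchange)
  finally show ?thesis .
qed

lemma interchange_symm':
  assumes "a \<in> Obj C" "b \<in> Obj C" "c \<in> Obj C" "d \<in> Obj C"
  shows "(symm C a c \<boxtimes> symm C b d) \<cdot> interchange C a b c d =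
    interchange C c d a b \<cdot> symm C (a \<otimes> b) (c \<otimes> d)"
  using assms by (intro interchange_conj) (auto simp: interchange_symm)

text \<open>Turned around from \<open>interchange_hexagon\<close>: composed with the invertible
  \<open>?x\<close>, both sides become \<open>?A\<close>. In this form it makes the pointwise
  associativity of [A,B] a monoidal transformation.\<close>

lemma interchange_hexagon':
  assumes "a \<in> Obj C" "a' \<in> Obj C" "b \<in> Obj C" "b' \<in> Obj C" "c \<in> Obj C" "c' \<in> Obj C"
  shows "ass C (a \<otimes> a') (b \<otimes> b') (c \<otimes> c') \<cdot> (Id C (a \<otimes> a') \<boxtimes> interchange C b c b' c') \<cdot>
       interchange C a (b \<otimes> c) a' (b' \<otimes> c') =
    (interchange C a b a' b' \<boxtimes> Id C (c \<otimes> c')) \<cdot> interchange C (a \<otimes> b) c (a' \<otimes> b') c' \<cdot>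
      (ass C a b c \<boxtimes> ass C a' b' c')"
proof -
  let ?x = "interchange C (a \<otimes> b) (a' \<otimes> b') c c' \<cdot> (interchange C a a' b b' \<boxtimes> Id C (c \<otimes> c'))"
  let ?y = "interchange C a a' (b \<otimes> c) (b' \<otimes> c') \<cdot> (Id C (a \<otimes> a') \<boxtimes> interchange C b b' c c')"
  let ?A = "ass C a b c \<boxtimes> ass C a' b' c'" and ?B = "ass C (a \<otimes> a') (b \<otimes> b') (c \<otimes> c')"
  have "?x \<cdot> (?B \<cdot> (Id C (a \<otimes> a') \<boxtimes> interchange C b c b' c') \<cdot> interchange C a (b \<otimes> c) a' (b' \<otimes> c')) =
     (interchange C (a \<otimes> b) (a' \<otimes> b') c c' \<cdot> (interchange C a a' b b' \<boxtimes> Id C (c \<otimes> c')) \<cdot> ?B) \<cdot>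
       (Id C (a \<otimes> a') \<boxtimes> interchange C b c b' c') \<cdot> interchange C a (b \<otimes> c) a' (b' \<otimes> c')"
    using assms by simp
  also have "\<dots> = (?A \<cdot> interchange C a a' (b \<otimes> c) (b' \<otimes> c')) \<cdot>
      ((Id C (a \<otimes> a') \<boxtimes> interchange C b b' c c') \<cdot> (Id C (a \<otimes> a') \<boxtimes> interchange C b c b' c')) \<cdot>
      interchange C a (b \<otimes> c) a' (b' \<otimes> c')"
    using assms by (subst interchange_hexagon[symmetric]) auto
  also have "\<dots> = ?A"
    using assms by (subst TensM_Comp_simp) (auto simp: interchange_interchange)
  also have "\<dots> = interchange C (a \<otimes> b) (a' \<otimes> b') c c' \<cdot> ((interchange C a a' b b' \<boxtimes> Id C (c \<otimes> c')) \<cdot>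
     (interchange C a b a' b' \<boxtimes> Id C (c \<otimes> c'))) \<cdot> interchange C (a \<otimes> b) c (a' \<otimes> b') c' \<cdot> ?A"
    using assms by (subst TensM_Comp_simp) (auto simp: interchange_interchange ext2[OF interchange_interchange])
  also have "\<dots> = ?x \<cdot> ((interchange C a b a' b' \<boxtimes> Id C (c \<otimes> c')) \<cdot> interchange C (a \<otimes> b) c (a' \<otimes> b') c' \<cdot> ?A)"
    using assms by simp
  finally show ?thesis
    by (rule iso_monic) (use assms in auto)
qed

text \<open>With units in the last two places, \<open>shuf\<close> carries \<open>b\<close> past the
  unit and is absorbed by a unitor (fact \<open>1\<close>); \<open>triangle\<close> and
  \<open>runit_tens\<close> do the rest.\<close>

lemma interchange_runit:
  assumes "a \<in> Obj C" "b \<in> Obj C"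
  shows "(runit C a \<boxtimes> runit C b) \<cdot> interchange C a b (Unit C) (Unit C) =
    runit C (a \<otimes> b) \<cdot> (Id C (a \<otimes> b) \<boxtimes> lunit C (Unit C))"
proof (rule iso_epic)
  let ?I = "Unit C"
  let ?J = "ass C a b (?I \<otimes> ?I)"
  have 1: "lunit C (b \<otimes> ?I) \<cdot> shuf C b ?I ?I = Id C b \<boxtimes> lunit C ?I"
  proof -
    have "lunit C (b \<otimes> ?I) \<cdot> shuf C b ?I ?I = (lunit C b \<boxtimes> Id C ?I) \<cdot> ass C ?I b ?I \<cdot> shuf C b ?I ?I"
      using assms by (simp flip: lunit_tens)
    also have "\<dots> = ((lunit C b \<cdot> symm C b ?I) \<boxtimes> Id C ?I) \<cdot> ass C b ?I ?I"
      using assms by (simp add: ass_shuf)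
    also have "\<dots> = Id C b \<boxtimes> lunit C ?I"
      using assms by (subst symm_unit) (auto simp: triangle)
    finally show ?thesis .
  qed
  have "((runit C a \<boxtimes> runit C b) \<cdot> interchange C a b ?I ?I) \<cdot> ?J =
     ((Id C a \<boxtimes> runit C b) \<cdot> (runit C a \<boxtimes> Id C (b \<otimes> ?I))) \<cdot> ass C a ?I (b \<otimes> ?I) \<cdot> (Id C a \<boxtimes> shuf C b ?I ?I)" (is "?l = _")
    using assms by (subst TensM_Comp_simp) (auto simp: interchange_ass)
  also have "\<dots> = (Id C a \<boxtimes> runit C b) \<cdot> (Id C a \<boxtimes> (lunit C (b \<otimes> ?I) \<cdot> shuf C b ?I ?I))"
    using assms by (simp add: ext2[OF triangle])
  also have "\<dots> = (Id C a \<boxtimes> runit C b) \<cdot> (Id C a \<boxtimes> Id C b \<boxtimes> lunit C ?I)"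
    by (simp add: 1)
  also have "\<dots> = (runit C (a \<otimes> b) \<cdot> (Id C (a \<otimes> b) \<boxtimes> lunit C ?I)) \<cdot> ?J"
    using assms by (simp add: ass_nat_r ext2[OF runit_tens])
  finally show "?l = \<dots>" .
qed (use assms in auto)

text \<open>Conjugating \<open>interchange_runit\<close> by the symmetry exchanges left and right
  unitors.\<close>

lemma interchange_lunit:
  assumes "a \<in> Obj C" "b \<in> Obj C"
  shows "(lunit C a \<boxtimes> lunit C b) \<cdot> interchange C (Unit C) (Unit C) a b =
    lunit C (a \<otimes> b) \<cdot> (lunit C (Unit C) \<boxtimes> Id C (a \<otimes> b))"
proof -
  let ?I = "Unit C"
  have "(lunit C a \<boxtimes> lunit C b) \<cdot> interchange C ?I ?I a b =
     (runit C a \<boxtimes> runit C b) \<cdot> (symm C ?I a \<boxtimes> symm C ?I b) \<cdot> interchange C ?I ?I a b"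
    using assms by (simp add: TensM_Comp_ext symm_unit')
  also have "\<dots> = runit C (a \<otimes> b) \<cdot> (Id C (a \<otimes> b) \<boxtimes> lunit C ?I) \<cdot> symm C (?I \<otimes> ?I) (a \<otimes> b)"
    using assms by (simp add: interchange_symm' ext2[OF interchange_runit])
  also have "\<dots> = runit C (a \<otimes> b) \<cdot> symm C ?I (a \<otimes> b) \<cdot> (lunit C ?I \<boxtimes> Id C (a \<otimes> b))"
    using assms by (simp add: symm_nat)
  also have "\<dots> = lunit C (a \<otimes> b) \<cdot> (lunit C ?I \<boxtimes> Id C (a \<otimes> b))"
    using assms by (simp add: ext2[OF symm_unit'])
  finally show ?thesis .
qed

lemma interchange_nat_r:
  assumes "a \<in> Obj C" "b \<in> Obj C" "h \<in> Arr C" "k \<in> Arr C" "Cod C h = c" "Cod C k = d"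
  shows "interchange C a b c d \<cdot> (Id C (a \<otimes> b) \<boxtimes> (h \<boxtimes> k)) =
    ((Id C a \<boxtimes> h) \<boxtimes> (Id C b \<boxtimes> k)) \<cdot> interchange C a b (Dom C h) (Dom C k)"
  using interchange_nat[of "Id C a" "Id C b" h k a b c d] assms by auto

lemma interchange_nat_l:
  assumes "a \<in> Obj C" "b \<in> Obj C" "h \<in> Arr C" "k \<in> Arr C" "Cod C h = c" "Cod C k = d"
  shows "interchange C c d a b \<cdot> ((h \<boxtimes> k) \<boxtimes> Id C (a \<otimes> b)) =
    ((h \<boxtimes> Id C a) \<boxtimes> (k \<boxtimes> Id C b)) \<cdot> interchange C (Dom C h) (Dom C k) a b"
  using interchange_nat[of h k "Id C a" "Id C b" c d a b] assms by auto

lemma symm_Unit_Unit: "symm C (Unit C) (Unit C) = Id C (Unit C \<otimes> Unit C)"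
  by (rule iso_monic[of "lunit C (Unit C)"]) (simp_all add: symm_unit, simp add: lunit_Unit)

lemma ass_Unit:
  "ass C (Unit C) (Unit C) (Unit C) \<cdot> (Id C (Unit C) \<boxtimes> inv_arr C (lunit C (Unit C))) =
   inv_arr C (lunit C (Unit C)) \<boxtimes> Id C (Unit C)"
proof (rule iso_monic[of "runit C (Unit C) \<boxtimes> Id C (Unit C)"])
  have "(runit C (Unit C) \<boxtimes> Id C (Unit C)) \<cdot> ass C (Unit C) (Unit C) (Unit C) \<cdot> (Id C (Unit C) \<boxtimes> inv_arr C (lunit C (Unit C)))
    = Id C (Unit C) \<boxtimes> (lunit C (Unit C) \<cdot> inv_arr C (lunit C (Unit C)))"
    by (simp add: ext2[OF triangle] TensM_Comp_simp)
  also have "\<dots> = (runit C (Unit C) \<cdot> inv_arr C (runit C (Unit C))) \<boxtimes> Id C (Unit C)"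
    by simp
  also have "\<dots> = (runit C (Unit C) \<boxtimes> Id C (Unit C)) \<cdot> (inv_arr C (lunit C (Unit C)) \<boxtimes> Id C (Unit C))"
    by (subst whisker_comp) (auto simp: lunit_Unit)
  finally show "(runit C (Unit C) \<boxtimes> Id C (Unit C)) \<cdot> ass C (Unit C) (Unit C) (Unit C) \<cdot> (Id C (Unit C) \<boxtimes> inv_arr C (lunit C (Unit C))) = \<dots>" .
qed auto

end

section \<open>Symmetric monoidal functors\<close>

lemma smf_eqI:
  assumes "sym_mon_functor A B F" "sym_mon_functor A B G"
    "\<And>a. a \<in> Obj A \<Longrightarrow> fobj F a = fobj G a" "\<And>f. f \<in> Arr A \<Longrightarrow> farr F f = farr G f"
    "funit F = funit G" "\<And>a b. a \<in> Obj A \<Longrightarrow> b \<in> Obj A \<Longrightarrow> ftens F (a, b) = ftens G (a, b)"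
  shows "F = G"
proof -
  have "fobj F = fobj G" "farr F = farr G" "ftens F = ftens G"
    using sym_mon_functor.fobj_ext[OF assms(1)] sym_mon_functor.fobj_ext[OF assms(2)]
      sym_mon_functor.farr_ext[OF assms(1)] sym_mon_functor.farr_ext[OF assms(2)]
      sym_mon_functor.ftens_ext[OF assms(1)] sym_mon_functor.ftens_ext[OF assms(2)]
    by (auto intro!: extensionalityI[of "fobj F"] extensionalityI[of "farr F"] extensionalityI[of "ftens F"] assms(3-))
  with assms(5) show ?thesis by simp
qed

lemma mnt_eqI:
  assumes "mon_nat_trans A B \<sigma>" "mon_nat_trans A B \<tau>" "ndom \<sigma> = ndom \<tau>" "ncod \<sigma> = ncod \<tau>"
    "\<And>a. a \<in> Obj A \<Longrightarrow> ncomp \<sigma> a = ncomp \<tau> a"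
  shows "\<sigma> = \<tau>"
proof -
  have "ncomp \<sigma> = ncomp \<tau>"
    using assms mon_nat_trans.ncomp_ext by (blast intro: extensionalityI)
  with assms(3,4) show ?thesis by simp
qed

text \<open>The laws are stated for plain maps \<open>ob\<close>, \<open>mo\<close> and
  \<open>t\<close>; restricting them inside the record settles extensionality once and for
  all.\<close>

lemma sym_mon_functorI:
  fixes A :: "('oa, 'ma) smcat" and B :: "('ob, 'mb) smcat" (structure)
  assumes A: "sym_mon_cat A" and B: "sym_mon_cat B"
    and "\<And>a. a \<in> Obj A \<Longrightarrow> ob a \<in> Obj B"
    and "\<And>f. f \<in> Arr A \<Longrightarrow> mo f \<in> Arr B \<and> Dom B (mo f) = ob (Dom A f) \<and> Cod B (mo f) = ob (Cod A f)"
    and "\<And>a. a \<in> Obj A \<Longrightarrow> mo (Id A a) = Id B (ob a)"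
    and "\<And>f g. f \<in> Arr A \<Longrightarrow> g \<in> Arr A \<Longrightarrow> Dom A g = Cod A f \<Longrightarrow> mo (g \<cdot>\<^bsub>A\<^esub> f) = mo g \<cdot> mo f"
    and "u \<in> Arr B \<and> Dom B u = Unit B \<and> Cod B u = ob (Unit A)"
    and "\<And>a b. a \<in> Obj A \<Longrightarrow> b \<in> Obj A \<Longrightarrow> t (a, b) \<in> Arr B \<and> Dom B (t (a, b)) = ob a \<otimes> ob b \<and>
      Cod B (t (a, b)) = ob (a \<otimes>\<^bsub>A\<^esub> b)"
    and "\<And>f g. f \<in> Arr A \<Longrightarrow> g \<in> Arr A \<Longrightarrow>
      mo (f \<boxtimes>\<^bsub>A\<^esub> g) \<cdot> t (Dom A f, Dom A g) = t (Cod A f, Cod A g) \<cdot> (mo f \<boxtimes> mo g)"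
    and "\<And>a b c. a \<in> Obj A \<Longrightarrow> b \<in> Obj A \<Longrightarrow> c \<in> Obj A \<Longrightarrow>
      mo (ass A a b c) \<cdot> t (a, b \<otimes>\<^bsub>A\<^esub> c) \<cdot> (Id B (ob a) \<boxtimes> t (b, c)) =
      t (a \<otimes>\<^bsub>A\<^esub> b, c) \<cdot> (t (a, b) \<boxtimes> Id B (ob c)) \<cdot> ass B (ob a) (ob b) (ob c)"
    and "\<And>a. a \<in> Obj A \<Longrightarrow>
      mo (runit A a) \<cdot> t (a, Unit A) \<cdot> (Id B (ob a) \<boxtimes> u) = runit B (ob a)"
    and "\<And>a. a \<in> Obj A \<Longrightarrow>
      mo (lunit A a) \<cdot> t (Unit A, a) \<cdot> (u \<boxtimes> Id B (ob a)) = lunit B (ob a)"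
    and "\<And>a b. a \<in> Obj A \<Longrightarrow> b \<in> Obj A \<Longrightarrow>
      mo (symm A a b) \<cdot> t (a, b) = t (b, a) \<cdot> symm B (ob a) (ob b)"
  shows "sym_mon_functor A B \<lparr>fobj = restrict ob (Obj A), farr = restrict mo (Arr A),
    funit = u, ftens = restrict t (Obj A \<times> Obj A)\<rparr>"
proof -
  interpret A: sym_mon_cat A by fact
  interpret B: sym_mon_cat B by fact
  show ?thesis
    by unfold_locales (use assms(3-) in \<open>auto simp: in_Hom_iff\<close>)
qed

section \<open>Preservation of isomorphisms and of the interchange by a symmetric monoidal
  functor\<close>

context sym_mon_functor
begin

lemmas fobj_simp [simp] = fobj_closed

lemma farr_simps [simp]:
  assumes "f \<in> Arr A"
  shows "farr F f \<in> Arr B" "Dom B (farr F f) = fobj F (Dom A f)" "Cod B (farr F f) = fobj F (Cod A f)"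
  using farr_closed[of f "Dom A f" "Cod A f"] assms by (auto simp: in_Hom_iff)

lemmas farr_Id_simp [simp] = farr_Id

lemma farr_Comp_simp [simp]:
  "f \<in> Arr A \<Longrightarrow> g \<in> Arr A \<Longrightarrow> Dom A g = Cod A f \<Longrightarrow> farr F (g \<cdot>\<^bsub>A\<^esub> f) = farr F g \<cdot>\<^bsub>B\<^esub> farr F f"
  using farr_Comp[of f "Dom A f" "Cod A f" g "Cod A g"] by (auto simp: in_Hom_iff)

lemma funit_simps [simp]:
  "funit F \<in> Arr B" "Dom B (funit F) = Unit B" "Cod B (funit F) = fobj F (Unit A)"
  using funit_closed by (auto simp: in_Hom_iff)

lemma ftens_simps [simp]:
  assumes "a \<in> Obj A" "b \<in> Obj A"
  shows "ftens F (a, b) \<in> Arr B" "Dom B (ftens F (a, b)) = fobj F a \<otimes>\<^bsub>B\<^esub> fobj F b"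
    "Cod B (ftens F (a, b)) = fobj F (a \<otimes>\<^bsub>A\<^esub> b)"
  using ftens_closed[OF assms] by (auto simp: in_Hom_iff)

lemma ftens_nat:
  "f \<in> Arr A \<Longrightarrow> g \<in> Arr A \<Longrightarrow> Dom A f = a \<Longrightarrow> Dom A g = b \<Longrightarrow>
   farr F (f \<boxtimes>\<^bsub>A\<^esub> g) \<cdot>\<^bsub>B\<^esub> ftens F (a, b) = ftens F (Cod A f, Cod A g) \<cdot>\<^bsub>B\<^esub> (farr F f \<boxtimes>\<^bsub>B\<^esub> farr F g)"
  using ftens_natural[of f a "Cod A f" g b "Cod A g"] by (simp add: in_Hom_iff)

lemma ftens_nat_ext:
  "f \<in> Arr A \<Longrightarrow> g \<in> Arr A \<Longrightarrow> Dom A f = a \<Longrightarrow> Dom A g = b \<Longrightarrow>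
   x \<in> Arr B \<Longrightarrow> Cod B x = fobj F a \<otimes>\<^bsub>B\<^esub> fobj F b \<Longrightarrow>
   farr F (f \<boxtimes>\<^bsub>A\<^esub> g) \<cdot>\<^bsub>B\<^esub> ftens F (a, b) \<cdot>\<^bsub>B\<^esub> x =
   ftens F (Cod A f, Cod A g) \<cdot>\<^bsub>B\<^esub> (farr F f \<boxtimes>\<^bsub>B\<^esub> farr F g) \<cdot>\<^bsub>B\<^esub> x"
  by (subst B.ext2[OF ftens_nat]) auto

lemma inverse_arrs_farr: "inverse_arrs A f g \<Longrightarrow> inverse_arrs B (farr F f) (farr F g)"
  unfolding inverse_arrs_def in_Hom_iff
  by (auto simp flip: farr_Comp_simp)

lemma is_iso_farr [simp]: "is_iso A f \<Longrightarrow> is_iso B (farr F f)"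
  using inverse_arrs_farr A.inverse_inv_arr B.is_isoI by blast

lemma farr_inv: "is_iso A f \<Longrightarrow> farr F (inv_arr A f) = inv_arr B (farr F f)"
  by (metis inverse_arrs_farr A.inverse_inv_arr B.inv_arr_eqI)

text \<open>The associativity and symmetry laws of F combined. Cancelling the image of an
  associativity replaces \<open>shuf\<close> by \<open>symm\<close> and avoids computing F at an
  inverse.\<close>

lemma ftens_shuf:
  assumes "b \<in> Obj A" "c \<in> Obj A" "d \<in> Obj A"
  shows "farr F (shuf A b c d) \<cdot>\<^bsub>B\<^esub> ftens F (b, c \<otimes>\<^bsub>A\<^esub> d) \<cdot>\<^bsub>B\<^esub> (Id B (fobj F b) \<boxtimes>\<^bsub>B\<^esub> ftens F (c, d)) =
   ftens F (c, b \<otimes>\<^bsub>A\<^esub> d) \<cdot>\<^bsub>B\<^esub> (Id B (fobj F c) \<boxtimes>\<^bsub>B\<^esub> ftens F (b, d)) \<cdot>\<^bsub>B\<^esub> shuf B (fobj F b) (fobj F c) (fobj F d)"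
    (is "?L = ?R")
proof (rule B.iso_monic)
  have "farr F (ass A c b d) \<cdot>\<^bsub>B\<^esub> ?L = farr F (ass A c b d \<cdot>\<^bsub>A\<^esub> shuf A b c d) \<cdot>\<^bsub>B\<^esub> ftens F (b, c \<otimes>\<^bsub>A\<^esub> d) \<cdot>\<^bsub>B\<^esub> (Id B (fobj F b) \<boxtimes>\<^bsub>B\<^esub> ftens F (c, d))"
    using assms by simp
  also have "\<dots> = farr F (symm A b c \<boxtimes>\<^bsub>A\<^esub> Id A d) \<cdot>\<^bsub>B\<^esub> ftens F (b \<otimes>\<^bsub>A\<^esub> c, d) \<cdot>\<^bsub>B\<^esub>
      (ftens F (b, c) \<boxtimes>\<^bsub>B\<^esub> Id B (fobj F d)) \<cdot>\<^bsub>B\<^esub> ass B (fobj F b) (fobj F c) (fobj F d)"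
    using assms by (subst A.ass_shuf) (auto simp: ftens_ass)
  also have "\<dots> = ftens F (c \<otimes>\<^bsub>A\<^esub> b, d) \<cdot>\<^bsub>B\<^esub> ((farr F (symm A b c) \<cdot>\<^bsub>B\<^esub> ftens F (b, c)) \<boxtimes>\<^bsub>B\<^esub> Id B (fobj F d)) \<cdot>\<^bsub>B\<^esub>
      ass B (fobj F b) (fobj F c) (fobj F d)"
    using assms by (simp add: ftens_nat_ext)
  also have "\<dots> = ftens F (c \<otimes>\<^bsub>A\<^esub> b, d) \<cdot>\<^bsub>B\<^esub> (ftens F (c, b) \<boxtimes>\<^bsub>B\<^esub> Id B (fobj F d)) \<cdot>\<^bsub>B\<^esub>
      ass B (fobj F c) (fobj F b) (fobj F d) \<cdot>\<^bsub>B\<^esub> shuf B (fobj F b) (fobj F c) (fobj F d)"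
    using assms by (subst ftens_symm) (auto simp: B.ass_shuf)
  also have "\<dots> = (farr F (ass A c b d) \<cdot>\<^bsub>B\<^esub> ftens F (c, b \<otimes>\<^bsub>A\<^esub> d) \<cdot>\<^bsub>B\<^esub> (Id B (fobj F c) \<boxtimes>\<^bsub>B\<^esub> ftens F (b, d))) \<cdot>\<^bsub>B\<^esub> shuf B (fobj F b) (fobj F c) (fobj F d)"
    using assms by (subst ftens_ass) auto
  also have "\<dots> = farr F (ass A c b d) \<cdot>\<^bsub>B\<^esub> ?R"
    using assms by simp
  finally show "farr F (ass A c b d) \<cdot>\<^bsub>B\<^esub> ?L = farr F (ass A c b d) \<cdot>\<^bsub>B\<^esub> ?R" .
qed (use assms in auto)

text \<open>This is why [A,F]^2 consists of monoidal transformations, see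
  \<open>mnt_hom_post_tens\<close>; both the associativity and the symmetry law of F enter.\<close>

lemma ftens_interchange:
  assumes "a \<in> Obj A" "b \<in> Obj A" "c \<in> Obj A" "d \<in> Obj A"
  shows "farr F (interchange A a b c d) \<cdot>\<^bsub>B\<^esub> ftens F (a \<otimes>\<^bsub>A\<^esub> b, c \<otimes>\<^bsub>A\<^esub> d) \<cdot>\<^bsub>B\<^esub> (ftens F (a, b) \<boxtimes>\<^bsub>B\<^esub> ftens F (c, d)) =
   ftens F (a \<otimes>\<^bsub>A\<^esub> c, b \<otimes>\<^bsub>A\<^esub> d) \<cdot>\<^bsub>B\<^esub> (ftens F (a, c) \<boxtimes>\<^bsub>B\<^esub> ftens F (b, d)) \<cdot>\<^bsub>B\<^esub>
     interchange B (fobj F a) (fobj F b) (fobj F c) (fobj F d)"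
    (is "?L = ?R")
proof (rule B.iso_epic)
  let ?J = "ass B (fobj F a) (fobj F b) (fobj F c \<otimes>\<^bsub>B\<^esub> fobj F d)"
  have t1: "ftens F (p, q) \<boxtimes>\<^bsub>B\<^esub> ftens F (r, s) =
      (ftens F (p, q) \<boxtimes>\<^bsub>B\<^esub> Id B (fobj F (r \<otimes>\<^bsub>A\<^esub> s))) \<cdot>\<^bsub>B\<^esub> (Id B (fobj F p \<otimes>\<^bsub>B\<^esub> fobj F q) \<boxtimes>\<^bsub>B\<^esub> ftens F (r, s))"
    if "p \<in> Obj A" "q \<in> Obj A" "r \<in> Obj A" "s \<in> Obj A" for p q r s
    using that by (simp add: B.TensM_Comp_simp)
  have "?L \<cdot>\<^bsub>B\<^esub> ?J = farr F (interchange A a b c d) \<cdot>\<^bsub>B\<^esub> (ftens F (a \<otimes>\<^bsub>A\<^esub> b, c \<otimes>\<^bsub>A\<^esub> d) \<cdot>\<^bsub>B\<^esub> (ftens F (a, b) \<boxtimes>\<^bsub>B\<^esub> Id B (fobj F (c \<otimes>\<^bsub>A\<^esub> d))) \<cdot>\<^bsub>B\<^esub>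
     ass B (fobj F a) (fobj F b) (fobj F (c \<otimes>\<^bsub>A\<^esub> d))) \<cdot>\<^bsub>B\<^esub> (Id B (fobj F a) \<boxtimes>\<^bsub>B\<^esub> Id B (fobj F b) \<boxtimes>\<^bsub>B\<^esub> ftens F (c, d))"
    using assms by (subst t1) (auto simp: B.ass_nat_r_ext B.ass_nat_r)
  also have "\<dots> = farr F (interchange A a b c d \<cdot>\<^bsub>A\<^esub> ass A a b (c \<otimes>\<^bsub>A\<^esub> d)) \<cdot>\<^bsub>B\<^esub> ftens F (a, b \<otimes>\<^bsub>A\<^esub> c \<otimes>\<^bsub>A\<^esub> d) \<cdot>\<^bsub>B\<^esub>
      (Id B (fobj F a) \<boxtimes>\<^bsub>B\<^esub> ftens F (b, c \<otimes>\<^bsub>A\<^esub> d)) \<cdot>\<^bsub>B\<^esub> (Id B (fobj F a) \<boxtimes>\<^bsub>B\<^esub> Id B (fobj F b) \<boxtimes>\<^bsub>B\<^esub> ftens F (c, d))"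
    using assms by (subst ftens_ass[symmetric]) auto
  also have "\<dots> = farr F (ass A a c (b \<otimes>\<^bsub>A\<^esub> d)) \<cdot>\<^bsub>B\<^esub> ftens F (a, c \<otimes>\<^bsub>A\<^esub> b \<otimes>\<^bsub>A\<^esub> d) \<cdot>\<^bsub>B\<^esub>
      (Id B (fobj F a) \<boxtimes>\<^bsub>B\<^esub> (farr F (shuf A b c d) \<cdot>\<^bsub>B\<^esub> ftens F (b, c \<otimes>\<^bsub>A\<^esub> d) \<cdot>\<^bsub>B\<^esub> (Id B (fobj F b) \<boxtimes>\<^bsub>B\<^esub> ftens F (c, d))))"
    using assms by (subst A.interchange_ass) (auto simp: ftens_nat_ext)
  also have "\<dots> = (farr F (ass A a c (b \<otimes>\<^bsub>A\<^esub> d)) \<cdot>\<^bsub>B\<^esub> ftens F (a, c \<otimes>\<^bsub>A\<^esub> b \<otimes>\<^bsub>A\<^esub> d) \<cdot>\<^bsub>B\<^esub>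
      (Id B (fobj F a) \<boxtimes>\<^bsub>B\<^esub> ftens F (c, b \<otimes>\<^bsub>A\<^esub> d))) \<cdot>\<^bsub>B\<^esub>
      (Id B (fobj F a) \<boxtimes>\<^bsub>B\<^esub> ((Id B (fobj F c) \<boxtimes>\<^bsub>B\<^esub> ftens F (b, d)) \<cdot>\<^bsub>B\<^esub> shuf B (fobj F b) (fobj F c) (fobj F d)))"
    using assms by (subst ftens_shuf) auto
  also have "\<dots> = ftens F (a \<otimes>\<^bsub>A\<^esub> c, b \<otimes>\<^bsub>A\<^esub> d) \<cdot>\<^bsub>B\<^esub> (ftens F (a, c) \<boxtimes>\<^bsub>B\<^esub> ftens F (b, d)) \<cdot>\<^bsub>B\<^esub>
      ass B (fobj F a) (fobj F c) (fobj F b \<otimes>\<^bsub>B\<^esub> fobj F d) \<cdot>\<^bsub>B\<^esub> (Id B (fobj F a) \<boxtimes>\<^bsub>B\<^esub> shuf B (fobj F b) (fobj F c) (fobj F d))"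
    using assms by (subst ftens_ass) (auto simp: t1 B.ass_nat_r_ext)
  also have "\<dots> = ?R \<cdot>\<^bsub>B\<^esub> ?J"
    using assms by (simp add: B.interchange_ass)
  finally show "?L \<cdot>\<^bsub>B\<^esub> ?J = ?R \<cdot>\<^bsub>B\<^esub> ?J" .
qed (use assms in auto)

end

section \<open>Composition and identities of symmetric monoidal functors\<close>

lemma smf_comp_simps [simp]:
  "a \<in> Obj A \<Longrightarrow> fobj (smf_comp A C G F) a = fobj G (fobj F a)"
  "f \<in> Arr A \<Longrightarrow> farr (smf_comp A C G F) f = farr G (farr F f)"
  "funit (smf_comp A C G F) = farr G (funit F) \<cdot>\<^bsub>C\<^esub> funit G"
  "a \<in> Obj A \<Longrightarrow> b \<in> Obj A \<Longrightarrow>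
    ftens (smf_comp A C G F) (a, b) = farr G (ftens F (a, b)) \<cdot>\<^bsub>C\<^esub> ftens G (fobj F a, fobj F b)"
  by (auto simp: smf_comp_def)

lemma sym_mon_functor_comp:
  fixes C :: "('oc, 'mc) smcat" (structure)
  assumes "sym_mon_functor A B F" "sym_mon_functor B C G"
  shows "sym_mon_functor A C (smf_comp A C G F)"
proof -
  interpret F: sym_mon_functor A B F by fact
  interpret G: sym_mon_functor B C G by fact
  show ?thesis
    unfolding smf_comp_def
  proof (rule sym_mon_functorI)
    fix f g assume o: "f \<in> Arr A" "g \<in> Arr A"
    let ?t = "\<lambda>(a, b). farr G (ftens F (a, b)) \<cdot> ftens G (fobj F a, fobj F b)"
    have "farr G (farr F (f \<boxtimes>\<^bsub>A\<^esub> g)) \<cdot> ?t (Dom A f, Dom A g) =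
      farr G (farr F (f \<boxtimes>\<^bsub>A\<^esub> g) \<cdot>\<^bsub>B\<^esub> ftens F (Dom A f, Dom A g)) \<cdot> ftens G (fobj F (Dom A f), fobj F (Dom A g))" (is "?l = _")
      using o by simp
    also have "\<dots> = ?t (Cod A f, Cod A g) \<cdot> (farr G (farr F f) \<boxtimes> farr G (farr F g))"
      using o by (subst F.ftens_nat) (auto simp: G.ftens_nat)
    finally show "?l = \<dots>" .
  next
    fix a b c assume o: "a \<in> Obj A" "b \<in> Obj A" "c \<in> Obj A"
    let ?t = "\<lambda>(a, b). farr G (ftens F (a, b)) \<cdot> ftens G (fobj F a, fobj F b)"
    have "farr G (farr F (ass A a b c)) \<cdot> ?t (a, b \<otimes>\<^bsub>A\<^esub> c) \<cdot> (Id C (fobj G (fobj F a)) \<boxtimes> ?t (b, c)) =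
     farr G (farr F (ass A a b c) \<cdot>\<^bsub>B\<^esub> ftens F (a, b \<otimes>\<^bsub>A\<^esub> c) \<cdot>\<^bsub>B\<^esub> (Id B (fobj F a) \<boxtimes>\<^bsub>B\<^esub> ftens F (b, c))) \<cdot>
       ftens G (fobj F a, fobj F b \<otimes>\<^bsub>B\<^esub> fobj F c) \<cdot> (Id C (fobj G (fobj F a)) \<boxtimes> ftens G (fobj F b, fobj F c))" (is "?l = _")
      using o by (simp add: G.ftens_nat_ext)
    also have "\<dots> = farr G (ftens F (a \<otimes>\<^bsub>A\<^esub> b, c)) \<cdot> farr G (ftens F (a, b) \<boxtimes>\<^bsub>B\<^esub> Id B (fobj F c)) \<cdot>
      (farr G (ass B (fobj F a) (fobj F b) (fobj F c)) \<cdot>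
       ftens G (fobj F a, fobj F b \<otimes>\<^bsub>B\<^esub> fobj F c) \<cdot> (Id C (fobj G (fobj F a)) \<boxtimes> ftens G (fobj F b, fobj F c)))"
      using o by (subst F.ftens_ass) auto
    also have "\<dots> = ?t (a \<otimes>\<^bsub>A\<^esub> b, c) \<cdot> (?t (a, b) \<boxtimes> Id C (fobj G (fobj F c))) \<cdot>
        ass C (fobj G (fobj F a)) (fobj G (fobj F b)) (fobj G (fobj F c))"
      using o by (subst G.ftens_ass) (auto simp: G.ftens_nat_ext)
    finally show "?l = \<dots>" .
  next
    fix a assume o: "a \<in> Obj A"
    let ?t = "\<lambda>(a, b). farr G (ftens F (a, b)) \<cdot> ftens G (fobj F a, fobj F b)"
    let ?u = "farr G (funit F) \<cdot> funit G"
    have "farr G (farr F (runit A a)) \<cdot> ?t (a, Unit A) \<cdot> (Id C (fobj G (fobj F a)) \<boxtimes> ?u)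
     = farr G (farr F (runit A a) \<cdot>\<^bsub>B\<^esub> ftens F (a, Unit A) \<cdot>\<^bsub>B\<^esub> (Id B (fobj F a) \<boxtimes>\<^bsub>B\<^esub> funit F)) \<cdot>
       ftens G (fobj F a, Unit B) \<cdot> (Id C (fobj G (fobj F a)) \<boxtimes> funit G)"
      using o by (simp add: G.ftens_nat_ext)
    also have "\<dots> = runit C (fobj G (fobj F a))"
      using o by (subst F.ftens_runit) (auto simp: G.ftens_runit)
    finally show "farr G (farr F (runit A a)) \<cdot> ?t (a, Unit A) \<cdot> (Id C (fobj G (fobj F a)) \<boxtimes> ?u) = \<dots>" .
    have "farr G (farr F (lunit A a)) \<cdot> ?t (Unit A, a) \<cdot> (?u \<boxtimes> Id C (fobj G (fobj F a)))
     = farr G (farr F (lunit A a) \<cdot>\<^bsub>B\<^esub> ftens F (Unit A, a) \<cdot>\<^bsub>B\<^esub> (funit F \<boxtimes>\<^bsub>B\<^esub> Id B (fobj F a))) \<cdot>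
       ftens G (Unit B, fobj F a) \<cdot> (funit G \<boxtimes> Id C (fobj G (fobj F a)))"
      using o by (simp add: G.ftens_nat_ext)
    also have "\<dots> = lunit C (fobj G (fobj F a))"
      using o by (subst F.ftens_lunit) (auto simp: G.ftens_lunit)
    finally show "farr G (farr F (lunit A a)) \<cdot> ?t (Unit A, a) \<cdot> (?u \<boxtimes> Id C (fobj G (fobj F a))) = \<dots>" .
  next
    fix a b assume o: "a \<in> Obj A" "b \<in> Obj A"
    let ?t = "\<lambda>(a, b). farr G (ftens F (a, b)) \<cdot> ftens G (fobj F a, fobj F b)"
    have "farr G (farr F (symm A a b)) \<cdot> ?t (a, b) =
      farr G (farr F (symm A a b) \<cdot>\<^bsub>B\<^esub> ftens F (a, b)) \<cdot> ftens G (fobj F a, fobj F b)" (is "?l = _")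
      using o by simp
    also have "\<dots> = ?t (b, a) \<cdot> symm C (fobj G (fobj F a)) (fobj G (fobj F b))"
      using o by (subst F.ftens_symm) (auto simp: G.ftens_symm)
    finally show "?l = \<dots>" .
  qed (auto simp: F.A.sym_mon_cat_axioms G.B.sym_mon_cat_axioms)
qed

lemma smf_comp_assoc:
  assumes "sym_mon_functor A B F" "sym_mon_functor B C G" "sym_mon_functor C D H"
  shows "smf_comp A D H (smf_comp A C G F) = smf_comp A D (smf_comp B D H G) F"
proof -
  interpret F: sym_mon_functor A B F by fact
  interpret G: sym_mon_functor B C G by fact
  interpret H: sym_mon_functor C D H by fact
  show ?thesis
    by (rule smf_eqI[of A D]) (auto intro!: sym_mon_functor_comp assms)
qed

lemma sym_mon_functor_id: "sym_mon_cat A \<Longrightarrow> sym_mon_functor A A (smf_id A)"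
proof -
  assume "sym_mon_cat A"
  then interpret sym_mon_cat A .
  show ?thesis
    unfolding smf_id_def by (rule sym_mon_functorI) (auto intro: sym_mon_cat_axioms)
qed

lemma smf_id_simps [simp]:
  "a \<in> Obj A \<Longrightarrow> fobj (smf_id A) a = a" "f \<in> Arr A \<Longrightarrow> farr (smf_id A) f = f"
  "funit (smf_id A) = Id A (Unit A)"
  "a \<in> Obj A \<Longrightarrow> b \<in> Obj A \<Longrightarrow> ftens (smf_id A) (a, b) = Id A (a \<otimes>\<^bsub>A\<^esub> b)"
  by (auto simp: smf_id_def)

lemma smf_comp_id:
  assumes "sym_mon_functor A B F"
  shows "smf_comp A B (smf_id B) F = F"
proof -
  interpret F: sym_mon_functor A B F by fact
  show ?thesis
    by (rule smf_eqI[of A B]) (auto intro!: sym_mon_functor_comp[OF assms] sym_mon_functor_id assms F.B.sym_mon_cat_axioms)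
qed

section \<open>Monoidal natural transformations and the internal hom\<close>

lemma mon_nat_transI:
  fixes A :: "('oa, 'ma) smcat" and B :: "('ob, 'mb) smcat" (structure)
  assumes F: "sym_mon_functor A B F" and G: "sym_mon_functor A B G"
    and "\<And>a. a \<in> Obj A \<Longrightarrow> c a \<in> Arr B \<and> Dom B (c a) = fobj F a \<and> Cod B (c a) = fobj G a"
    and "\<And>f. f \<in> Arr A \<Longrightarrow> farr G f \<cdot> c (Dom A f) = c (Cod A f) \<cdot> farr F f"
    and "c (Unit A) \<cdot> funit F = funit G"
    and "\<And>a b. a \<in> Obj A \<Longrightarrow> b \<in> Obj A \<Longrightarrow>
      c (a \<otimes>\<^bsub>A\<^esub> b) \<cdot> ftens F (a, b) = ftens G (a, b) \<cdot> (c a \<boxtimes> c b)"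
  shows "mon_nat_trans A B \<lparr>ndom = F, ncod = G, ncomp = restrict c (Obj A)\<rparr>"
proof -
  interpret F: sym_mon_functor A B F by fact
  interpret G: sym_mon_functor A B G by fact
  show ?thesis
    by (intro mon_nat_trans.intro mon_nat_trans_axioms.intro)
      (use assms in \<open>auto simp: in_Hom_iff\<close>)
qed

context mon_nat_trans
begin

lemma ncomp_simps [simp]:
  assumes "a \<in> Obj A"
  shows "ncomp \<sigma> a \<in> Arr B" "Dom B (ncomp \<sigma> a) = fobj (ndom \<sigma>) a"
    "Cod B (ncomp \<sigma> a) = fobj (ncod \<sigma>) a"
  using ncomp_closed[OF assms] by (auto simp: in_Hom_iff)

lemma ncomp_nat:
  "f \<in> Arr A \<Longrightarrow> Dom A f = a \<Longrightarrow>
   farr (ncod \<sigma>) f \<cdot>\<^bsub>B\<^esub> ncomp \<sigma> a = ncomp \<sigma> (Cod A f) \<cdot>\<^bsub>B\<^esub> farr (ndom \<sigma>) f"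
  using ncomp_natural[of f a "Cod A f"] by (auto simp: in_Hom_iff)

end

section \<open>The pointwise unit and tensor of functors\<close>

lemma sym_mon_functor_hom_unit:
  assumes "sym_mon_cat A" "sym_mon_cat B"
  shows "sym_mon_functor A B (hom_unit A B)"
proof -
  interpret A: sym_mon_cat A by fact
  interpret B: sym_mon_cat B by fact
  \<comment> \<open>The structure arrow of the constant functor is \<open>lunit\<close> at the unit,
    so its associativity law asks for the associativity at units to be a composite of
    unitors.\<close>
  have *: "ass B (Unit B) (Unit B) (Unit B) = (inv_arr B (lunit B (Unit B)) \<boxtimes>\<^bsub>B\<^esub> Id B (Unit B)) \<cdot>\<^bsub>B\<^esub> (Id B (Unit B) \<boxtimes>\<^bsub>B\<^esub> lunit B (Unit B))"
    by (subst B.ass_Unit[symmetric]) (auto simp: B.TensM_Comp_simp)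
  show ?thesis
    unfolding hom_unit_def
    by (rule sym_mon_functorI)
      (auto simp: assms * B.symm_Unit_Unit B.TensM_Comp_ext B.lunit_Unit simp del: B.whisker_comp)
qed

lemma hom_unit_simps [simp]:
  "a \<in> Obj A \<Longrightarrow> fobj (hom_unit A B) a = Unit B"
  "f \<in> Arr A \<Longrightarrow> farr (hom_unit A B) f = Id B (Unit B)"
  "funit (hom_unit A B) = Id B (Unit B)"
  "a \<in> Obj A \<Longrightarrow> b \<in> Obj A \<Longrightarrow> ftens (hom_unit A B) (a, b) = lunit B (Unit B)"
  by (auto simp: hom_unit_def)

lemma hom_tens_simps [simp]:
  "a \<in> Obj A \<Longrightarrow> fobj (hom_tens A B F G) a = fobj F a \<otimes>\<^bsub>B\<^esub> fobj G a"
  "f \<in> Arr A \<Longrightarrow> farr (hom_tens A B F G) f = farr F f \<boxtimes>\<^bsub>B\<^esub> farr G f"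
  "funit (hom_tens A B F G) = (funit F \<boxtimes>\<^bsub>B\<^esub> funit G) \<cdot>\<^bsub>B\<^esub> inv_arr B (lunit B (Unit B))"
  "a \<in> Obj A \<Longrightarrow> b \<in> Obj A \<Longrightarrow> ftens (hom_tens A B F G) (a, b) =
    (ftens F (a, b) \<boxtimes>\<^bsub>B\<^esub> ftens G (a, b)) \<cdot>\<^bsub>B\<^esub> interchange B (fobj F a) (fobj G a) (fobj F b) (fobj G b)"
  by (auto simp: hom_tens_def)

text \<open>In each law, naturality of \<open>interchange\<close> collects the data of F into one
  tensor factor and those of G into the other. The law for F tensored with the law for G then leaves
  a coherence law of \<open>interchange\<close>.\<close>

lemma sym_mon_functor_hom_tens:
  fixes B :: "('ob, 'mb) smcat" (structure)
  assumes "sym_mon_functor A B F" "sym_mon_functor A B G"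
  shows "sym_mon_functor A B (hom_tens A B F G)"
proof -
  interpret F: sym_mon_functor A B F by fact
  interpret G: sym_mon_functor A B G by fact
  let ?t = "\<lambda>(a, b). (ftens F (a, b) \<boxtimes> ftens G (a, b)) \<cdot> interchange B (fobj F a) (fobj G a) (fobj F b) (fobj G b)"
  let ?u = "(funit F \<boxtimes> funit G) \<cdot> inv_arr B (lunit B (Unit B))"
  show ?thesis
    unfolding hom_tens_def
  proof (rule sym_mon_functorI)
    fix f g assume "f \<in> Arr A" "g \<in> Arr A"
    then show "(farr F (f \<boxtimes>\<^bsub>A\<^esub> g) \<boxtimes> farr G (f \<boxtimes>\<^bsub>A\<^esub> g)) \<cdot> ?t (Dom A f, Dom A g) =
       ?t (Cod A f, Cod A g) \<cdot> ((farr F f \<boxtimes> farr G f) \<boxtimes> (farr F g \<boxtimes> farr G g))"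
      by (simp add: F.B.TensM_Comp_ext F.B.TensM_Comp_simp F.B.interchange_nat F.ftens_nat G.ftens_nat
          del: F.B.whisker_comp)
  next
    fix a b c assume o: "a \<in> Obj A" "b \<in> Obj A" "c \<in> Obj A"
    have "(farr F (ass A a b c) \<boxtimes> farr G (ass A a b c)) \<cdot> ?t (a, b \<otimes>\<^bsub>A\<^esub> c) \<cdot> (Id B (fobj F a \<otimes> fobj G a) \<boxtimes> ?t (b, c)) =
      ((farr F (ass A a b c) \<cdot> ftens F (a, b \<otimes>\<^bsub>A\<^esub> c) \<cdot> (Id B (fobj F a) \<boxtimes> ftens F (b, c))) \<boxtimes>
       (farr G (ass A a b c) \<cdot> ftens G (a, b \<otimes>\<^bsub>A\<^esub> c) \<cdot> (Id B (fobj G a) \<boxtimes> ftens G (b, c)))) \<cdot>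
       interchange B (fobj F a) (fobj G a) (fobj F b \<otimes> fobj F c) (fobj G b \<otimes> fobj G c) \<cdot>
       (Id B (fobj F a \<otimes> fobj G a) \<boxtimes> interchange B (fobj F b) (fobj G b) (fobj F c) (fobj G c))" (is "?l = _")
      using o by (simp flip: F.B.TensM_Comp_ext add: F.B.ext2[OF F.B.interchange_nat_r])
    also have "\<dots> = (ftens F (a \<otimes>\<^bsub>A\<^esub> b, c) \<boxtimes> ftens G (a \<otimes>\<^bsub>A\<^esub> b, c)) \<cdot>
       ((ftens F (a, b) \<boxtimes> Id B (fobj F c)) \<boxtimes> (ftens G (a, b) \<boxtimes> Id B (fobj G c))) \<cdot>
       ((ass B (fobj F a) (fobj F b) (fobj F c) \<boxtimes> ass B (fobj G a) (fobj G b) (fobj G c)) \<cdot>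
       interchange B (fobj F a) (fobj G a) (fobj F b \<otimes> fobj F c) (fobj G b \<otimes> fobj G c) \<cdot>
       (Id B (fobj F a \<otimes> fobj G a) \<boxtimes> interchange B (fobj F b) (fobj G b) (fobj F c) (fobj G c)))"
      using o by (simp flip: F.B.TensM_Comp_ext add: F.ftens_ass G.ftens_ass)
    also have "\<dots> = ?t (a \<otimes>\<^bsub>A\<^esub> b, c) \<cdot> (?t (a, b) \<boxtimes> Id B (fobj F c \<otimes> fobj G c)) \<cdot>
       ass B (fobj F a \<otimes> fobj G a) (fobj F b \<otimes> fobj G b) (fobj F c \<otimes> fobj G c)"
      using o by (subst F.B.interchange_hexagon) (auto simp: F.B.ext2[OF F.B.interchange_nat_l])
    finally show "?l = \<dots>" .
  next
    fix a assume o: "a \<in> Obj A"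
    have "(farr F (runit A a) \<boxtimes> farr G (runit A a)) \<cdot> ?t (a, Unit A) \<cdot> (Id B (fobj F a \<otimes> fobj G a) \<boxtimes> ?u)
      = ((farr F (runit A a) \<cdot> ftens F (a, Unit A) \<cdot> (Id B (fobj F a) \<boxtimes> funit F)) \<boxtimes>
         (farr G (runit A a) \<cdot> ftens G (a, Unit A) \<cdot> (Id B (fobj G a) \<boxtimes> funit G))) \<cdot>
        interchange B (fobj F a) (fobj G a) (Unit B) (Unit B) \<cdot>
        (Id B (fobj F a \<otimes> fobj G a) \<boxtimes> inv_arr B (lunit B (Unit B)))"
      using o by (simp flip: F.B.TensM_Comp_ext add: F.B.ext2[OF F.B.interchange_nat_r])
    also have "\<dots> = runit B (fobj F a \<otimes> fobj G a) \<cdot>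
       (Id B (fobj F a \<otimes> fobj G a) \<boxtimes> (lunit B (Unit B) \<cdot> inv_arr B (lunit B (Unit B))))"
      using o by (subst F.B.whisker_comp) (auto simp: F.ftens_runit G.ftens_runit F.B.ext2[OF F.B.interchange_runit])
    also have "\<dots> = runit B (fobj F a \<otimes> fobj G a)"
      using o by simp
    finally show "(farr F (runit A a) \<boxtimes> farr G (runit A a)) \<cdot> ?t (a, Unit A) \<cdot> (Id B (fobj F a \<otimes> fobj G a) \<boxtimes> ?u) = \<dots>" .
    have "(farr F (lunit A a) \<boxtimes> farr G (lunit A a)) \<cdot> ?t (Unit A, a) \<cdot> (?u \<boxtimes> Id B (fobj F a \<otimes> fobj G a))
      = ((farr F (lunit A a) \<cdot> ftens F (Unit A, a) \<cdot> (funit F \<boxtimes> Id B (fobj F a))) \<boxtimes>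
         (farr G (lunit A a) \<cdot> ftens G (Unit A, a) \<cdot> (funit G \<boxtimes> Id B (fobj G a)))) \<cdot>
        interchange B (Unit B) (Unit B) (fobj F a) (fobj G a) \<cdot>
        (inv_arr B (lunit B (Unit B)) \<boxtimes> Id B (fobj F a \<otimes> fobj G a))"
      using o by (simp flip: F.B.TensM_Comp_ext add: F.B.ext2[OF F.B.interchange_nat_l])
    also have "\<dots> = lunit B (fobj F a \<otimes> fobj G a) \<cdot>
       ((lunit B (Unit B) \<cdot> inv_arr B (lunit B (Unit B))) \<boxtimes> Id B (fobj F a \<otimes> fobj G a))"
      using o by (subst F.B.whisker_comp) (auto simp: F.ftens_lunit G.ftens_lunit F.B.ext2[OF F.B.interchange_lunit])
    also have "\<dots> = lunit B (fobj F a \<otimes> fobj G a)"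
      using o by simp
    finally show "(farr F (lunit A a) \<boxtimes> farr G (lunit A a)) \<cdot> ?t (Unit A, a) \<cdot> (?u \<boxtimes> Id B (fobj F a \<otimes> fobj G a)) = \<dots>" .
  next
    fix a b assume o: "a \<in> Obj A" "b \<in> Obj A"
    then show "(farr F (symm A a b) \<boxtimes> farr G (symm A a b)) \<cdot> ?t (a, b) =
      ?t (b, a) \<cdot> symm B (fobj F a \<otimes> fobj G a) (fobj F b \<otimes> fobj G b)"
      by (simp add: F.B.TensM_Comp_ext F.ftens_symm G.ftens_symm
          flip: F.B.interchange_symm')
  qed (auto simp: F.A.sym_mon_cat_axioms F.B.sym_mon_cat_axioms F.B.TensM_Comp_simp)
qed

section \<open>Structure arrows and axioms of the internal hom\<close>

lemma hom_cat_simps [simp]: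
  "F \<in> Obj (hom_cat A B) \<longleftrightarrow> sym_mon_functor A B F"
  "\<sigma> \<in> Arr (hom_cat A B) \<longleftrightarrow> mon_nat_trans A B \<sigma>"
  "Dom (hom_cat A B) = ndom" "Cod (hom_cat A B) = ncod"
  "Unit (hom_cat A B) = hom_unit A B" "TensO (hom_cat A B) = hom_tens A B"
  by (auto simp: hom_cat_def)

lemma hom_cat_ends [simp]:
  "ndom (Id (hom_cat A B) F) = F" "ncod (Id (hom_cat A B) F) = F"
  "ndom (Comp (hom_cat A B) \<tau> \<sigma>) = ndom \<sigma>" "ncod (Comp (hom_cat A B) \<tau> \<sigma>) = ncod \<tau>"
  "ndom (TensM (hom_cat A B) \<sigma> \<tau>) = hom_tens A B (ndom \<sigma>) (ndom \<tau>)"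
  "ncod (TensM (hom_cat A B) \<sigma> \<tau>) = hom_tens A B (ncod \<sigma>) (ncod \<tau>)"
  "ndom (ass (hom_cat A B) F G H) = hom_tens A B F (hom_tens A B G H)"
  "ncod (ass (hom_cat A B) F G H) = hom_tens A B (hom_tens A B F G) H"
  "ndom (runit (hom_cat A B) F) = hom_tens A B F (hom_unit A B)" "ncod (runit (hom_cat A B) F) = F"
  "ndom (lunit (hom_cat A B) F) = hom_tens A B (hom_unit A B) F" "ncod (lunit (hom_cat A B) F) = F"
  "ndom (symm (hom_cat A B) F G) = hom_tens A B F G" "ncod (symm (hom_cat A B) F G) = hom_tens A B G F"
  by (auto simp: hom_cat_def)

lemma hom_cat_ncomp [simp]:
  assumes "a \<in> Obj A"
  shows "ncomp (Id (hom_cat A B) F) a = Id B (fobj F a)"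
    "ncomp (Comp (hom_cat A B) \<tau> \<sigma>) a = ncomp \<tau> a \<cdot>\<^bsub>B\<^esub> ncomp \<sigma> a"
    "ncomp (TensM (hom_cat A B) \<sigma> \<tau>) a = ncomp \<sigma> a \<boxtimes>\<^bsub>B\<^esub> ncomp \<tau> a"
    "ncomp (ass (hom_cat A B) F G H) a = ass B (fobj F a) (fobj G a) (fobj H a)"
    "ncomp (runit (hom_cat A B) F) a = runit B (fobj F a)"
    "ncomp (lunit (hom_cat A B) F) a = lunit B (fobj F a)"
    "ncomp (symm (hom_cat A B) F G) a = symm B (fobj F a) (fobj G a)"
  using assms by (auto simp: hom_cat_def)

lemma mon_nat_trans_functors:
  "mon_nat_trans A B \<sigma> \<Longrightarrow> sym_mon_functor A B (ndom \<sigma>)"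
  "mon_nat_trans A B \<sigma> \<Longrightarrow> sym_mon_functor A B (ncod \<sigma>)"
  by (auto simp: mon_nat_trans_def)

lemma mnt_Id:
  assumes "sym_mon_functor A B F"
  shows "mon_nat_trans A B (Id (hom_cat A B) F)"
proof -
  interpret F: sym_mon_functor A B F by fact
  show ?thesis
    unfolding hom_cat_def by simp (rule mon_nat_transI; simp add: assms)
qed

lemma mnt_Comp:
  fixes B :: "('ob, 'mb) smcat" (structure)
  assumes "mon_nat_trans A B \<sigma>" "mon_nat_trans A B \<tau>" "ndom \<tau> = ncod \<sigma>"
  shows "mon_nat_trans A B (Comp (hom_cat A B) \<tau> \<sigma>)"
proof -
  interpret s: mon_nat_trans A B \<sigma> by fact
  interpret t: mon_nat_trans A B \<tau> by fact
  note [simp] = assms(3)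
  show ?thesis
    unfolding hom_cat_def
  proof (simp, rule mon_nat_transI)
    fix f assume "f \<in> Arr A"
    then show "farr (ncod \<tau>) f \<cdot> ncomp \<tau> (Dom A f) \<cdot> ncomp \<sigma> (Dom A f) =
      (ncomp \<tau> (Cod A f) \<cdot> ncomp \<sigma> (Cod A f)) \<cdot> farr (ndom \<sigma>) f"
      using t.ncomp_nat[of f] s.ncomp_nat[of f] by (simp add: s.F.B.ext2[OF t.ncomp_nat])
  next
    show "(ncomp \<tau> (Unit A) \<cdot> ncomp \<sigma> (Unit A)) \<cdot> funit (ndom \<sigma>) = funit (ncod \<tau>)"
      using t.ncomp_unit s.ncomp_unit by simp
  next
    fix a b assume "a \<in> Obj A" "b \<in> Obj A"
    then show "(ncomp \<tau> (a \<otimes>\<^bsub>A\<^esub> b) \<cdot> ncomp \<sigma> (a \<otimes>\<^bsub>A\<^esub> b)) \<cdot> ftens (ndom \<sigma>) (a, b) =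
      ftens (ncod \<tau>) (a, b) \<cdot> ((ncomp \<tau> a \<cdot> ncomp \<sigma> a) \<boxtimes> (ncomp \<tau> b \<cdot> ncomp \<sigma> b))"
      using s.ncomp_tens[of a b] t.ncomp_tens[of a b]
      by (simp add: s.F.B.ext2[OF t.ncomp_tens[simplified]] s.F.B.TensM_Comp_simp)
  qed (auto intro: s.F.sym_mon_functor_axioms t.G.sym_mon_functor_axioms)
qed

lemma mnt_TensM:
  fixes B :: "('ob, 'mb) smcat" (structure)
  assumes "mon_nat_trans A B \<sigma>" "mon_nat_trans A B \<tau>"
  shows "mon_nat_trans A B (TensM (hom_cat A B) \<sigma> \<tau>)"
proof -
  interpret s: mon_nat_trans A B \<sigma> by fact
  interpret t: mon_nat_trans A B \<tau> by fact
  show ?thesis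
    unfolding hom_cat_def
  proof (simp, rule mon_nat_transI)
    show "(ncomp \<sigma> (Unit A) \<boxtimes> ncomp \<tau> (Unit A)) \<cdot> funit (hom_tens A B (ndom \<sigma>) (ndom \<tau>)) =
      funit (hom_tens A B (ncod \<sigma>) (ncod \<tau>))"
      by (simp add: s.F.B.TensM_Comp_ext s.ncomp_unit t.ncomp_unit)
  next
    fix a b assume "a \<in> Obj A" "b \<in> Obj A"
    then show "(ncomp \<sigma> (a \<otimes>\<^bsub>A\<^esub> b) \<boxtimes> ncomp \<tau> (a \<otimes>\<^bsub>A\<^esub> b)) \<cdot> ftens (hom_tens A B (ndom \<sigma>) (ndom \<tau>)) (a, b) =
       ftens (hom_tens A B (ncod \<sigma>) (ncod \<tau>)) (a, b) \<cdot> ((ncomp \<sigma> a \<boxtimes> ncomp \<tau> a) \<boxtimes> (ncomp \<sigma> b \<boxtimes> ncomp \<tau> b))"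
      by (simp add: s.F.B.TensM_Comp_ext s.ncomp_tens t.ncomp_tens s.F.B.interchange_nat)
  qed (auto simp: s.F.B.TensM_Comp_simp s.ncomp_nat t.ncomp_nat
      intro!: sym_mon_functor_hom_tens s.F.sym_mon_functor_axioms t.F.sym_mon_functor_axioms
        s.G.sym_mon_functor_axioms t.G.sym_mon_functor_axioms)
qed

lemma mnt_ass:
  fixes B :: "('ob, 'mb) smcat" (structure)
  assumes "sym_mon_functor A B F" "sym_mon_functor A B G" "sym_mon_functor A B H"
  shows "mon_nat_trans A B (ass (hom_cat A B) F G H)"
proof -
  interpret F: sym_mon_functor A B F by fact
  interpret G: sym_mon_functor A B G by fact
  interpret H: sym_mon_functor A B H by fact
  let ?ass = "\<lambda>a. ass B (fobj F a) (fobj G a) (fobj H a)"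
  show ?thesis
    unfolding hom_cat_def
  proof (simp, rule mon_nat_transI)
    let ?i = "inv_arr B (lunit B (Unit B))"
    have "?ass (Unit A) \<cdot> funit (hom_tens A B F (hom_tens A B G H)) =
      ?ass (Unit A) \<cdot> (funit F \<boxtimes> (funit G \<boxtimes> funit H)) \<cdot> (Id B (Unit B) \<boxtimes> ?i) \<cdot> ?i" (is "?l = _")
      by (simp add: F.B.TensM_Comp_ext del: F.B.whisker_comp)
    also have "\<dots> = ((funit F \<boxtimes> funit G) \<boxtimes> funit H) \<cdot> (?i \<boxtimes> Id B (Unit B)) \<cdot> ?i"
      by (simp add: F.B.ass_nat_ext F.B.ext2[OF F.B.ass_Unit])
    also have "\<dots> = funit (hom_tens A B (hom_tens A B F G) H)"
      by (simp add: F.B.TensM_Comp_ext del: F.B.whisker_comp)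
    finally show "?l = \<dots>" .
  next
    fix a b assume o: "a \<in> Obj A" "b \<in> Obj A"
    have "?ass (a \<otimes>\<^bsub>A\<^esub> b) \<cdot> ftens (hom_tens A B F (hom_tens A B G H)) (a, b) =
      ?ass (a \<otimes>\<^bsub>A\<^esub> b) \<cdot> (ftens F (a, b) \<boxtimes> (ftens G (a, b) \<boxtimes> ftens H (a, b))) \<cdot>
       (Id B (fobj F a \<otimes> fobj F b) \<boxtimes> interchange B (fobj G a) (fobj H a) (fobj G b) (fobj H b)) \<cdot>
       interchange B (fobj F a) (fobj G a \<otimes> fobj H a) (fobj F b) (fobj G b \<otimes> fobj H b)" (is "?l = _")
      using o by (simp add: F.B.TensM_Comp_ext del: F.B.whisker_comp)
    also have "\<dots> = ((ftens F (a, b) \<boxtimes> ftens G (a, b)) \<boxtimes> ftens H (a, b)) \<cdot>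
       (interchange B (fobj F a) (fobj G a) (fobj F b) (fobj G b) \<boxtimes> Id B (fobj H a \<otimes> fobj H b)) \<cdot>
       interchange B (fobj F a \<otimes> fobj G a) (fobj H a) (fobj F b \<otimes> fobj G b) (fobj H b) \<cdot> (?ass a \<boxtimes> ?ass b)"
      using o by (simp add: F.B.ass_nat_ext F.B.interchange_hexagon')
    also have "\<dots> = ftens (hom_tens A B (hom_tens A B F G) H) (a, b) \<cdot> (?ass a \<boxtimes> ?ass b)"
      using o by (simp add: F.B.TensM_Comp_ext del: F.B.whisker_comp)
    finally show "?l = \<dots>" .
  qed (auto simp: F.B.ass_nat intro!: sym_mon_functor_hom_tens assms)
qed

lemma mnt_runit:
  fixes B :: "('ob, 'mb) smcat" (structure)
  assumes "sym_mon_functor A B F"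
  shows "mon_nat_trans A B (runit (hom_cat A B) F)"
proof -
  interpret F: sym_mon_functor A B F by fact
  show ?thesis
    unfolding hom_cat_def
  proof (simp, rule mon_nat_transI)
    show "runit B (fobj F (Unit A)) \<cdot> funit (hom_tens A B F (hom_unit A B)) = funit F"
      by (simp add: F.B.ext2[OF F.B.runit_nat]) (simp add: F.B.lunit_Unit)
  next
    fix a b assume o: "a \<in> Obj A" "b \<in> Obj A"
    have "runit B (fobj F (a \<otimes>\<^bsub>A\<^esub> b)) \<cdot> ftens (hom_tens A B F (hom_unit A B)) (a, b) =
      runit B (fobj F (a \<otimes>\<^bsub>A\<^esub> b)) \<cdot> (ftens F (a, b) \<boxtimes> Id B (Unit B)) \<cdot>
      (Id B (fobj F a \<otimes> fobj F b) \<boxtimes> lunit B (Unit B)) \<cdot> interchange B (fobj F a) (Unit B) (fobj F b) (Unit B)" (is "?l = _")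
      using o by (simp add: F.B.TensM_Comp_ext)
    also have "\<dots> = ftens F (a, b) \<cdot> (runit B (fobj F a \<otimes> fobj F b) \<cdot>
      (Id B (fobj F a \<otimes> fobj F b) \<boxtimes> lunit B (Unit B))) \<cdot> interchange B (fobj F a) (Unit B) (fobj F b) (Unit B)"
      using o by (simp add: F.B.ext2[OF F.B.runit_nat])
    also have "\<dots> = ftens F (a, b) \<cdot> (runit B (fobj F a) \<boxtimes> runit B (fobj F b))"
      using o by (subst F.B.interchange_runit[symmetric]) (auto simp: F.B.interchange_interchange)
    finally show "?l = \<dots>" .
  qed (auto simp: F.B.runit_nat assms F.A.sym_mon_cat_axioms F.B.sym_mon_cat_axioms
     intro!: sym_mon_functor_hom_tens sym_mon_functor_hom_unit)
qed

lemma mnt_lunit: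
  fixes B :: "('ob, 'mb) smcat" (structure)
  assumes "sym_mon_functor A B F"
  shows "mon_nat_trans A B (lunit (hom_cat A B) F)"
proof -
  interpret F: sym_mon_functor A B F by fact
  show ?thesis
    unfolding hom_cat_def
  proof (simp, rule mon_nat_transI)
    show "lunit B (fobj F (Unit A)) \<cdot> funit (hom_tens A B (hom_unit A B) F) = funit F"
      by (simp add: F.B.ext2[OF F.B.lunit_nat])
  next
    fix a b assume o: "a \<in> Obj A" "b \<in> Obj A"
    have "lunit B (fobj F (a \<otimes>\<^bsub>A\<^esub> b)) \<cdot> ftens (hom_tens A B (hom_unit A B) F) (a, b) =
      lunit B (fobj F (a \<otimes>\<^bsub>A\<^esub> b)) \<cdot> (Id B (Unit B) \<boxtimes> ftens F (a, b)) \<cdot>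
      (lunit B (Unit B) \<boxtimes> Id B (fobj F a \<otimes> fobj F b)) \<cdot> interchange B (Unit B) (fobj F a) (Unit B) (fobj F b)" (is "?l = _")
      using o by (simp add: F.B.TensM_Comp_ext)
    also have "\<dots> = ftens F (a, b) \<cdot> (lunit B (fobj F a \<otimes> fobj F b) \<cdot>
      (lunit B (Unit B) \<boxtimes> Id B (fobj F a \<otimes> fobj F b))) \<cdot> interchange B (Unit B) (fobj F a) (Unit B) (fobj F b)"
      using o by (simp add: F.B.ext2[OF F.B.lunit_nat])
    also have "\<dots> = ftens F (a, b) \<cdot> (lunit B (fobj F a) \<boxtimes> lunit B (fobj F b))"
      using o by (subst F.B.interchange_lunit[symmetric]) (auto simp: F.B.interchange_interchange)
    finally show "?l = \<dots>" .
  qed (auto simp: F.B.lunit_nat assms F.A.sym_mon_cat_axioms F.B.sym_mon_cat_axioms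
     intro!: sym_mon_functor_hom_tens sym_mon_functor_hom_unit)
qed

lemma mnt_symm:
  fixes B :: "('ob, 'mb) smcat" (structure)
  assumes "sym_mon_functor A B F" "sym_mon_functor A B G"
  shows "mon_nat_trans A B (symm (hom_cat A B) F G)"
proof -
  interpret F: sym_mon_functor A B F by fact
  interpret G: sym_mon_functor A B G by fact
  show ?thesis
    unfolding hom_cat_def
  proof (simp, rule mon_nat_transI)
    show "symm B (fobj F (Unit A)) (fobj G (Unit A)) \<cdot> funit (hom_tens A B F G) = funit (hom_tens A B G F)"
      by (simp add: F.B.ext2[OF F.B.symm_nat] F.B.symm_Unit_Unit)
  next
    fix a b assume o: "a \<in> Obj A" "b \<in> Obj A"
    then show "symm B (fobj F (a \<otimes>\<^bsub>A\<^esub> b)) (fobj G (a \<otimes>\<^bsub>A\<^esub> b)) \<cdot> ftens (hom_tens A B F G) (a, b) =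
      ftens (hom_tens A B G F) (a, b) \<cdot> (symm B (fobj F a) (fobj G a) \<boxtimes> symm B (fobj F b) (fobj G b))"
      by (simp add: F.B.ext2[OF F.B.symm_nat] F.B.interchange_symm)
  qed (auto simp: F.B.symm_nat intro!: sym_mon_functor_hom_tens assms)
qed

text \<open>The inverted components form a monoidal transformation because each law of
  \<open>\<sigma>\<close> can be solved for them. Isomorphisms of [A,B] are thus recognised
  pointwise, which later gives the inverses of \<epsilon> used in En.\<close>

lemma hom_cat_inverse_arrs:
  fixes B :: "('ob, 'mb) smcat" (structure)
  assumes "mon_nat_trans A B \<sigma>" "\<And>a. a \<in> Obj A \<Longrightarrow> is_iso B (ncomp \<sigma> a)"
  shows "inverse_arrs (hom_cat A B) \<sigma>
    \<lparr>ndom = ncod \<sigma>, ncod = ndom \<sigma>, ncomp = (\<lambda>a\<in>Obj A. inv_arr B (ncomp \<sigma> a))\<rparr>"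
    (is "inverse_arrs _ _ ?\<tau>")
proof -
  interpret s: mon_nat_trans A B \<sigma> by fact
  note [simp] = assms(2)
  have t: "mon_nat_trans A B ?\<tau>"
  proof (rule mon_nat_transI)
    fix f assume f: "f \<in> Arr A"
    have "ncomp \<sigma> (Cod A f) \<cdot> farr (ndom \<sigma>) f \<cdot> inv_arr B (ncomp \<sigma> (Dom A f)) = farr (ncod \<sigma>) f"
      using f by (simp add: s.F.B.ext2[OF s.ncomp_nat[OF _ HOL.refl, symmetric]])
    from s.F.B.inv_arr_move_left[OF this] f
    show "farr (ndom \<sigma>) f \<cdot> inv_arr B (ncomp \<sigma> (Dom A f)) = inv_arr B (ncomp \<sigma> (Cod A f)) \<cdot> farr (ncod \<sigma>) f"
      by simp
  next
    show "inv_arr B (ncomp \<sigma> (Unit A)) \<cdot> funit (ncod \<sigma>) = funit (ndom \<sigma>)"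
      by (simp flip: s.ncomp_unit)
  next
    fix a b assume o: "a \<in> Obj A" "b \<in> Obj A"
    have "ncomp \<sigma> (a \<otimes>\<^bsub>A\<^esub> b) \<cdot> ftens (ndom \<sigma>) (a, b) \<cdot> (inv_arr B (ncomp \<sigma> a) \<boxtimes> inv_arr B (ncomp \<sigma> b)) =
       ftens (ncod \<sigma>) (a, b)"
      using o by (simp add: s.F.B.ext2[OF s.ncomp_tens] s.F.B.TensM_Comp_simp)
    from s.F.B.inv_arr_move_left[OF this] o
    show "inv_arr B (ncomp \<sigma> (a \<otimes>\<^bsub>A\<^esub> b)) \<cdot> ftens (ncod \<sigma>) (a, b) =
       ftens (ndom \<sigma>) (a, b) \<cdot> (inv_arr B (ncomp \<sigma> a) \<boxtimes> inv_arr B (ncomp \<sigma> b))"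
      by simp
  qed (auto intro: s.F.sym_mon_functor_axioms s.G.sym_mon_functor_axioms)
  show ?thesis
    unfolding inverse_arrs_def in_Hom_iff
    by (intro conjI mnt_eqI[of A B] mnt_Comp mnt_Id)
      (auto simp: assms(1) t intro: s.F.sym_mon_functor_axioms s.G.sym_mon_functor_axioms)
qed

lemma hom_cat_is_iso:
  assumes "mon_nat_trans A B \<sigma>" "\<And>a. a \<in> Obj A \<Longrightarrow> is_iso B (ncomp \<sigma> a)"
  shows "is_iso (hom_cat A B) \<sigma>"
  unfolding is_iso_def by (rule exI) (rule hom_cat_inverse_arrs[OF assms])

text \<open>Componentwise, each axiom of [A,B] is the same axiom of B; the content lies in the
  structure arrows being monoidal.\<close>

lemma sym_mon_cat_hom_cat:
  assumes "sym_mon_cat A" "sym_mon_cat B"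
  shows "sym_mon_cat (hom_cat A B)"
proof -
  let ?H = "hom_cat A B"
  interpret A: sym_mon_cat A by fact
  interpret B: sym_mon_cat B by fact
  note simps = sym_mon_functor.fobj_simp mon_nat_trans.ncomp_simps
  note closed = mnt_Id mnt_Comp mnt_TensM mnt_ass mnt_runit mnt_lunit mnt_symm
    sym_mon_functor_hom_tens sym_mon_functor_hom_unit[OF assms] mon_nat_trans_functors
  show ?thesis
  proof (unfold_locales, unfold in_Hom_iff)
    fix a b c assume "a \<in> Obj ?H" "b \<in> Obj ?H" "c \<in> Obj ?H"
    then show "is_iso ?H (ass ?H a b c)"
      by (intro hom_cat_is_iso) (auto simp: closed simps)
  next
    fix a assume "a \<in> Obj ?H"
    then show "is_iso ?H (runit ?H a)" "is_iso ?H (lunit ?H a)"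
      by (intro hom_cat_is_iso; auto simp: closed simps)+
  next
    fix a b c d assume "a \<in> Obj ?H" "b \<in> Obj ?H" "c \<in> Obj ?H" "d \<in> Obj ?H"
    then show "ass ?H (a \<otimes>\<^bsub>?H\<^esub> b) c d \<cdot>\<^bsub>?H\<^esub> ass ?H a b (c \<otimes>\<^bsub>?H\<^esub> d) =
      (ass ?H a b c \<boxtimes>\<^bsub>?H\<^esub> Id ?H d) \<cdot>\<^bsub>?H\<^esub> ass ?H a (b \<otimes>\<^bsub>?H\<^esub> c) d \<cdot>\<^bsub>?H\<^esub>
        (Id ?H a \<boxtimes>\<^bsub>?H\<^esub> ass ?H b c d)"
      by (intro mnt_eqI[of A B]) (auto intro!: closed simp: B.pentagon simps)
  next
    fix a b c assume "a \<in> Obj ?H" "b \<in> Obj ?H" "c \<in> Obj ?H"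
    then show "ass ?H c a b \<cdot>\<^bsub>?H\<^esub> symm ?H (a \<otimes>\<^bsub>?H\<^esub> b) c \<cdot>\<^bsub>?H\<^esub> ass ?H a b c =
       (symm ?H a c \<boxtimes>\<^bsub>?H\<^esub> Id ?H b) \<cdot>\<^bsub>?H\<^esub> ass ?H a c b \<cdot>\<^bsub>?H\<^esub>
        (Id ?H a \<boxtimes>\<^bsub>?H\<^esub> symm ?H b c)"
      by (intro mnt_eqI[of A B]) (auto intro!: closed simp: B.hexagon simps)
  qed (auto intro!: mnt_eqI[of A B] closed simp: simps B.TensM_Comp_simp B.ass_nat B.runit_nat B.lunit_nat
       B.symm_nat B.symm_symm B.triangle B.symm_unit)
qed

lemma hom_cat_inv_ncomp:
  assumes "mon_nat_trans A B \<sigma>" "\<And>a. a \<in> Obj A \<Longrightarrow> is_iso B (ncomp \<sigma> a)"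
  shows "a \<in> Obj A \<Longrightarrow> ncomp (inv_arr (hom_cat A B) \<sigma>) a = inv_arr B (ncomp \<sigma> a)"
proof -
  interpret s: mon_nat_trans A B \<sigma> by fact
  interpret H: sym_mon_cat "hom_cat A B"
    by (rule sym_mon_cat_hom_cat) (rule s.F.A.sym_mon_cat_axioms s.F.B.sym_mon_cat_axioms)+
  show "a \<in> Obj A \<Longrightarrow> ncomp (inv_arr (hom_cat A B) \<sigma>) a = inv_arr B (ncomp \<sigma> a)"
    by (subst H.inv_arr_eqI[OF hom_cat_inverse_arrs[OF assms]]) auto
qed

subsection \<open>Whiskering and post-composition\<close>

lemma mnt_whisker_l:
  fixes C :: "('oc, 'mc) smcat" (structure)
  assumes "mon_nat_trans A B \<theta>" "sym_mon_functor B C F"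
  shows "mon_nat_trans A C (whisker_l A C F \<theta>)"
proof -
  interpret t: mon_nat_trans A B \<theta> by fact
  interpret F: sym_mon_functor B C F by fact
  show ?thesis
    unfolding whisker_l_def
  proof (rule mon_nat_transI)
    fix f assume "f \<in> Arr A"
    then show "farr (smf_comp A C F (ncod \<theta>)) f \<cdot> farr F (ncomp \<theta> (Dom A f)) =
      farr F (ncomp \<theta> (Cod A f)) \<cdot> farr (smf_comp A C F (ndom \<theta>)) f"
      by (simp add: t.ncomp_nat flip: F.farr_Comp_simp)
  next
    show "farr F (ncomp \<theta> (Unit A)) \<cdot> funit (smf_comp A C F (ndom \<theta>)) = funit (smf_comp A C F (ncod \<theta>))"
      using arg_cong[OF t.ncomp_unit, of "farr F"] by (simp flip: F.B.Comp_assoc_simp)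
  next
    fix a b assume o: "a \<in> Obj A" "b \<in> Obj A"
    have "farr F (ncomp \<theta> (a \<otimes>\<^bsub>A\<^esub> b)) \<cdot> ftens (smf_comp A C F (ndom \<theta>)) (a, b) =
      farr F (ncomp \<theta> (a \<otimes>\<^bsub>A\<^esub> b) \<cdot>\<^bsub>B\<^esub> ftens (ndom \<theta>) (a, b)) \<cdot> ftens F (fobj (ndom \<theta>) a, fobj (ndom \<theta>) b)" (is "?l = _")
      using o by simp
    also have "\<dots> = ftens (smf_comp A C F (ncod \<theta>)) (a, b) \<cdot> (farr F (ncomp \<theta> a) \<boxtimes> farr F (ncomp \<theta> b))"
      using o by (subst t.ncomp_tens) (auto simp: F.ftens_nat)
    finally show "?l = \<dots>" .
  qed (auto intro!: sym_mon_functor_comp[of A B] assms t.F.sym_mon_functor_axioms t.G.sym_mon_functor_axioms)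
qed

lemma mnt_whisker_r:
  fixes C :: "('oc, 'mc) smcat" (structure)
  assumes "mon_nat_trans B C \<sigma>" "sym_mon_functor A B H"
  shows "mon_nat_trans A C (whisker_r A C \<sigma> H)"
proof -
  interpret s: mon_nat_trans B C \<sigma> by fact
  interpret H: sym_mon_functor A B H by fact
  show ?thesis
    unfolding whisker_r_def
  proof (rule mon_nat_transI)
    show "ncomp \<sigma> (fobj H (Unit A)) \<cdot> funit (smf_comp A C (ndom \<sigma>) H) = funit (smf_comp A C (ncod \<sigma>) H)"
      using s.F.B.ext2[OF s.ncomp_nat[of "funit H" "Unit B", symmetric], of "funit (ndom \<sigma>)"]
      by (simp add: s.ncomp_unit)
  next
    fix a b assume o: "a \<in> Obj A" "b \<in> Obj A"
    have "ncomp \<sigma> (fobj H (a \<otimes>\<^bsub>A\<^esub> b)) \<cdot> ftens (smf_comp A C (ndom \<sigma>) H) (a, b) =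
      (ncomp \<sigma> (Cod B (ftens H (a, b))) \<cdot> farr (ndom \<sigma>) (ftens H (a, b))) \<cdot> ftens (ndom \<sigma>) (fobj H a, fobj H b)" (is "?l = _")
      using o by simp
    also have "\<dots> = ftens (smf_comp A C (ncod \<sigma>) H) (a, b) \<cdot> (ncomp \<sigma> (fobj H a) \<boxtimes> ncomp \<sigma> (fobj H b))"
      using o by (subst s.ncomp_nat[OF _ HOL.refl, symmetric]) (auto simp: s.ncomp_tens)
    finally show "?l = \<dots>" .
  qed (auto intro!: sym_mon_functor_comp[of A B] assms s.F.sym_mon_functor_axioms s.G.sym_mon_functor_axioms
      simp: s.ncomp_nat)
qed

lemma whisker_simps [simp]:
  "ndom (whisker_l A C F \<theta>) = smf_comp A C F (ndom \<theta>)" "ncod (whisker_l A C F \<theta>) = smf_comp A C F (ncod \<theta>)"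
  "a \<in> Obj A \<Longrightarrow> ncomp (whisker_l A C F \<theta>) a = farr F (ncomp \<theta> a)"
  "ndom (whisker_r A C \<sigma> H) = smf_comp A C (ndom \<sigma>) H" "ncod (whisker_r A C \<sigma> H) = smf_comp A C (ncod \<sigma>) H"
  "a \<in> Obj A \<Longrightarrow> ncomp (whisker_r A C \<sigma> H) a = ncomp \<sigma> (fobj H a)"
  by (auto simp: whisker_l_def whisker_r_def)

lemma hom_post_simps [simp]:
  "sym_mon_functor A B H \<Longrightarrow> fobj (hom_post A B C F) H = smf_comp A C F H"
  "mon_nat_trans A B \<theta> \<Longrightarrow> farr (hom_post A B C F) \<theta> = whisker_l A C F \<theta>"
  "ndom (funit (hom_post A B C F)) = hom_unit A C"
  "ncod (funit (hom_post A B C F)) = smf_comp A C F (hom_unit A B)"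
  "a \<in> Obj A \<Longrightarrow> ncomp (funit (hom_post A B C F)) a = funit F"
  "sym_mon_functor A B H \<Longrightarrow> sym_mon_functor A B K \<Longrightarrow> ndom (ftens (hom_post A B C F) (H, K)) =
    hom_tens A C (smf_comp A C F H) (smf_comp A C F K)"
  "sym_mon_functor A B H \<Longrightarrow> sym_mon_functor A B K \<Longrightarrow> ncod (ftens (hom_post A B C F) (H, K)) =
    smf_comp A C F (hom_tens A B H K)"
  "sym_mon_functor A B H \<Longrightarrow> sym_mon_functor A B K \<Longrightarrow> a \<in> Obj A \<Longrightarrow>
    ncomp (ftens (hom_post A B C F) (H, K)) a = ftens F (fobj H a, fobj K a)"
  by (auto simp: hom_post_def)

lemma mnt_hom_post_unit:
  fixes C :: "('oc, 'mc) smcat" (structure)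
  assumes "sym_mon_cat A" "sym_mon_functor B C F"
  shows "mon_nat_trans A C (funit (hom_post A B C F))"
proof -
  interpret A: sym_mon_cat A by fact
  interpret F: sym_mon_functor B C F by fact
  \<comment> \<open>The tensor law of the transformation constant at F^0. It comes from
    \<open>ftens_lunit\<close> at the unit, with the tensor square of F^0 split into two
    whiskerings.\<close>
  have "funit F \<cdot> lunit C (Unit C) = farr F (lunit B (Unit B)) \<cdot> ftens F (Unit B, Unit B) \<cdot>
      ((funit F \<boxtimes> Id C (fobj F (Unit B))) \<cdot> (Id C (Unit C) \<boxtimes> funit F))"
    by (simp add: F.B.ext3[OF F.ftens_lunit] F.B.lunit_nat)
  also have "\<dots> = farr F (lunit B (Unit B)) \<cdot> ftens F (Unit B, Unit B) \<cdot> (funit F \<boxtimes> funit F)"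
    by (subst F.B.TensM_Comp_simp) auto
  finally show ?thesis
    unfolding hom_post_def
    by simp (rule mon_nat_transI, auto intro!: sym_mon_functor_comp[of A B] sym_mon_functor_hom_unit assms
        F.A.sym_mon_cat_axioms F.B.sym_mon_cat_axioms)
qed

lemma mnt_hom_post_tens:
  fixes C :: "('oc, 'mc) smcat" (structure)
  assumes "sym_mon_functor B C F" "sym_mon_functor A B H" "sym_mon_functor A B K"
  shows "mon_nat_trans A C (ftens (hom_post A B C F) (H, K))"
proof -
  interpret F: sym_mon_functor B C F by fact
  interpret H: sym_mon_functor A B H by fact
  interpret K: sym_mon_functor A B K by fact
  have "mon_nat_trans A C \<lparr>ndom = hom_tens A C (smf_comp A C F H) (smf_comp A C F K),
      ncod = smf_comp A C F (hom_tens A B H K), ncomp = (\<lambda>a\<in>Obj A. ftens F (fobj H a, fobj K a))\<rparr>"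
  proof (rule mon_nat_transI)
    let ?i = "lunit B (Unit B)"
    \<comment> \<open>The unit law with H^0 and K^0 stripped off; they return through naturality of
      F^2.\<close>
    have 1: "ftens F (Unit B, Unit B) \<cdot> (funit F \<boxtimes> funit F) \<cdot> inv_arr C (lunit C (Unit C)) = farr F (inv_arr B ?i) \<cdot> funit F"
    proof (rule F.B.iso_monic[of "farr F ?i"])
      have "farr F ?i \<cdot> ftens F (Unit B, Unit B) \<cdot> (funit F \<boxtimes> funit F) \<cdot> inv_arr C (lunit C (Unit C)) =
        farr F ?i \<cdot> ftens F (Unit B, Unit B) \<cdot> ((funit F \<boxtimes> Id C (fobj F (Unit B))) \<cdot> (Id C (Unit C) \<boxtimes> funit F)) \<cdot> inv_arr C (lunit C (Unit C))"
        by (subst F.B.TensM_Comp_simp) auto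
      also have "\<dots> = funit F"
        by (simp add: F.B.ext3[OF F.ftens_lunit] F.B.ext2[OF F.B.lunit_nat])
      also have "\<dots> = farr F (?i \<cdot>\<^bsub>B\<^esub> inv_arr B ?i) \<cdot> funit F"
        by simp
      finally show "farr F ?i \<cdot> ftens F (Unit B, Unit B) \<cdot> (funit F \<boxtimes> funit F) \<cdot> inv_arr C (lunit C (Unit C)) =
        farr F ?i \<cdot> farr F (inv_arr B ?i) \<cdot> funit F"
        by (subst (asm) F.farr_Comp_simp) auto
    qed auto
    show "ftens F (fobj H (Unit A), fobj K (Unit A)) \<cdot> funit (hom_tens A C (smf_comp A C F H) (smf_comp A C F K)) =
      funit (smf_comp A C F (hom_tens A B H K))"
    proof -
      have "(farr F (funit H) \<cdot> funit F) \<boxtimes> (farr F (funit K) \<cdot> funit F) =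
        (farr F (funit H) \<boxtimes> farr F (funit K)) \<cdot> (funit F \<boxtimes> funit F)"
        by (simp add: F.B.TensM_Comp_simp)
      then show ?thesis
        using F.ftens_nat_ext[of "funit H" "funit K" "Unit B" "Unit B"] by (simp add: 1[symmetric])
    qed
  next
    fix a b assume o: "a \<in> Obj A" "b \<in> Obj A"
    have "ftens F (fobj H (a \<otimes>\<^bsub>A\<^esub> b), fobj K (a \<otimes>\<^bsub>A\<^esub> b)) \<cdot> ftens (hom_tens A C (smf_comp A C F H) (smf_comp A C F K)) (a, b) =
      (ftens F (Cod B (ftens H (a, b)), Cod B (ftens K (a, b))) \<cdot> (farr F (ftens H (a, b)) \<boxtimes> farr F (ftens K (a, b)))) \<cdot>
      (ftens F (fobj H a, fobj H b) \<boxtimes> ftens F (fobj K a, fobj K b)) \<cdot>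
      interchange C (fobj F (fobj H a)) (fobj F (fobj K a)) (fobj F (fobj H b)) (fobj F (fobj K b))" (is "?l = _")
      using o by (simp add: F.B.TensM_Comp_ext)
    also have "\<dots> = farr F (ftens H (a, b) \<boxtimes>\<^bsub>B\<^esub> ftens K (a, b)) \<cdot>
      (ftens F (fobj H a \<otimes>\<^bsub>B\<^esub> fobj H b, fobj K a \<otimes>\<^bsub>B\<^esub> fobj K b) \<cdot>
      (ftens F (fobj H a, fobj H b) \<boxtimes> ftens F (fobj K a, fobj K b)) \<cdot>
      interchange C (fobj F (fobj H a)) (fobj F (fobj K a)) (fobj F (fobj H b)) (fobj F (fobj K b)))"
      using o by (subst F.ftens_nat[OF _ _ HOL.refl HOL.refl, symmetric]) auto
    also have "\<dots> = ftens (smf_comp A C F (hom_tens A B H K)) (a, b) \<cdot>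
      (ftens F (fobj H a, fobj K a) \<boxtimes> ftens F (fobj H b, fobj K b))"
      using o by (subst F.ftens_interchange[symmetric]) auto
    finally show "?l = \<dots>" .
  qed (auto simp: F.ftens_nat intro!: sym_mon_functor_comp[of A B] sym_mon_functor_hom_tens assms)
  then show ?thesis
    using assms by (simp add: hom_post_def)
qed

lemma sym_mon_functor_hom_post:
  fixes A :: "('oa, 'ma) smcat"
  assumes "sym_mon_cat A" "sym_mon_functor B C F"
  shows "sym_mon_functor (hom_cat A B) (hom_cat A C) (hom_post A B C F)"
proof -
  interpret A: sym_mon_cat A by fact
  interpret F: sym_mon_functor B C F by fact
  interpret AB: sym_mon_cat "hom_cat A B"
    by (rule sym_mon_cat_hom_cat) (rule A.sym_mon_cat_axioms F.A.sym_mon_cat_axioms)+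
  interpret AC: sym_mon_cat "hom_cat A C"
    by (rule sym_mon_cat_hom_cat) (rule A.sym_mon_cat_axioms F.B.sym_mon_cat_axioms)+
  let ?P = "hom_post A B C F"
  note simps = sym_mon_functor.fobj_simp mon_nat_trans.ncomp_simps
  note closed = mnt_Id mnt_Comp mnt_TensM mnt_ass mnt_runit mnt_lunit mnt_symm
    sym_mon_functor_hom_tens sym_mon_functor_hom_unit mon_nat_trans_functors assms
    A.sym_mon_cat_axioms F.A.sym_mon_cat_axioms F.B.sym_mon_cat_axioms
    mnt_hom_post_unit[OF assms] mnt_hom_post_tens[OF assms(2)] mnt_whisker_l[OF _ assms(2)]
    sym_mon_functor_comp[OF _ assms(2)] AB.sym_mon_cat_axioms AC.sym_mon_cat_axioms
  \<comment> \<open>Restating \<open>hom_post\<close> through its own fields lets the simp rules for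
    its components apply; \<open>restrict_cong\<close> identifies the two records at the
    end.\<close>
  have "sym_mon_functor (hom_cat A B) (hom_cat A C) \<lparr>fobj = (\<lambda>H\<in>Obj (hom_cat A B). fobj ?P H),
      farr = (\<lambda>\<theta>\<in>Arr (hom_cat A B). farr ?P \<theta>), funit = funit ?P,
      ftens = (\<lambda>p\<in>Obj (hom_cat A B) \<times> Obj (hom_cat A B). ftens ?P p)\<rparr>"
    by (rule sym_mon_functorI)
      (auto intro!: mnt_eqI[of A C] simp: closed simps F.ftens_nat F.ftens_ass F.ftens_runit F.ftens_lunit F.ftens_symm)
  then show ?thesis
    by (simp add: hom_post_def cong: restrict_cong)
qed

lemma mnt_hom_post_nt:
  fixes A :: "('oa, 'ma) smcat"
  assumes A: "sym_mon_cat A" and \<sigma>: "mon_nat_trans B C \<sigma>"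
  shows "mon_nat_trans (hom_cat A B) (hom_cat A C) (hom_post_nt A B C \<sigma>)"
proof -
  interpret A: sym_mon_cat A by fact
  interpret s: mon_nat_trans B C \<sigma> by fact
  interpret AB: sym_mon_cat "hom_cat A B"
    by (rule sym_mon_cat_hom_cat) (rule A.sym_mon_cat_axioms s.F.A.sym_mon_cat_axioms)+
  interpret AC: sym_mon_cat "hom_cat A C"
    by (rule sym_mon_cat_hom_cat) (rule A.sym_mon_cat_axioms s.F.B.sym_mon_cat_axioms)+
  note simps = sym_mon_functor.fobj_simp mon_nat_trans.ncomp_simps
  note F = s.F.sym_mon_functor_axioms and G = s.G.sym_mon_functor_axioms
  note closed = mnt_Id mnt_Comp mnt_TensM
    sym_mon_functor_hom_tens sym_mon_functor_hom_unit mon_nat_trans_functors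
    A.sym_mon_cat_axioms s.F.A.sym_mon_cat_axioms s.F.B.sym_mon_cat_axioms
    mnt_hom_post_unit[OF A F] mnt_hom_post_unit[OF A G] mnt_hom_post_tens[OF F] mnt_hom_post_tens[OF G]
    mnt_whisker_l[OF _ F] mnt_whisker_l[OF _ G] mnt_whisker_r[OF \<sigma>]
    sym_mon_functor_comp[OF _ F] sym_mon_functor_comp[OF _ G]
  show ?thesis
    unfolding hom_post_nt_def
    by (rule mon_nat_transI)
      (auto intro!: mnt_eqI[of A C] sym_mon_functor_hom_post A F G
        simp: closed simps s.ncomp_nat s.ncomp_unit s.ncomp_tens)
qed

section \<open>The tensor product is a symmetric monoidal category\<close>

locale smc_pair = A: sym_mon_cat A + B: sym_mon_cat B
  for A :: "('oa, 'ma) smcat" and B :: "('ob, 'mb) smcat"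
begin

abbreviation "cl \<equiv> tclass A B"
abbreviation "T \<equiv> tensor_cat A B"

section \<open>Calculus with classes of arrow expressions\<close>

lemma twf_words [simp]:
  assumes "twf A B t" shows "is_word A B (tdom A B t)" "is_word A B (tcod A B t)"
  using assms by (induction t) auto

lemma ttens_simps [simp]:
  "tdom A B (ttens A B t u) = tdom A B t \<odot> tdom A B u"
  "tcod A B (ttens A B t u) = tcod A B t \<odot> tcod A B u"
  "twf A B (ttens A B t u) \<longleftrightarrow> twf A B t \<and> twf A B u"
  by (auto simp: ttens_def)

lemma texch_simps [simp]:
  "tdom A B (texch X Y Z W) = (X \<odot> Y) \<odot> (Z \<odot> W)" "tcod A B (texch X Y Z W) = (X \<odot> Z) \<odot> (Y \<odot> W)"
  "twf A B (texch X Y Z W) \<longleftrightarrow> is_word A B X \<and> is_word A B Y \<and> is_word A B Z \<and> is_word A B W"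
  by (auto simp: texch_def)

lemma trel_ends:
  "trel A B t u \<Longrightarrow> twf A B t \<Longrightarrow> twf A B u \<Longrightarrow> tdom A B t = tdom A B u \<and> tcod A B t = tcod A B u"
  by (induction rule: trel.induct) auto

lemma tcong_ends:
  "tcong A B t u \<Longrightarrow> twf A B t \<and> twf A B u \<and> tdom A B t = tdom A B u \<and> tcod A B t = tcod A B u"
  by (induction rule: tcong.induct) (auto dest: trel_ends)

lemma cl_eq_iff: "twf A B t \<Longrightarrow> cl t = cl u \<longleftrightarrow> tcong A B t u"
  unfolding tclass_def by (auto intro: tcong.refl tcong.sym tcong.trans)

lemma trep_cong: "twf A B t \<Longrightarrow> tcong A B t (trep (cl t))"
  unfolding trep_def tclass_def by (rule someI2[of _ t]) (auto intro: tcong.refl)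

lemma trep_cl [simp]:
  assumes "twf A B t"
  shows "twf A B (trep (cl t))" "tdom A B (trep (cl t)) = tdom A B t" "tcod A B (trep (cl t)) = tcod A B t"
    "cl (trep (cl t)) = cl t"
  using tcong_ends[OF trep_cong[OF assms]] trep_cong[OF assms] by (auto simp: cl_eq_iff tcong.sym)

lemma clI: "trel A B t u \<Longrightarrow> twf A B t \<Longrightarrow> twf A B u \<Longrightarrow> cl t = cl u"
  by (simp add: cl_eq_iff tcong.base)

lemma cl_comp: "cl t = cl t' \<Longrightarrow> cl u = cl u' \<Longrightarrow> twf A B (t \<bullet> u) \<Longrightarrow> cl (t \<bullet> u) = cl (t' \<bullet> u')"
  by (simp add: cl_eq_iff tcong.comp)

lemma cl_left: "cl t = cl u \<Longrightarrow> twf A B t \<Longrightarrow> is_word A B X \<Longrightarrow> cl (TLeft X t) = cl (TLeft X u)"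
  by (simp add: cl_eq_iff tcong.left)

lemma cl_right: "cl t = cl u \<Longrightarrow> twf A B t \<Longrightarrow> is_word A B X \<Longrightarrow> cl (TRight t X) = cl (TRight u X)"
  by (simp add: cl_eq_iff tcong.right)

lemma cl_tens:
  assumes "cl t = cl t'" "cl u = cl u'" "twf A B t" "twf A B u"
  shows "cl (ttens A B t u) = cl (ttens A B t' u')"
proof -
  have "tcong A B t t'" "tcong A B u u'"
    using assms by (auto simp: cl_eq_iff)
  then have e: "tdom A B t = tdom A B t'" "tcod A B u = tcod A B u'" and "twf A B t'" "twf A B u'"
    by (auto dest: tcong_ends)
  then show ?thesis
    unfolding ttens_def e using assms by (intro cl_comp cl_left cl_right) (simp_all add: e)
qed

text \<open>Whiskerings are the primitive operations and \<open>ttens\<close> is derived from them,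
  so its agreement with them at identities has to be proved.\<close>

lemma cl_tens_Id:
  assumes "twf A B t" "is_word A B X"
  shows "cl (ttens A B t (TId X)) = cl (TRight t X)" "cl (ttens A B (TId X) t) = cl (TLeft X t)"
proof -
  have "cl (TLeft (tdom A B t) (TId X)) = cl (TId (tdom A B (TRight t X)))"
    by (simp, rule clI, rule trel.intros) (use assms in auto)
  moreover have "cl (TRight t X \<bullet> TId (tdom A B (TRight t X))) = cl (TRight t X)"
    by (rule clI, rule trel.intros) (use assms in auto)
  ultimately show "cl (ttens A B t (TId X)) = cl (TRight t X)"
    unfolding ttens_def using assms
      cl_comp[of "TRight t X" "TRight t X" "TLeft (tdom A B t) (TId X)" "TId (tdom A B (TRight t X))"] by auto
  have "cl (TRight (TId X) (tcod A B t)) = cl (TId (tcod A B (TLeft X t)))"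
    by (simp, rule clI, rule trel.intros) (use assms in auto)
  moreover have "cl (TId (tcod A B (TLeft X t)) \<bullet> TLeft X t) = cl (TLeft X t)"
    by (rule clI, rule trel.intros) (use assms in auto)
  ultimately show "cl (ttens A B (TId X) t) = cl (TLeft X t)"
    unfolding ttens_def using assms
      cl_comp[of "TRight (TId X) (tcod A B t)" "TId (tcod A B (TLeft X t))" "TLeft X t" "TLeft X t"] by auto
qed

lemma tensor_cat_cl:
  "Obj T = {X. is_word A B X}"
  "Unit T = WUnit" "TensO T = (\<odot>)" "Id T X = cl (TId X)"
  "ass T X Y Z = cl (TAss X Y Z)" "runit T X = cl (TR X)" "lunit T X = cl (TL X)" "symm T X Y = cl (TS X Y)"
  by (auto simp: tensor_cat_def)

lemma tensor_cat_cl_ends: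
  assumes "twf A B t"
  shows "cl t \<in> Arr T" "Dom T (cl t) = tdom A B t" "Cod T (cl t) = tcod A B t"
  using assms by (auto simp: tensor_cat_def)

text \<open>\<open>tensor_cat\<close> composes chosen representatives; as the congruence respects
  composition, any representatives may be used, and \<open>trep\<close> disappears from calculations
  in \<open>T\<close>.\<close>

lemma tensor_cat_Comp:
  assumes "twf A B (t \<bullet> u)"
  shows "Comp T (cl t) (cl u) = cl (t \<bullet> u)"
proof -
  have "cl (t \<bullet> u) = cl (trep (cl t) \<bullet> trep (cl u))"
    using assms by (intro cl_comp) auto
  then show ?thesis by (simp add: tensor_cat_def)
qed

lemma tensor_cat_TensM:
  assumes "twf A B t" "twf A B u"
  shows "TensM T (cl t) (cl u) = cl (ttens A B t u)"
proof -
  have "cl (ttens A B t u) = cl (ttens A B (trep (cl t)) (trep (cl u)))"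
    using assms by (intro cl_tens) auto
  then show ?thesis by (simp add: tensor_cat_def)
qed

lemma tensor_cat_TensM_Id:
  assumes "twf A B t" "is_word A B X"
  shows "TensM T (cl t) (cl (TId X)) = cl (TRight t X)" "TensM T (cl (TId X)) (cl t) = cl (TLeft X t)"
  using assms by (simp_all add: tensor_cat_TensM cl_tens_Id)

lemma tensor_cat_arrE [elim!]:
  assumes "p \<in> Arr T"
  obtains t where "p = cl t" "twf A B t"
  using assms by (auto simp: tensor_cat_def)

lemma cl_assoc:
  "twf A B t \<Longrightarrow> twf A B u \<Longrightarrow> twf A B v \<Longrightarrow> tcod A B u = tdom A B t \<Longrightarrow> tcod A B v = tdom A B u \<Longrightarrow>
   cl ((t \<bullet> u) \<bullet> v) = cl (t \<bullet> u \<bullet> v)"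
  by (rule clI, rule trel.intros) auto

lemma cl_tens_comp:
  assumes "twf A B (f' \<bullet> f)" "twf A B (g' \<bullet> g)"
  shows "cl (ttens A B (f' \<bullet> f) (g' \<bullet> g)) = cl (ttens A B f' g' \<bullet> ttens A B f g)"
proof -
  let ?X = "tdom A B f" and ?X' = "tdom A B f'" and ?Y' = "tdom A B g'" and ?Y'' = "tcod A B g'"
  let ?X'' = "tcod A B f'" and ?Y = "tdom A B g"
  have "cl (ttens A B (f' \<bullet> f) (g' \<bullet> g)) = cl (TRight (f' \<bullet> f) ?Y'' \<bullet> TLeft ?X (g' \<bullet> g))"
    by (simp add: ttens_def)
  also have "\<dots> = cl ((TRight f' ?Y'' \<bullet> TRight f ?Y'') \<bullet> (TLeft ?X g' \<bullet> TLeft ?X g))"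
    using assms by (intro cl_comp clI trel.intros) auto
  also have "\<dots> = cl (TRight f' ?Y'' \<bullet> TRight f ?Y'' \<bullet> TLeft ?X g' \<bullet> TLeft ?X g)"
    using assms by (simp add: cl_assoc)
  also have "\<dots> = cl (TRight f' ?Y'' \<bullet> (TRight f ?Y'' \<bullet> TLeft ?X g') \<bullet> TLeft ?X g)"
    by (rule cl_comp[OF HOL.refl cl_assoc[symmetric]]) (use assms in auto)
\<comment> \<open>The exchange relation between the two whiskerings slides \<open>f\<close> past
  \<open>g'\<close>; the remaining steps only split whiskerings and rebracket.\<close>
also have "\<dots> = cl (TRight f' ?Y'' \<bullet> (TLeft ?X' g' \<bullet> TRight f ?Y') \<bullet> TLeft ?X g)"
  proof -
    have "cl (TRight f (tcod A B g') \<bullet> TLeft (tdom A B f) g') = cl (TLeft (tcod A B f) g' \<bullet> TRight f (tdom A B g'))"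
      using assms by (intro clI trel.intros) auto
    then have "cl (TRight f ?Y'' \<bullet> TLeft ?X g') = cl (TLeft ?X' g' \<bullet> TRight f ?Y')"
      using assms by simp
    then show ?thesis
      by (rule cl_comp[OF HOL.refl cl_comp[OF _ HOL.refl]]) (use assms in auto)
  qed
  also have "\<dots> = cl (TRight f' ?Y'' \<bullet> TLeft ?X' g' \<bullet> TRight f ?Y' \<bullet> TLeft ?X g)"
    by (rule cl_comp[OF HOL.refl cl_assoc]) (use assms in auto)
  also have "\<dots> = cl ((TRight f' ?Y'' \<bullet> TLeft ?X' g') \<bullet> (TRight f ?Y' \<bullet> TLeft ?X g))"
    using assms by (simp add: cl_assoc)
also have "\<dots> = cl (ttens A B f' g' \<bullet> ttens A B f g)"
    using assms by (simp add: ttens_def)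
  finally show ?thesis .
qed

text \<open>Once arrows are written as classes, most axioms are defining relations, found by
  matching against \<open>trel.intros\<close>. Associativity of composition and compatibility of the
  tensor with composition were prepared as \<open>cl_assoc\<close> and
  \<open>cl_tens_comp\<close>.\<close>

sublocale T: sym_mon_cat T
proof (unfold_locales, unfold in_Hom_iff)
  note [simp] = tensor_cat_cl tensor_cat_cl_ends tensor_cat_Comp
  have isoI: "is_iso T (cl t)" if "twf A B t" "twf A B u" "tdom A B t = tcod A B u" "tcod A B t = tdom A B u"
    "cl (u \<bullet> t) = cl (TId (tdom A B t))" "cl (t \<bullet> u) = cl (TId (tcod A B t))" for t u
    using that unfolding is_iso_def inverse_arrs_def in_Hom_iff by (intro exI[of _ "cl u"]) auto
  fix X Y Z assume o: "X \<in> Obj T" "Y \<in> Obj T" "Z \<in> Obj T"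
  show "is_iso T (ass T X Y Z)"
    using o isoI[of "TAss X Y Z" "TAss' X Y Z"] by (simp add: clI trel.intros)
  show "is_iso T (runit T X)"
    using o isoI[of "TR X" "TR' X"] by (simp add: clI trel.intros)
  show "is_iso T (lunit T X)"
    using o isoI[of "TL X" "TL' X"] by (simp add: clI trel.intros)
  show "symm T Y X \<cdot>\<^bsub>T\<^esub> symm T X Y = Id T (X \<otimes>\<^bsub>T\<^esub> Y)"
    using o by (simp, intro clI trel.intros; simp)
  show "(runit T X \<boxtimes>\<^bsub>T\<^esub> Id T Z) \<cdot>\<^bsub>T\<^esub> ass T X (Unit T) Z = Id T X \<boxtimes>\<^bsub>T\<^esub> lunit T Z"
    using o by (simp add: tensor_cat_TensM_Id, intro clI trel.intros; simp)
  show "ass T Z X Y \<cdot>\<^bsub>T\<^esub> symm T (X \<otimes>\<^bsub>T\<^esub> Y) Z \<cdot>\<^bsub>T\<^esub> ass T X Y Z =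
     (symm T X Z \<boxtimes>\<^bsub>T\<^esub> Id T Y) \<cdot>\<^bsub>T\<^esub> ass T X Z Y \<cdot>\<^bsub>T\<^esub> (Id T X \<boxtimes>\<^bsub>T\<^esub> symm T Y Z)"
    using o by (simp add: tensor_cat_TensM_Id, intro clI trel.intros; simp)
  show "lunit T X \<cdot>\<^bsub>T\<^esub> symm T X (Unit T) = runit T X"
    using o by (simp, intro clI trel.intros; simp)
  fix W assume w: "W \<in> Obj T"
  show "ass T (X \<otimes>\<^bsub>T\<^esub> Y) Z W \<cdot>\<^bsub>T\<^esub> ass T X Y (Z \<otimes>\<^bsub>T\<^esub> W) =
     (ass T X Y Z \<boxtimes>\<^bsub>T\<^esub> Id T W) \<cdot>\<^bsub>T\<^esub> ass T X (Y \<otimes>\<^bsub>T\<^esub> Z) W \<cdot>\<^bsub>T\<^esub> (Id T X \<boxtimes>\<^bsub>T\<^esub> ass T Y Z W)"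
    using o w by (simp add: tensor_cat_TensM_Id, intro clI trel.intros; simp)
next
  note [simp] = tensor_cat_cl tensor_cat_cl_ends tensor_cat_Comp
  fix p X X' assume "p \<in> Arr T \<and> Dom T p = X \<and> Cod T p = X'"
  then obtain t where p: "p = cl t" "twf A B t" and X: "X = tdom A B t" "X' = tcod A B t"
    by auto
  show "p \<cdot>\<^bsub>T\<^esub> Id T X = p" "Id T X' \<cdot>\<^bsub>T\<^esub> p = p"
    using p X by (simp, intro clI trel.intros; simp)+
  show "runit T X' \<cdot>\<^bsub>T\<^esub> (p \<boxtimes>\<^bsub>T\<^esub> Id T (Unit T)) = p \<cdot>\<^bsub>T\<^esub> runit T X"
    by (insert p X, simp add: tensor_cat_TensM_Id, rule clI, rule trel.intros, simp_all)
  show "lunit T X' \<cdot>\<^bsub>T\<^esub> (Id T (Unit T) \<boxtimes>\<^bsub>T\<^esub> p) = p \<cdot>\<^bsub>T\<^esub> lunit T X"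
    by (insert p X, simp add: tensor_cat_TensM_Id, rule clI, rule trel.intros, simp_all)
next
  fix X Y assume "X \<in> Obj T" "Y \<in> Obj T"
  then show "Id T X \<boxtimes>\<^bsub>T\<^esub> Id T Y = Id T (X \<otimes>\<^bsub>T\<^esub> Y)"
    by (simp add: tensor_cat_TensM_Id tensor_cat_cl, intro clI trel.intros; simp)
next
  note [simp] = tensor_cat_cl tensor_cat_cl_ends tensor_cat_Comp tensor_cat_TensM
  fix p X X' q Y Y'
  assume "p \<in> Arr T \<and> Dom T p = X \<and> Cod T p = X'" "q \<in> Arr T \<and> Dom T q = Y \<and> Cod T q = Y'"
  then obtain t u where p: "p = cl t" "q = cl u" "twf A B t" "twf A B u"
      and X: "X = tdom A B t" "X' = tcod A B t" "Y = tdom A B u" "Y' = tcod A B u"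
    by auto
  show "symm T X' Y' \<cdot>\<^bsub>T\<^esub> (p \<boxtimes>\<^bsub>T\<^esub> q) = (q \<boxtimes>\<^bsub>T\<^esub> p) \<cdot>\<^bsub>T\<^esub> symm T X Y"
    using p X by (simp, intro clI trel.intros; simp)
  fix r Z Z' assume "r \<in> Arr T \<and> Dom T r = Z \<and> Cod T r = Z'"
  then obtain v where r: "r = cl v" "twf A B v" "Z = tdom A B v" "Z' = tcod A B v"
    by auto
  show "ass T X' Y' Z' \<cdot>\<^bsub>T\<^esub> (p \<boxtimes>\<^bsub>T\<^esub> q \<boxtimes>\<^bsub>T\<^esub> r) = ((p \<boxtimes>\<^bsub>T\<^esub> q) \<boxtimes>\<^bsub>T\<^esub> r) \<cdot>\<^bsub>T\<^esub> ass T X Y Z"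
    using p X r by (simp, intro clI trel.intros; simp)
qed (auto simp: tensor_cat_cl tensor_cat_cl_ends tensor_cat_Comp tensor_cat_TensM cl_assoc cl_tens_comp)

subsection \<open>The functor eta\<close>

text \<open>Runs opposite to \<open>collapse\<close> below. There composites of classes are gathered
  into one class, to be matched with a relation; here the class of a compound expression is broken
  up, as induction over expressions requires.\<close>

lemma cl_expand:
  "twf A B (t \<bullet> u) \<Longrightarrow> cl (t \<bullet> u) = cl t \<cdot>\<^bsub>T\<^esub> cl u"
  "is_word A B X \<Longrightarrow> twf A B t \<Longrightarrow> cl (TLeft X t) = Id T X \<boxtimes>\<^bsub>T\<^esub> cl t"
  "is_word A B X \<Longrightarrow> twf A B t \<Longrightarrow> cl (TRight t X) = cl t \<boxtimes>\<^bsub>T\<^esub> Id T X"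
  "cl (TId X) = Id T X" "cl (TAss X Y Z) = ass T X Y Z" "cl (TR X) = runit T X" "cl (TL X) = lunit T X"
  "cl (TS X Y) = symm T X Y"
  by (simp_all add: tensor_cat_Comp tensor_cat_TensM_Id tensor_cat_cl)

lemma cl_inverses:
  "is_word A B X \<Longrightarrow> is_word A B Y \<Longrightarrow> is_word A B Z \<Longrightarrow> cl (TAss' X Y Z) = inv_arr T (ass T X Y Z)"
  "is_word A B X \<Longrightarrow> cl (TR' X) = inv_arr T (runit T X)"
  "is_word A B X \<Longrightarrow> cl (TL' X) = inv_arr T (lunit T X)"
proof -
  have *: "inv_arr T (cl t) = cl u"
    if "twf A B t" "twf A B u" "tdom A B t = tcod A B u" "tcod A B t = tdom A B u"
      "cl (u \<bullet> t) = cl (TId (tdom A B t))" "cl (t \<bullet> u) = cl (TId (tcod A B t))" for t u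
    using that by (intro T.inv_arr_eqI)
      (simp add: inverse_arrs_def in_Hom_iff tensor_cat_cl_ends tensor_cat_cl tensor_cat_Comp)
  show "is_word A B X \<Longrightarrow> is_word A B Y \<Longrightarrow> is_word A B Z \<Longrightarrow> cl (TAss' X Y Z) = inv_arr T (ass T X Y Z)"
    using *[of "TAss X Y Z" "TAss' X Y Z"] by (simp add: clI trel.intros tensor_cat_cl)
  show "is_word A B X \<Longrightarrow> cl (TR' X) = inv_arr T (runit T X)"
    using *[of "TR X" "TR' X"] by (simp add: clI trel.intros tensor_cat_cl)
  show "is_word A B X \<Longrightarrow> cl (TL' X) = inv_arr T (lunit T X)"
    using *[of "TL X" "TL' X"] by (simp add: clI trel.intros tensor_cat_cl)
qed

lemma tensor_cat_interchange:
  assumes "is_word A B X" "is_word A B Y" "is_word A B Z" "is_word A B W"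
  shows "interchange T X Y Z W = cl (texch X Y Z W)"
  using assms by (simp add: interchange_def texch_def Let_def cl_expand cl_inverses tensor_cat_cl(3))

lemmas collapse = tensor_cat_cl tensor_cat_cl_ends tensor_cat_Comp

text \<open>The laws of this functor are imposed literally by the relations (ii).\<close>

lemma sym_mon_functor_eta_at:
  assumes "a \<in> Obj A"
  shows "sym_mon_functor B T (eta_at A B a)"
proof -
  let ?t = "\<lambda>(b, b'). cl (TDelta a b b')"
  show ?thesis
    unfolding eta_at_def
  proof (rule sym_mon_functorI)
    note [simp] = collapse assms
    fix f g assume "f \<in> Arr B" "g \<in> Arr B"
    then show "cl (TGenR a (f \<boxtimes>\<^bsub>B\<^esub> g)) \<cdot>\<^bsub>T\<^esub> ?t (Dom B f, Dom B g) =
        ?t (Cod B f, Cod B g) \<cdot>\<^bsub>T\<^esub> (cl (TGenR a f) \<boxtimes>\<^bsub>T\<^esub> cl (TGenR a g))"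
      by (simp add: tensor_cat_TensM, intro clI trel.intros; simp)
  next
    note [simp] = collapse assms tensor_cat_TensM_Id
    fix b b' b'' assume "b \<in> Obj B" "b' \<in> Obj B" "b'' \<in> Obj B"
    then show "cl (TGenR a (ass B b b' b'')) \<cdot>\<^bsub>T\<^esub> ?t (b, b' \<otimes>\<^bsub>B\<^esub> b'') \<cdot>\<^bsub>T\<^esub>
        (Id T (WGen a b) \<boxtimes>\<^bsub>T\<^esub> ?t (b', b'')) =
      ?t (b \<otimes>\<^bsub>B\<^esub> b', b'') \<cdot>\<^bsub>T\<^esub>
        (?t (b, b') \<boxtimes>\<^bsub>T\<^esub> Id T (WGen a b'')) \<cdot>\<^bsub>T\<^esub> ass T (WGen a b) (WGen a b') (WGen a b'')"
      by (simp, intro clI trel.intros; simp)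
  next
    note [simp] = collapse assms tensor_cat_TensM_Id
    fix b assume "b \<in> Obj B"
    then show "cl (TGenR a (runit B b)) \<cdot>\<^bsub>T\<^esub> ?t (b, Unit B) \<cdot>\<^bsub>T\<^esub> (Id T (WGen a b) \<boxtimes>\<^bsub>T\<^esub> cl (TBeta a)) = runit T (WGen a b)"
      "cl (TGenR a (lunit B b)) \<cdot>\<^bsub>T\<^esub> ?t (Unit B, b) \<cdot>\<^bsub>T\<^esub> (cl (TBeta a) \<boxtimes>\<^bsub>T\<^esub> Id T (WGen a b)) = lunit T (WGen a b)"
      by (simp, intro clI trel.intros; simp)+
  next
    fix b b' assume "b \<in> Obj B" "b' \<in> Obj B"
    then show "cl (TGenR a (symm B b b')) \<cdot>\<^bsub>T\<^esub> ?t (b, b') =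
       ?t (b', b) \<cdot>\<^bsub>T\<^esub> symm T (WGen a b) (WGen a b')"
      using assms by (simp add: collapse, intro clI trel.intros; simp)
  next
    fix b assume "b \<in> Obj B"
    then show "cl (TGenR a (Id B b)) = Id T (WGen a b)"
      using assms by (simp add: collapse, intro clI trel.intros; simp)
  next
    fix f g assume "f \<in> Arr B" "g \<in> Arr B" "Dom B g = Cod B f"
    then show "cl (TGenR a (g \<cdot>\<^bsub>B\<^esub> f)) = cl (TGenR a g) \<cdot>\<^bsub>T\<^esub> cl (TGenR a f)"
      using assms by (simp add: collapse, intro clI trel.intros; simp)
  qed (auto simp: A.sym_mon_cat_axioms B.sym_mon_cat_axioms T.sym_mon_cat_axioms collapse assms)
qed

lemma eta_at_simps [simp]:
  "b \<in> Obj B \<Longrightarrow> fobj (eta_at A B a) b = WGen a b"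
  "g \<in> Arr B \<Longrightarrow> farr (eta_at A B a) g = cl (TGenR a g)"
  "funit (eta_at A B a) = cl (TBeta a)"
  "b \<in> Obj B \<Longrightarrow> b' \<in> Obj B \<Longrightarrow> ftens (eta_at A B a) (b, b') = cl (TDelta a b b')"
  by (auto simp: eta_at_def)

lemma eta_simps [simp]:
  "a \<in> Obj A \<Longrightarrow> fobj (eta A B) a = eta_at A B a"
  "f \<in> Arr A \<Longrightarrow> ndom (farr (eta A B) f) = eta_at A B (Dom A f)"
  "f \<in> Arr A \<Longrightarrow> ncod (farr (eta A B) f) = eta_at A B (Cod A f)"
  "f \<in> Arr A \<Longrightarrow> b \<in> Obj B \<Longrightarrow> ncomp (farr (eta A B) f) b = cl (TGenL f b)"
  "ndom (funit (eta A B)) = hom_unit B T" "ncod (funit (eta A B)) = eta_at A B (Unit A)"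
  "b \<in> Obj B \<Longrightarrow> ncomp (funit (eta A B)) b = cl (TAlpha b)"
  "a \<in> Obj A \<Longrightarrow> a' \<in> Obj A \<Longrightarrow> ndom (ftens (eta A B) (a, a')) = hom_tens B T (eta_at A B a) (eta_at A B a')"
  "a \<in> Obj A \<Longrightarrow> a' \<in> Obj A \<Longrightarrow> ncod (ftens (eta A B) (a, a')) = eta_at A B (a \<otimes>\<^bsub>A\<^esub> a')"
  "a \<in> Obj A \<Longrightarrow> a' \<in> Obj A \<Longrightarrow> b \<in> Obj B \<Longrightarrow> ncomp (ftens (eta A B) (a, a')) b = cl (TGamma a a' b)"
  by (auto simp: eta_def)

lemma mnt_eta_arr:
  assumes "f \<in> Arr A"
  shows "mon_nat_trans B T (farr (eta A B) f)"
proof -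
  have "mon_nat_trans B T \<lparr> ndom = eta_at A B (Dom A f), ncod = eta_at A B (Cod A f),
        ncomp = (\<lambda>b\<in>Obj B. cl (TGenL f b)) \<rparr>"
  proof (rule mon_nat_transI)
    fix g assume "g \<in> Arr B"
    then show "farr (eta_at A B (Cod A f)) g \<cdot>\<^bsub>T\<^esub> cl (TGenL f (Dom B g)) = cl (TGenL f (Cod B g)) \<cdot>\<^bsub>T\<^esub> farr (eta_at A B (Dom A f)) g"
      using assms by (simp add: collapse, intro clI[symmetric] trel.intros; simp)
  next
    show "cl (TGenL f (Unit B)) \<cdot>\<^bsub>T\<^esub> funit (eta_at A B (Dom A f)) = funit (eta_at A B (Cod A f))"
      using assms by (simp add: collapse, intro clI trel.intros; simp)
  next
    fix b b' assume "b \<in> Obj B" "b' \<in> Obj B"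
    then show "cl (TGenL f (b \<otimes>\<^bsub>B\<^esub> b')) \<cdot>\<^bsub>T\<^esub> ftens (eta_at A B (Dom A f)) (b, b') =
       ftens (eta_at A B (Cod A f)) (b, b') \<cdot>\<^bsub>T\<^esub> (cl (TGenL f b) \<boxtimes>\<^bsub>T\<^esub> cl (TGenL f b'))"
      using assms by (simp add: collapse tensor_cat_TensM, intro clI trel.intros; simp)
  qed (use assms in \<open>auto simp: collapse intro!: sym_mon_functor_eta_at\<close>)
  then show ?thesis using assms by (simp add: eta_def)
qed

lemma mnt_eta_unit: "mon_nat_trans B T (funit (eta A B))"
proof -
  have "mon_nat_trans B T \<lparr> ndom = hom_unit B T, ncod = eta_at A B (Unit A),
        ncomp = (\<lambda>b\<in>Obj B. cl (TAlpha b)) \<rparr>"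
  proof (rule mon_nat_transI)
    fix g assume g: "g \<in> Arr B"
    then have "cl (TGenR (Unit A) g) \<cdot>\<^bsub>T\<^esub> cl (TAlpha (Dom B g)) = cl (TAlpha (Cod B g))"
      by (simp add: collapse, intro clI trel.intros; simp)
    then show "farr (eta_at A B (Unit A)) g \<cdot>\<^bsub>T\<^esub> cl (TAlpha (Dom B g)) = cl (TAlpha (Cod B g)) \<cdot>\<^bsub>T\<^esub> farr (hom_unit B T) g"
      using g by (simp add: tensor_cat_cl_ends tensor_cat_cl(2))
  next
    have "cl (TAlpha (Unit B)) = cl (TBeta (Unit A))"
      by (intro clI[symmetric] trel.intros; simp)
    then show "cl (TAlpha (Unit B)) \<cdot>\<^bsub>T\<^esub> funit (hom_unit B T) = funit (eta_at A B (Unit A))"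
      by (simp add: tensor_cat_cl_ends tensor_cat_cl(2))
  next
    fix b b' assume "b \<in> Obj B" "b' \<in> Obj B"
    then show "cl (TAlpha (b \<otimes>\<^bsub>B\<^esub> b')) \<cdot>\<^bsub>T\<^esub> ftens (hom_unit B T) (b, b') =
       ftens (eta_at A B (Unit A)) (b, b') \<cdot>\<^bsub>T\<^esub> (cl (TAlpha b) \<boxtimes>\<^bsub>T\<^esub> cl (TAlpha b'))"
      by (simp add: collapse tensor_cat_TensM, intro clI trel.intros; simp)
  qed (auto simp: collapse intro!: sym_mon_functor_eta_at sym_mon_functor_hom_unit B.sym_mon_cat_axioms T.sym_mon_cat_axioms)
  then show ?thesis by (simp add: eta_def)
qed

lemma mnt_eta_tens:
  assumes "a \<in> Obj A" "a' \<in> Obj A"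
  shows "mon_nat_trans B T (ftens (eta A B) (a, a'))"
proof -
  have "mon_nat_trans B T \<lparr> ndom = hom_tens B T (eta_at A B a) (eta_at A B a'), ncod = eta_at A B (a \<otimes>\<^bsub>A\<^esub> a'),
        ncomp = (\<lambda>b\<in>Obj B. cl (TGamma a a' b)) \<rparr>"
  proof (rule mon_nat_transI)
    fix g assume "g \<in> Arr B"
    then show "farr (eta_at A B (a \<otimes>\<^bsub>A\<^esub> a')) g \<cdot>\<^bsub>T\<^esub> cl (TGamma a a' (Dom B g)) = cl (TGamma a a' (Cod B g)) \<cdot>\<^bsub>T\<^esub> farr (hom_tens B T (eta_at A B a) (eta_at A B a')) g"
      using assms by (simp add: collapse tensor_cat_TensM, intro clI trel.intros; simp)
  next
    have "cl (TGamma a a' (Unit B)) \<cdot>\<^bsub>T\<^esub> (cl (TBeta a) \<boxtimes>\<^bsub>T\<^esub> cl (TBeta a')) = cl (TBeta (a \<otimes>\<^bsub>A\<^esub> a')) \<cdot>\<^bsub>T\<^esub> lunit T (Unit T)"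
      using assms by (simp add: collapse tensor_cat_TensM, intro clI[symmetric] trel.intros; simp)
    then show "cl (TGamma a a' (Unit B)) \<cdot>\<^bsub>T\<^esub> funit (hom_tens B T (eta_at A B a) (eta_at A B a')) = funit (eta_at A B (a \<otimes>\<^bsub>A\<^esub> a'))"
      using assms T.ext2[of "cl (TGamma a a' (Unit B))" "cl (TBeta a) \<boxtimes>\<^bsub>T\<^esub> cl (TBeta a')"]
      by (simp add: tensor_cat_cl_ends tensor_cat_cl(1,2,3))
  next
    fix b b' assume b: "b \<in> Obj B" "b' \<in> Obj B"
    let ?\<gamma> = "cl (TGamma a a' (b \<otimes>\<^bsub>B\<^esub> b'))" and ?\<delta> = "cl (TDelta a b b') \<boxtimes>\<^bsub>T\<^esub> cl (TDelta a' b b')"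
    let ?i = "interchange T (WGen a b) (WGen a' b) (WGen a b') (WGen a' b')"
    have "?\<gamma> \<cdot>\<^bsub>T\<^esub> ?\<delta> = cl (TDelta (a \<otimes>\<^bsub>A\<^esub> a') b b') \<cdot>\<^bsub>T\<^esub> (cl (TGamma a a' b) \<boxtimes>\<^bsub>T\<^esub> cl (TGamma a a' b')) \<cdot>\<^bsub>T\<^esub>
        interchange T (WGen a b) (WGen a b') (WGen a' b) (WGen a' b')"
      using assms b by (simp add: collapse tensor_cat_TensM tensor_cat_interchange, intro clI trel.intros; simp)
    \<comment> \<open>Relation (vi) has the interchange on the opposite side from the tensor law of
      a transformation out of \<open>hom_tens\<close>; precomposing with its inverse moves it
      across.\<close>
    then have "(?\<gamma> \<cdot>\<^bsub>T\<^esub> ?\<delta>) \<cdot>\<^bsub>T\<^esub> ?i = cl (TDelta (a \<otimes>\<^bsub>A\<^esub> a') b b') \<cdot>\<^bsub>T\<^esub> (cl (TGamma a a' b) \<boxtimes>\<^bsub>T\<^esub> cl (TGamma a a' b'))"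
      using assms b by (simp add: tensor_cat_cl_ends tensor_cat_cl(1,3) T.interchange_interchange del: T.Comp_assoc_simp)
        (simp add: tensor_cat_cl_ends tensor_cat_cl(1,3) T.interchange_interchange)
    then show "?\<gamma> \<cdot>\<^bsub>T\<^esub> ftens (hom_tens B T (eta_at A B a) (eta_at A B a')) (b, b') =
       ftens (eta_at A B (a \<otimes>\<^bsub>A\<^esub> a')) (b, b') \<cdot>\<^bsub>T\<^esub> (cl (TGamma a a' b) \<boxtimes>\<^bsub>T\<^esub> cl (TGamma a a' b'))"
      using assms b by (simp add: tensor_cat_cl_ends tensor_cat_cl(1,3))
  qed (use assms in \<open>auto simp: collapse intro!: sym_mon_functor_eta_at sym_mon_functor_hom_tens\<close>)
  then show ?thesis using assms by (simp add: eta_def)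
qed

text \<open>Componentwise the laws are the relations (iii). That values and structure arrows lie in
  [B,T] was the content of (ii), (iv), (v) and (vi).\<close>

lemma sym_mon_functor_eta: "sym_mon_functor A (hom_cat B T) (eta A B)"
proof -
  let ?H = "hom_cat B T" and ?\<eta> = "fobj (eta A B)"
  interpret H: sym_mon_cat ?H
    by (intro sym_mon_cat_hom_cat B.sym_mon_cat_axioms T.sym_mon_cat_axioms)
  note closed = mnt_Id mnt_Comp mnt_TensM mnt_ass mnt_runit mnt_lunit mnt_symm
    sym_mon_functor_hom_tens sym_mon_functor_hom_unit mon_nat_trans_functors
    A.sym_mon_cat_axioms H.sym_mon_cat_axioms B.sym_mon_cat_axioms T.sym_mon_cat_axioms
    sym_mon_functor_eta_at mnt_eta_arr mnt_eta_unit mnt_eta_tens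
  have "sym_mon_functor A (?H) \<lparr>fobj = (\<lambda>a\<in>Obj A. ?\<eta> a),
      farr = (\<lambda>f\<in>Arr A. farr (eta A B) f), funit = funit (eta A B),
      ftens = (\<lambda>p\<in>Obj A \<times> Obj A. ftens (eta A B) p)\<rparr>"
  proof (rule sym_mon_functorI)
    fix a assume "a \<in> Obj A"
    then show "farr (eta A B) (Id A a) = Id (?H) (?\<eta> a)"
      by (intro mnt_eqI[of B T]) (simp_all add: closed, (simp add: collapse, intro clI trel.intros; simp))
  next
    fix f g assume "f \<in> Arr A" "g \<in> Arr A" "Dom A g = Cod A f"
    then show "farr (eta A B) (g \<cdot>\<^bsub>A\<^esub> f) = farr (eta A B) g \<cdot>\<^bsub>?H\<^esub> farr (eta A B) f"
      by (intro mnt_eqI[of B T]) (simp_all add: closed, (simp add: collapse, intro clI trel.intros; simp))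
  next
    fix f g assume "f \<in> Arr A" "g \<in> Arr A"
    then show "farr (eta A B) (f \<boxtimes>\<^bsub>A\<^esub> g) \<cdot>\<^bsub>?H\<^esub> ftens (eta A B) (Dom A f, Dom A g) =
      ftens (eta A B) (Cod A f, Cod A g) \<cdot>\<^bsub>?H\<^esub> (farr (eta A B) f \<boxtimes>\<^bsub>?H\<^esub> farr (eta A B) g)"
      by (intro mnt_eqI[of B T]) (simp_all add: closed, (simp add: collapse tensor_cat_TensM, intro clI trel.intros; simp))
  next
    fix a b c assume "a \<in> Obj A" "b \<in> Obj A" "c \<in> Obj A"
    then show "farr (eta A B) (ass A a b c) \<cdot>\<^bsub>?H\<^esub> ftens (eta A B) (a, b \<otimes>\<^bsub>A\<^esub> c) \<cdot>\<^bsub>?H\<^esub>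
        (Id (?H) (?\<eta> a) \<boxtimes>\<^bsub>?H\<^esub> ftens (eta A B) (b, c)) =
      ftens (eta A B) (a \<otimes>\<^bsub>A\<^esub> b, c) \<cdot>\<^bsub>?H\<^esub> (ftens (eta A B) (a, b) \<boxtimes>\<^bsub>?H\<^esub> Id (?H) (?\<eta> c)) \<cdot>\<^bsub>?H\<^esub>
        ass (?H) (?\<eta> a) (?\<eta> b) (?\<eta> c)"
      by (intro mnt_eqI[of B T]) (simp_all add: closed, (simp add: collapse tensor_cat_TensM_Id, intro clI trel.intros; simp))
  next
    fix a assume a: "a \<in> Obj A"
    then show "farr (eta A B) (runit A a) \<cdot>\<^bsub>?H\<^esub> ftens (eta A B) (a, Unit A) \<cdot>\<^bsub>?H\<^esub>
        (Id (?H) (?\<eta> a) \<boxtimes>\<^bsub>?H\<^esub> funit (eta A B)) = runit (?H) (?\<eta> a)"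
      by (intro mnt_eqI[of B T]) (simp_all add: closed, (simp add: collapse tensor_cat_TensM_Id, intro clI trel.intros; simp))
    show "farr (eta A B) (lunit A a) \<cdot>\<^bsub>?H\<^esub> ftens (eta A B) (Unit A, a) \<cdot>\<^bsub>?H\<^esub>
        (funit (eta A B) \<boxtimes>\<^bsub>?H\<^esub> Id (?H) (?\<eta> a)) = lunit (?H) (?\<eta> a)"
      using a by (intro mnt_eqI[of B T]) (simp_all add: closed, (simp add: collapse tensor_cat_TensM_Id, intro clI trel.intros; simp))
  next
    fix a b assume "a \<in> Obj A" "b \<in> Obj A"
    then show "farr (eta A B) (symm A a b) \<cdot>\<^bsub>?H\<^esub> ftens (eta A B) (a, b) =
      ftens (eta A B) (b, a) \<cdot>\<^bsub>?H\<^esub> symm (?H) (?\<eta> a) (?\<eta> b)"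
      by (intro mnt_eqI[of B T]) (simp_all add: closed, (simp add: collapse, intro clI trel.intros; simp))
  qed (auto simp: closed)
  then show ?thesis
    by (simp add: eta_def cong: restrict_cong)
qed

end

section \<open>Functors out of the tensor product\<close>

text \<open>The input of En. The simp rules below describe F by two-variable data such as
  \<open>fobj (fobj F a) b\<close>, the form in which generators of \<open>A \<otimes> B\<close> are
  interpreted.\<close>

locale curried_functor = smc_pair A B + C: sym_mon_cat C + F: sym_mon_functor A "hom_cat B C" F
  for A :: "('oa, 'ma) smcat" and B :: "('ob, 'mb) smcat" and C :: "('oc, 'mc) smcat" (structure)
    and F :: "('oa, 'ma, ('ob, 'mb, 'oc, 'mc) smfun, ('ob, 'mb, 'oc, 'mc) mnt) smfun"
begin

lemma F_at: "a \<in> Obj A \<Longrightarrow> sym_mon_functor B C (fobj F a)"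
  using F.fobj_simp by (simp del: F.fobj_simp)

lemma F_nt:
  "f \<in> Arr A \<Longrightarrow> mon_nat_trans B C (farr F f)"
  "mon_nat_trans B C (funit F)"
  "a \<in> Obj A \<Longrightarrow> a' \<in> Obj A \<Longrightarrow> mon_nat_trans B C (ftens F (a, a'))"
  using F.farr_simps(1) F.funit_simps(1) F.ftens_simps(1) by auto

lemma F_ends [simp]:
  "f \<in> Arr A \<Longrightarrow> ndom (farr F f) = fobj F (Dom A f)" "f \<in> Arr A \<Longrightarrow> ncod (farr F f) = fobj F (Cod A f)"
  "ndom (funit F) = hom_unit B C" "ncod (funit F) = fobj F (Unit A)"
  "a \<in> Obj A \<Longrightarrow> a' \<in> Obj A \<Longrightarrow> ndom (ftens F (a, a')) = hom_tens B C (fobj F a) (fobj F a')"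
  "a \<in> Obj A \<Longrightarrow> a' \<in> Obj A \<Longrightarrow> ncod (ftens F (a, a')) = fobj F (a \<otimes>\<^bsub>A\<^esub> a')"
  using F.farr_simps(2,3) F.funit_simps(2,3) F.ftens_simps(2,3) by simp_all

lemmas F_at_simps [simp] = sym_mon_functor.fobj_simp[OF F_at] sym_mon_functor.farr_simps[OF F_at]
  sym_mon_functor.farr_Id[OF F_at]
  sym_mon_functor.farr_Comp_simp[OF F_at]
  sym_mon_functor.funit_simps[OF F_at] sym_mon_functor.ftens_simps[OF F_at]

lemma F_nt_simps [simp]:
  assumes "b \<in> Obj B"
  shows "f \<in> Arr A \<Longrightarrow> ncomp (farr F f) b \<in> Arr C"
    "f \<in> Arr A \<Longrightarrow> Dom C (ncomp (farr F f) b) = fobj (fobj F (Dom A f)) b"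
    "f \<in> Arr A \<Longrightarrow> Cod C (ncomp (farr F f) b) = fobj (fobj F (Cod A f)) b"
    "ncomp (funit F) b \<in> Arr C" "Dom C (ncomp (funit F) b) = Unit C"
    "Cod C (ncomp (funit F) b) = fobj (fobj F (Unit A)) b"
    "a \<in> Obj A \<Longrightarrow> a' \<in> Obj A \<Longrightarrow> ncomp (ftens F (a, a')) b \<in> Arr C"
    "a \<in> Obj A \<Longrightarrow> a' \<in> Obj A \<Longrightarrow> Dom C (ncomp (ftens F (a, a')) b) = fobj (fobj F a) b \<otimes> fobj (fobj F a') b"
    "a \<in> Obj A \<Longrightarrow> a' \<in> Obj A \<Longrightarrow> Cod C (ncomp (ftens F (a, a')) b) = fobj (fobj F (a \<otimes>\<^bsub>A\<^esub> a')) b"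
  using mon_nat_trans.ncomp_simps[OF F_nt(1) assms] mon_nat_trans.ncomp_simps[OF F_nt(2) assms]
    mon_nat_trans.ncomp_simps[OF F_nt(3) assms] assms by simp_all

lemma en_obj_closed [simp]: "is_word A B X \<Longrightarrow> en_obj C F X \<in> Obj C"
  by (induction X) auto

lemma en_exp_simps [simp]:
  assumes "twf A B t"
  shows "en_exp C F t \<in> Arr C" "Dom C (en_exp C F t) = en_obj C F (tdom A B t)"
    "Cod C (en_exp C F t) = en_obj C F (tcod A B t)"
  using assms by (induction t) (auto simp: C.iso_simps)

lemma en_exp_ttens [simp]:
  "twf A B t \<Longrightarrow> twf A B u \<Longrightarrow> en_exp C F (ttens A B t u) = en_exp C F t \<boxtimes> en_exp C F u"
  by (simp add: ttens_def C.TensM_Comp_simp)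

lemma en_exp_texch [simp]:
  "en_exp C F (texch X Y Z W) = interchange C (en_obj C F X) (en_obj C F Y) (en_obj C F Z) (en_obj C F W)"
  by (simp add: texch_def interchange_def Let_def)

text \<open>The laws of F evaluated at \<open>b\<close>; these are the equations demanded by the
  relations (iii).\<close>

lemma F_pointwise:
  assumes b: "b \<in> Obj B"
  shows "a \<in> Obj A \<Longrightarrow> ncomp (farr F (Id A a)) b = Id C (fobj (fobj F a) b)"
    and "f \<in> Arr A \<Longrightarrow> g \<in> Arr A \<Longrightarrow> Dom A g = Cod A f \<Longrightarrow>
      ncomp (farr F (g \<cdot>\<^bsub>A\<^esub> f)) b = ncomp (farr F g) b \<cdot> ncomp (farr F f) b"
    and "f \<in> Arr A \<Longrightarrow> g \<in> Arr A \<Longrightarrow>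
      ncomp (farr F (f \<boxtimes>\<^bsub>A\<^esub> g)) b \<cdot> ncomp (ftens F (Dom A f, Dom A g)) b =
      ncomp (ftens F (Cod A f, Cod A g)) b \<cdot> (ncomp (farr F f) b \<boxtimes> ncomp (farr F g) b)"
    and "a \<in> Obj A \<Longrightarrow> a' \<in> Obj A \<Longrightarrow> a'' \<in> Obj A \<Longrightarrow>
      ncomp (farr F (ass A a a' a'')) b \<cdot> ncomp (ftens F (a, a' \<otimes>\<^bsub>A\<^esub> a'')) b \<cdot>
        (Id C (fobj (fobj F a) b) \<boxtimes> ncomp (ftens F (a', a'')) b) =
      ncomp (ftens F (a \<otimes>\<^bsub>A\<^esub> a', a'')) b \<cdot> (ncomp (ftens F (a, a')) b \<boxtimes> Id C (fobj (fobj F a'') b)) \<cdot>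
        ass C (fobj (fobj F a) b) (fobj (fobj F a') b) (fobj (fobj F a'') b)"
    and "a \<in> Obj A \<Longrightarrow> ncomp (farr F (runit A a)) b \<cdot> ncomp (ftens F (a, Unit A)) b \<cdot>
        (Id C (fobj (fobj F a) b) \<boxtimes> ncomp (funit F) b) = runit C (fobj (fobj F a) b)"
    and "a \<in> Obj A \<Longrightarrow> ncomp (farr F (lunit A a)) b \<cdot> ncomp (ftens F (Unit A, a)) b \<cdot>
        (ncomp (funit F) b \<boxtimes> Id C (fobj (fobj F a) b)) = lunit C (fobj (fobj F a) b)"
    and "a \<in> Obj A \<Longrightarrow> a' \<in> Obj A \<Longrightarrow> ncomp (farr F (symm A a a')) b \<cdot> ncomp (ftens F (a, a')) b =
      ncomp (ftens F (a', a)) b \<cdot> symm C (fobj (fobj F a) b) (fobj (fobj F a') b)"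
  using arg_cong[OF F.farr_Id, of a "\<lambda>\<sigma>. ncomp \<sigma> b"] arg_cong[OF F.farr_Comp_simp, of f g "\<lambda>\<sigma>. ncomp \<sigma> b"]
    arg_cong[OF F.ftens_nat, of f g "Dom A f" "Dom A g" "\<lambda>\<sigma>. ncomp \<sigma> b"]
    arg_cong[OF F.ftens_ass, of a a' a'' "\<lambda>\<sigma>. ncomp \<sigma> b"]
    arg_cong[OF F.ftens_runit, of a "\<lambda>\<sigma>. ncomp \<sigma> b"] arg_cong[OF F.ftens_lunit, of a "\<lambda>\<sigma>. ncomp \<sigma> b"]
    arg_cong[OF F.ftens_symm, of a a' "\<lambda>\<sigma>. ncomp \<sigma> b"] b
  by simp_all

lemma F_gamma_beta:
  assumes "a \<in> Obj A" "a' \<in> Obj A"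
  shows "ncomp (ftens F (a, a')) (Unit B) \<cdot> (funit (fobj F a) \<boxtimes> funit (fobj F a')) =
    funit (fobj F (a \<otimes>\<^bsub>A\<^esub> a')) \<cdot> lunit C (Unit C)"
proof -
  have "funit (fobj F (a \<otimes>\<^bsub>A\<^esub> a')) = ncomp (ftens F (a, a')) (Unit B) \<cdot> (funit (fobj F a) \<boxtimes> funit (fobj F a')) \<cdot> inv_arr C (lunit C (Unit C))"
    using mon_nat_trans.ncomp_unit[OF F_nt(3)[OF assms]] assms by simp
  then show ?thesis
    using assms by simp
qed

text \<open>Monoidality of the transformation F^2, with the interchange moved to the other side to
  match relation (vi).\<close>

lemma F_gamma_delta:
  assumes "a \<in> Obj A" "a' \<in> Obj A" "b \<in> Obj B" "b' \<in> Obj B"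
  shows "ncomp (ftens F (a, a')) (b \<otimes>\<^bsub>B\<^esub> b') \<cdot> (ftens (fobj F a) (b, b') \<boxtimes> ftens (fobj F a') (b, b')) =
    ftens (fobj F (a \<otimes>\<^bsub>A\<^esub> a')) (b, b') \<cdot> (ncomp (ftens F (a, a')) b \<boxtimes> ncomp (ftens F (a, a')) b') \<cdot>
     interchange C (fobj (fobj F a) b) (fobj (fobj F a) b') (fobj (fobj F a') b) (fobj (fobj F a') b')"
proof -
  have "(ftens (fobj F (a \<otimes>\<^bsub>A\<^esub> a')) (b, b') \<cdot> (ncomp (ftens F (a, a')) b \<boxtimes> ncomp (ftens F (a, a')) b')) \<cdot>
     interchange C (fobj (fobj F a) b) (fobj (fobj F a) b') (fobj (fobj F a') b) (fobj (fobj F a') b') =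
    (ncomp (ftens F (a, a')) (b \<otimes>\<^bsub>B\<^esub> b') \<cdot> (ftens (fobj F a) (b, b') \<boxtimes> ftens (fobj F a') (b, b')) \<cdot>
     interchange C (fobj (fobj F a) b) (fobj (fobj F a') b) (fobj (fobj F a) b') (fobj (fobj F a') b')) \<cdot>
     interchange C (fobj (fobj F a) b) (fobj (fobj F a) b') (fobj (fobj F a') b) (fobj (fobj F a') b')"
    using mon_nat_trans.ncomp_tens[OF F_nt(3), of a a' b b'] assms by simp
  also have "\<dots> = ncomp (ftens F (a, a')) (b \<otimes>\<^bsub>B\<^esub> b') \<cdot> (ftens (fobj F a) (b, b') \<boxtimes> ftens (fobj F a') (b, b'))"
    using assms by (simp add: C.interchange_interchange)
  finally show ?thesis
    using assms by simp
qed

text \<open>Makes En(F) well defined on arrows: each relation turns into an axiom of C, or a law of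
  F, of a functor F(a), or of a transformation among the data of F. Besides the exchange relation 8,
  the numbered cases belong to group (ii) (26 to 30), group (iv) (38 to 42) and group (v) (43 and
  45).\<close>

lemma en_exp_trel:
  "trel A B t u \<Longrightarrow> twf A B t \<Longrightarrow> twf A B u \<Longrightarrow> en_exp C F t = en_exp C F u"
proof (induction rule: trel.induct)
  case (8 t u)
  then show ?case by (simp add: C.TensM_Comp_simp)
next
  case (26 a g g')
  then show ?case using sym_mon_functor.ftens_nat[OF F_at, of a g g'] by simp
next
  case (27 a b b' b'')
  then show ?case using sym_mon_functor.ftens_ass[OF F_at, of a b b' b''] by simp
next
  case (28 a b)
  then show ?case using sym_mon_functor.ftens_runit[OF F_at, of a b] by simp
next
  case (29 a b)
  then show ?case using sym_mon_functor.ftens_lunit[OF F_at, of a b] by simp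
next
  case (30 a b b')
  then show ?case using sym_mon_functor.ftens_symm[OF F_at, of a b b'] by simp
next
  case (38 f g)
  then show ?case using mon_nat_trans.ncomp_nat[OF F_nt(1), of f g] by simp
next
  case (39 f)
  then show ?case using mon_nat_trans.ncomp_unit[OF F_nt(1), of f] by simp
next
  case (40 f b b')
  then show ?case using mon_nat_trans.ncomp_tens[OF F_nt(1), of f b b'] by simp
next
  case (41 g)
  then show ?case using mon_nat_trans.ncomp_nat[OF F_nt(2), of g] by simp
next
  case (42 a a' g)
  then show ?case using mon_nat_trans.ncomp_nat[OF F_nt(3), of a a' g] by simp
next
  case (43 b b')
  then show ?case using mon_nat_trans.ncomp_tens[OF F_nt(2), of b b'] by simp
next
  case 45
  then show ?case using mon_nat_trans.ncomp_unit[OF F_nt(2)] by simp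
qed (auto simp: C.symm_symm C.ass_nat C.runit_nat C.lunit_nat C.symm_nat
    C.pentagon C.triangle C.hexagon C.symm_unit F_pointwise F_gamma_beta F_gamma_delta)

lemma en_exp_tcong: "tcong A B t u \<Longrightarrow> en_exp C F t = en_exp C F u"
proof (induction rule: tcong.induct)
  case (base t u)
  then show ?case by (rule en_exp_trel)
next
  case (trans t u v)
  then show ?case by (simp only:)
qed (simp_all only: en_exp.simps)

lemma en_exp_trep [simp]: "twf A B t \<Longrightarrow> en_exp C F (trep (cl t)) = en_exp C F t"
  by (rule en_exp_tcong[OF trep_cong, symmetric])

section \<open>The strict functor En(F) and transformations out of it\<close>

lemma En_obj_simps [simp]:
  "is_word A B X \<Longrightarrow> fobj (En_obj A B C F) X = en_obj C F X"
  "twf A B t \<Longrightarrow> farr (En_obj A B C F) (cl t) = en_exp C F t"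
  "funit (En_obj A B C F) = Id C (Unit C)"
  "is_word A B X \<Longrightarrow> is_word A B Y \<Longrightarrow> ftens (En_obj A B C F) (X, Y) = Id C (en_obj C F X \<otimes> en_obj C F Y)"
  by (simp_all add: En_obj_def collapse)

lemma sym_mon_functor_En_obj: "sym_mon_functor T C (En_obj A B C F)"
  unfolding En_obj_def
proof (rule sym_mon_functorI)
qed (auto simp: T.sym_mon_cat_axioms C.sym_mon_cat_axioms collapse tensor_cat_TensM)

text \<open>The universal property of the presentation at the level of 2-cells: a family at the
  generators, natural for the six kinds of generating arrows, extends along \<open>unit\<close> and
  \<open>tens\<close> to a transformation into a functor G that may be lax. Both En on 2-cells and
  \<epsilon> are instances.\<close>

lemma mnt_En:
  assumes G: "sym_mon_functor T C G"
    and unit: "c WUnit = funit G"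
    and tens: "\<And>X Y. is_word A B X \<Longrightarrow> is_word A B Y \<Longrightarrow> c (X \<odot> Y) = ftens G (X, Y) \<cdot> (c X \<boxtimes> c Y)"
    and gen: "\<And>a b. a \<in> Obj A \<Longrightarrow> b \<in> Obj B \<Longrightarrow> c (WGen a b) \<in> Arr C"
      "\<And>a b. a \<in> Obj A \<Longrightarrow> b \<in> Obj B \<Longrightarrow> Dom C (c (WGen a b)) = fobj (fobj F a) b"
      "\<And>a b. a \<in> Obj A \<Longrightarrow> b \<in> Obj B \<Longrightarrow> Cod C (c (WGen a b)) = fobj G (WGen a b)"
    and alpha: "\<And>b. b \<in> Obj B \<Longrightarrow> farr G (cl (TAlpha b)) \<cdot> funit G = c (WGen (Unit A) b) \<cdot> ncomp (funit F) b"
    and beta: "\<And>a. a \<in> Obj A \<Longrightarrow> farr G (cl (TBeta a)) \<cdot> funit G = c (WGen a (Unit B)) \<cdot> funit (fobj F a)"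
    and gamma: "\<And>a a' b. a \<in> Obj A \<Longrightarrow> a' \<in> Obj A \<Longrightarrow> b \<in> Obj B \<Longrightarrow>
      farr G (cl (TGamma a a' b)) \<cdot> ftens G (WGen a b, WGen a' b) \<cdot> (c (WGen a b) \<boxtimes> c (WGen a' b)) =
      c (WGen (a \<otimes>\<^bsub>A\<^esub> a') b) \<cdot> ncomp (ftens F (a, a')) b"
    and delta: "\<And>a b b'. a \<in> Obj A \<Longrightarrow> b \<in> Obj B \<Longrightarrow> b' \<in> Obj B \<Longrightarrow>
      farr G (cl (TDelta a b b')) \<cdot> ftens G (WGen a b, WGen a b') \<cdot> (c (WGen a b) \<boxtimes> c (WGen a b')) =
      c (WGen a (b \<otimes>\<^bsub>B\<^esub> b')) \<cdot> ftens (fobj F a) (b, b')"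
    and genl: "\<And>f b. f \<in> Arr A \<Longrightarrow> b \<in> Obj B \<Longrightarrow>
      farr G (cl (TGenL f b)) \<cdot> c (WGen (Dom A f) b) = c (WGen (Cod A f) b) \<cdot> ncomp (farr F f) b"
    and genr: "\<And>a g. a \<in> Obj A \<Longrightarrow> g \<in> Arr B \<Longrightarrow>
      farr G (cl (TGenR a g)) \<cdot> c (WGen a (Dom B g)) = c (WGen a (Cod B g)) \<cdot> farr (fobj F a) g"
  shows "mon_nat_trans T C \<lparr>ndom = En_obj A B C F, ncod = G, ncomp = (\<lambda>X\<in>Obj T. c X)\<rparr>"
proof -
  interpret G: sym_mon_functor T C G by fact
  note [simp] = tensor_cat_cl(1,3) tensor_cat_cl_ends
  have U [simp]: "Unit T = WUnit" by (rule tensor_cat_cl)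
  have c [simp]: "c X \<in> Arr C" "Dom C (c X) = en_obj C F X" "Cod C (c X) = fobj G X" if "is_word A B X" for X
    using that G.funit_simps by (induction X) (auto simp: unit tens gen)
  have Gf [simp]: "fobj G X \<in> Obj C" if "is_word A B X" for X
    using that G.fobj_simp by simp
  have Gt [simp]: "ftens G (X, Y) \<in> Arr C" "Dom C (ftens G (X, Y)) = fobj G X \<otimes> fobj G Y"
    "Cod C (ftens G (X, Y)) = fobj G (X \<odot> Y)" if "is_word A B X" "is_word A B Y" for X Y
    using that G.ftens_simps by auto
  \<comment> \<open>Serves the formal inverses of \<open>ass\<close>, \<open>runit\<close> and
    \<open>lunit\<close>: naturality at an invertible arrow gives naturality at its inverse.\<close>
  have inv_nat: "farr G (inv_arr T p) \<cdot> y = x \<cdot> inv_arr C q"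
    if "farr G p \<cdot> x = y \<cdot> q" "is_iso T p" "is_iso C q" "x \<in> Arr C" "y \<in> Arr C"
      "Cod C x = fobj G (Dom T p)" "Cod C y = fobj G (Cod T p)" "Dom C x = Dom C q" "Dom C y = Cod C q" for p q x y
    using C.inv_swap[OF that(1)] that(2-) T.is_iso_Arr[OF that(2)] by (simp add: G.farr_inv)
  \<comment> \<open>With \<open>c\<close> expanded at the tensors, this is the associativity law of
    G^2 followed by naturality of \<open>ass\<close> in C; the two unit cases are alike.\<close>
  have ass_case: "farr G (ass T X Y Z) \<cdot> c (X \<odot> Y \<odot> Z) = c ((X \<odot> Y) \<odot> Z) \<cdot> ass C (en_obj C F X) (en_obj C F Y) (en_obj C F Z)"
    if w: "is_word A B X" "is_word A B Y" "is_word A B Z" for X Y Z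
  proof -
    have "farr G (ass T X Y Z) \<cdot> c (X \<odot> Y \<odot> Z) = (farr G (ass T X Y Z) \<cdot> ftens G (X, Y \<otimes>\<^bsub>T\<^esub> Z) \<cdot>
       (Id C (fobj G X) \<boxtimes> ftens G (Y, Z))) \<cdot> (c X \<boxtimes> c Y \<boxtimes> c Z)"
      using w by (simp add: tens C.TensM_Comp_simp)
    also have "\<dots> = ftens G (X \<odot> Y, Z) \<cdot> ((ftens G (X, Y) \<boxtimes> Id C (fobj G Z)) \<cdot> ((c X \<boxtimes> c Y) \<boxtimes> c Z)) \<cdot>
       ass C (en_obj C F X) (en_obj C F Y) (en_obj C F Z)"
      using w by (subst G.ftens_ass) (auto simp: C.ass_nat)
    also have "\<dots> = c ((X \<odot> Y) \<odot> Z) \<cdot> ass C (en_obj C F X) (en_obj C F Y) (en_obj C F Z)"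
      using w by (subst C.TensM_Comp_simp) (auto simp: tens)
    finally show ?thesis .
  qed
  have R_case: "farr G (runit T X) \<cdot> c (X \<odot> WUnit) = c X \<cdot> runit C (en_obj C F X)" if w: "is_word A B X" for X
  proof -
    have "farr G (runit T X) \<cdot> c (X \<odot> WUnit) = (farr G (runit T X) \<cdot> ftens G (X, Unit T) \<cdot>
       (Id C (fobj G X) \<boxtimes> funit G)) \<cdot> (c X \<boxtimes> Id C (Unit C))"
      using w by (simp add: tens unit C.TensM_Comp_simp)
    also have "\<dots> = c X \<cdot> runit C (en_obj C F X)"
      using w by (subst G.ftens_runit) (auto simp: C.runit_nat)
    finally show ?thesis .
  qed
  have L_case: "farr G (lunit T X) \<cdot> c (WUnit \<odot> X) = c X \<cdot> lunit C (en_obj C F X)" if w: "is_word A B X" for X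
  proof -
    have "farr G (lunit T X) \<cdot> c (WUnit \<odot> X) = (farr G (lunit T X) \<cdot> ftens G (Unit T, X) \<cdot>
       (funit G \<boxtimes> Id C (fobj G X))) \<cdot> (Id C (Unit C) \<boxtimes> c X)"
      using w by (simp add: tens unit C.TensM_Comp_simp)
    also have "\<dots> = c X \<cdot> lunit C (en_obj C F X)"
      using w by (subst G.ftens_lunit) (auto simp: C.lunit_nat)
    finally show ?thesis .
  qed
  \<comment> \<open>Every arrow is the class of an expression, so induction over expressions proves
    naturality. The generating arrows are the six hypotheses from \<open>alpha\<close> to
    \<open>genr\<close>.\<close>
  have nat: "farr G (cl t) \<cdot> c (tdom A B t) = c (tcod A B t) \<cdot> en_exp C F t" if "twf A B t" for t
    using that
  proof (induction t)
    case (TId X)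
    then show ?case by (simp add: cl_expand)
  next
    case (TComp t u)
    have "farr G (cl (t \<bullet> u)) \<cdot> c (tdom A B u) = (farr G (cl t) \<cdot> c (tdom A B t)) \<cdot> en_exp C F u"
      using TComp.IH(2) TComp.prems by (simp add: cl_expand)
    also have "farr G (cl t) \<cdot> c (tdom A B t) = c (tcod A B t) \<cdot> en_exp C F t"
      using TComp by simp
    finally show ?case using TComp by simp
  next
    case (TLeft X t)
    then show ?case
      by (simp add: cl_expand G.ftens_nat_ext tens C.TensM_Comp_simp)
  next
    case (TRight t X)
    then show ?case
      by (simp add: cl_expand G.ftens_nat_ext tens C.TensM_Comp_simp)
  next
    case (TAss X Y Z)
    then show ?case by (simp add: cl_expand ass_case)
  next
    case (TAss' X Y Z)
    then show ?case
      using inv_nat[OF ass_case, of X Y Z] by (simp add: cl_inverses)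
  next
    case (TR X)
    then show ?case by (simp add: cl_expand R_case)
  next
    case (TR' X)
    then show ?case using inv_nat[OF R_case, of X] by (simp add: cl_inverses)
  next
    case (TL X)
    then show ?case by (simp add: cl_expand L_case)
  next
    case (TL' X)
    then show ?case using inv_nat[OF L_case, of X] by (simp add: cl_inverses)
  next
    case (TS X Y)
    then show ?case
      by (simp add: cl_expand tens C.symm_nat C.ext2[OF G.ftens_symm])
  next
    case (TGamma a a' b)
    then show ?case using gamma[of a a' b] by (simp add: tens)
  next
    case (TDelta a b b')
    then show ?case using delta[of a b b'] by (simp add: tens)
  qed (use alpha beta genl genr in \<open>simp_all add: unit\<close>)
  show ?thesis
    by (rule mon_nat_transI) (use G in \<open>auto simp: nat unit tens sym_mon_functor_En_obj\<close>)
qed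

text \<open>This replaces all coherence computations in the proof that \<open>En\<close> is a symmetric monoidal functor.\<close>

lemma mnt_En_eqI:
  assumes \<sigma>: "mon_nat_trans T C \<sigma>" and \<tau>: "mon_nat_trans T C \<tau>"
    and d: "ndom \<sigma> = En_obj A B C F" "ndom \<tau> = En_obj A B C F" and c: "ncod \<sigma> = ncod \<tau>"
    and gen: "\<And>a b. a \<in> Obj A \<Longrightarrow> b \<in> Obj B \<Longrightarrow> ncomp \<sigma> (WGen a b) = ncomp \<tau> (WGen a b)"
  shows "\<sigma> = \<tau>"
proof -
  interpret s: mon_nat_trans T C \<sigma> by fact
  interpret t: mon_nat_trans T C \<tau> by fact
  note [simp] = tensor_cat_cl(1,3) d
  have U: "Unit T = WUnit" by (rule tensor_cat_cl)
  \<comment> \<open>En(F) is strict, so the unit and tensor laws of a transformation leave only the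
    generators free.\<close>
  have "ncomp \<sigma> X = ncomp \<tau> X" if "is_word A B X" for X
    using that
  proof (induction X)
    case WUnit
    show ?case
      using s.ncomp_unit t.ncomp_unit s.ncomp_simps[of WUnit] t.ncomp_simps[of WUnit] by (simp add: U c)
  next
    case (WTens X Y)
    then show ?case
      using s.ncomp_tens[of X Y] t.ncomp_tens[of X Y] s.ncomp_simps[of "X \<odot> Y"] t.ncomp_simps[of "X \<odot> Y"]
      by (simp add: c)
  qed (simp add: gen)
  then show ?thesis
    using \<sigma> \<tau> d c by (intro mnt_eqI[of T C]) simp_all
qed

end

section \<open>En on 2-cells\<close>

context smc_pair
begin

lemma curried_functorI: "sym_mon_cat C \<Longrightarrow> sym_mon_functor A (hom_cat B C) F \<Longrightarrow> curried_functor A B C F"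
  by (simp add: curried_functor_def smc_pair_axioms)

lemma mnt_En_arr:
  fixes C :: "('oc, 'mc) smcat" (structure)
  assumes C: "sym_mon_cat C" and \<sigma>: "mon_nat_trans A (hom_cat B C) \<sigma>"
  shows "mon_nat_trans T C (En_arr A B C \<sigma>)"
proof -
  interpret s: mon_nat_trans A "hom_cat B C" \<sigma> by fact
  interpret F: curried_functor A B C "ndom \<sigma>"
    by (intro curried_functorI C s.F.sym_mon_functor_axioms)
  interpret G: curried_functor A B C "ncod \<sigma>"
    by (intro curried_functorI C s.G.sym_mon_functor_axioms)
  have sa: "mon_nat_trans B C (ncomp \<sigma> a)" if "a \<in> Obj A" for a
    using s.ncomp_simps(1)[OF that] by simp
  have ends [simp]: "ndom (ncomp \<sigma> a) = fobj (ndom \<sigma>) a" "ncod (ncomp \<sigma> a) = fobj (ncod \<sigma>) a" if "a \<in> Obj A" for a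
    using s.ncomp_simps[OF that] by simp_all
  have sab [simp]: "ncomp (ncomp \<sigma> a) b \<in> Arr C" "Dom C (ncomp (ncomp \<sigma> a) b) = fobj (fobj (ndom \<sigma>) a) b"
    "Cod C (ncomp (ncomp \<sigma> a) b) = fobj (fobj (ncod \<sigma>) a) b" if "a \<in> Obj A" "b \<in> Obj B" for a b
    using mon_nat_trans.ncomp_simps[OF sa] that by simp_all
  have types [simp]: "en_nt C \<sigma> X \<in> Arr C" "Dom C (en_nt C \<sigma> X) = en_obj C (ndom \<sigma>) X"
    "Cod C (en_nt C \<sigma> X) = en_obj C (ncod \<sigma>) X" if "is_word A B X" for X
    using that by (induction X) auto
  show ?thesis
    unfolding En_arr_def
  proof (rule F.mnt_En)
    fix b assume b: "b \<in> Obj B"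
    show "farr (En_obj A B C (ncod \<sigma>)) (cl (TAlpha b)) \<cdot> funit (En_obj A B C (ncod \<sigma>)) =
      en_nt C \<sigma> (WGen (Unit A) b) \<cdot> ncomp (funit (ndom \<sigma>)) b"
      using b arg_cong[OF s.ncomp_unit, of "\<lambda>\<sigma>. ncomp \<sigma> b"] by simp
  next
    fix a assume "a \<in> Obj A"
    then show "farr (En_obj A B C (ncod \<sigma>)) (cl (TBeta a)) \<cdot> funit (En_obj A B C (ncod \<sigma>)) =
      en_nt C \<sigma> (WGen a (Unit B)) \<cdot> funit (fobj (ndom \<sigma>) a)"
      using mon_nat_trans.ncomp_unit[OF sa, of a] by simp
  next
    fix a a' b assume "a \<in> Obj A" "a' \<in> Obj A" "b \<in> Obj B"
    then show "farr (En_obj A B C (ncod \<sigma>)) (cl (TGamma a a' b)) \<cdot> ftens (En_obj A B C (ncod \<sigma>)) (WGen a b, WGen a' b) \<cdot>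
        (en_nt C \<sigma> (WGen a b) \<boxtimes> en_nt C \<sigma> (WGen a' b)) =
      en_nt C \<sigma> (WGen (a \<otimes>\<^bsub>A\<^esub> a') b) \<cdot> ncomp (ftens (ndom \<sigma>) (a, a')) b"
      using arg_cong[OF s.ncomp_tens, of a a' "\<lambda>\<sigma>. ncomp \<sigma> b"] by simp
  next
    fix a b b' assume "a \<in> Obj A" "b \<in> Obj B" "b' \<in> Obj B"
    then show "farr (En_obj A B C (ncod \<sigma>)) (cl (TDelta a b b')) \<cdot> ftens (En_obj A B C (ncod \<sigma>)) (WGen a b, WGen a b') \<cdot>
        (en_nt C \<sigma> (WGen a b) \<boxtimes> en_nt C \<sigma> (WGen a b')) =
      en_nt C \<sigma> (WGen a (b \<otimes>\<^bsub>B\<^esub> b')) \<cdot> ftens (fobj (ndom \<sigma>) a) (b, b')"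
      using mon_nat_trans.ncomp_tens[OF sa, of a b b'] by simp
  next
    fix f b assume "f \<in> Arr A" "b \<in> Obj B"
    then show "farr (En_obj A B C (ncod \<sigma>)) (cl (TGenL f b)) \<cdot> en_nt C \<sigma> (WGen (Dom A f) b) =
      en_nt C \<sigma> (WGen (Cod A f) b) \<cdot> ncomp (farr (ndom \<sigma>) f) b"
      using arg_cong[OF s.ncomp_nat, of f "Dom A f" "\<lambda>\<sigma>. ncomp \<sigma> b"] by simp
  next
    fix a g assume "a \<in> Obj A" "g \<in> Arr B"
    then show "farr (En_obj A B C (ncod \<sigma>)) (cl (TGenR a g)) \<cdot> en_nt C \<sigma> (WGen a (Dom B g)) =
      en_nt C \<sigma> (WGen a (Cod B g)) \<cdot> farr (fobj (ndom \<sigma>) a) g"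
      using mon_nat_trans.ncomp_nat[OF sa, of a g] by simp
  qed (auto intro: G.sym_mon_functor_En_obj)
qed

end

section \<open>Currying\<close>

text \<open>Precomposition merely reindexes pointwise data and so preserves the tensor of functors
  on the nose. Together with \<open>hom_post_hom_tens\<close> this makes Rn strict.\<close>

lemma smf_comp_hom_tens:
  assumes F: "sym_mon_functor A B F" and H: "sym_mon_functor B C H" and K: "sym_mon_functor B C K"
  shows "smf_comp A C (hom_tens B C H K) F = hom_tens A C (smf_comp A C H F) (smf_comp A C K F)"
proof -
  interpret F: sym_mon_functor A B F by fact
  interpret H: sym_mon_functor B C H by fact
  interpret K: sym_mon_functor B C K by fact
  show ?thesis
  proof (rule smf_eqI[of A C])
    show "sym_mon_functor A C (smf_comp A C (hom_tens B C H K) F)"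
      by (rule sym_mon_functor_comp[OF F sym_mon_functor_hom_tens[OF H K]])
    show "sym_mon_functor A C (hom_tens A C (smf_comp A C H F) (smf_comp A C K F))"
      by (intro sym_mon_functor_hom_tens sym_mon_functor_comp[OF F] H K)
  qed (simp_all add: H.B.TensM_Comp_ext)
qed

lemma smf_comp_hom_unit:
  assumes F: "sym_mon_functor A B F" and C: "sym_mon_cat C"
  shows "smf_comp A C (hom_unit B C) F = hom_unit A C"
proof -
  interpret F: sym_mon_functor A B F by fact
  interpret C: sym_mon_cat C by fact
  note U = sym_mon_functor_hom_unit[OF _ C]
  show ?thesis
    by (rule smf_eqI[of A C])
      (simp_all add: U F.A.sym_mon_cat_axioms F.B.sym_mon_cat_axioms sym_mon_functor_comp[OF F])
qed

lemma hom_cat_interchange: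
  assumes "sym_mon_functor A B F" "sym_mon_functor A B G" "sym_mon_functor A B H" "sym_mon_functor A B K"
    "a \<in> Obj A"
  shows "ncomp (interchange (hom_cat A B) F G H K) a = interchange B (fobj F a) (fobj G a) (fobj H a) (fobj K a)"
proof -
  interpret F: sym_mon_functor A B F by fact
  note simps = sym_mon_functor.fobj_simp mnt_ass hom_cat_inv_ncomp sym_mon_functor_hom_tens
  show ?thesis
    using assms by (simp add: interchange_def Let_def simps)
qed

lemma mnt_curried_eqI:
  assumes \<sigma>: "mon_nat_trans A (hom_cat B C) \<sigma>" and \<tau>: "mon_nat_trans A (hom_cat B C) \<tau>"
    and d: "ndom \<sigma> = ndom \<tau>" "ncod \<sigma> = ncod \<tau>"
    and "\<And>a b. a \<in> Obj A \<Longrightarrow> b \<in> Obj B \<Longrightarrow> ncomp (ncomp \<sigma> a) b = ncomp (ncomp \<tau> a) b"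
  shows "\<sigma> = \<tau>"
proof (rule mnt_eqI[OF \<sigma> \<tau> d])
  fix a assume "a \<in> Obj A"
  then show "ncomp \<sigma> a = ncomp \<tau> a"
    using mon_nat_trans.ncomp_simps[OF \<sigma>, of a] mon_nat_trans.ncomp_simps[OF \<tau>, of a] assms(5) d
    by (intro mnt_eqI[of B C]) simp_all
qed

lemma hom_post_comp:
  assumes A: "sym_mon_cat A" and F: "sym_mon_functor B C F" and G: "sym_mon_functor C D G"
  shows "hom_post A B D (smf_comp B D G F) =
    smf_comp (hom_cat A B) (hom_cat A D) (hom_post A C D G) (hom_post A B C F)"
proof -
  interpret A: sym_mon_cat A by fact
  interpret F: sym_mon_functor B C F by fact
  interpret G: sym_mon_functor C D G by fact
  interpret AD: sym_mon_cat "hom_cat A D"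
    by (intro sym_mon_cat_hom_cat A G.B.sym_mon_cat_axioms)
  have GF: "sym_mon_functor B D (smf_comp B D G F)"
    by (rule sym_mon_functor_comp[OF F G])
  note closed = mnt_whisker_l[OF _ F] mnt_whisker_l[OF _ G] mnt_whisker_l[OF _ GF] sym_mon_functor_comp[OF _ F] sym_mon_functor_comp[OF _ G]
    sym_mon_functor_comp[OF _ GF] mnt_hom_post_unit[OF A F] mnt_hom_post_tens[OF F] mnt_hom_post_unit[OF A G] mnt_hom_post_tens[OF G]
    mnt_hom_post_unit[OF A GF] mnt_hom_post_tens[OF GF] smf_comp_assoc[OF _ F G] mon_nat_trans_functors
    sym_mon_functor_hom_tens sym_mon_functor_hom_unit[OF A F.A.sym_mon_cat_axioms] sym_mon_functor_hom_unit[OF A F.B.sym_mon_cat_axioms]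
    mnt_Comp
  note simps = sym_mon_functor.fobj_simp mon_nat_trans.ncomp_simps
  show ?thesis
  proof (rule smf_eqI[of "hom_cat A B" "hom_cat A D"])
    show "sym_mon_functor (hom_cat A B) (hom_cat A D) (hom_post A B D (smf_comp B D G F))"
      by (rule sym_mon_functor_hom_post[OF A GF])
    show "sym_mon_functor (hom_cat A B) (hom_cat A D) (smf_comp (hom_cat A B) (hom_cat A D) (hom_post A C D G) (hom_post A B C F))"
      by (rule sym_mon_functor_comp[OF sym_mon_functor_hom_post[OF A F] sym_mon_functor_hom_post[OF A G]])
  qed (auto intro!: mnt_eqI[of A D] simp: closed simps)
qed

text \<open>At a functor F this is \<open>smf_comp_hom_tens\<close>, as [A,H] evaluated at F is H
  precomposed with F. The structure arrows agree because the interchange of [A,C] is computed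
  pointwise.\<close>

lemma hom_post_hom_tens:
  fixes A :: "('oa, 'ma) smcat"
  assumes A: "sym_mon_cat A" and H: "sym_mon_functor B C H" and K: "sym_mon_functor B C K"
  shows "hom_post A B C (hom_tens B C H K) =
    hom_tens (hom_cat A B) (hom_cat A C) (hom_post A B C H) (hom_post A B C K)" (is "?L = ?R")
proof -
  interpret A: sym_mon_cat A by fact
  interpret H: sym_mon_functor B C H by fact
  interpret K: sym_mon_functor B C K by fact
  interpret AC: sym_mon_cat "hom_cat A C"
    by (intro sym_mon_cat_hom_cat A H.B.sym_mon_cat_axioms)
  have HK: "sym_mon_functor B C (hom_tens B C H K)"
    by (rule sym_mon_functor_hom_tens[OF H K])
  have L: "sym_mon_functor (hom_cat A B) (hom_cat A C) ?L"
    by (rule sym_mon_functor_hom_post[OF A HK])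
  have R: "sym_mon_functor (hom_cat A B) (hom_cat A C) ?R"
    by (intro sym_mon_functor_hom_tens sym_mon_functor_hom_post A H K)
  note closed = smf_comp_hom_tens[OF _ H K] mon_nat_trans_functors mnt_whisker_l[OF _ H] mnt_whisker_l[OF _ K] mnt_whisker_l[OF _ HK]
     mnt_lunit sym_mon_functor_hom_unit[OF A H.B.sym_mon_cat_axioms] sym_mon_functor_hom_unit[OF A H.A.sym_mon_cat_axioms]
     hom_cat_inv_ncomp sym_mon_functor_comp[OF _ H] sym_mon_functor_comp[OF _ K] hom_cat_interchange mnt_TensM
     sym_mon_functor_hom_tens sym_mon_functor.fobj_simp
  show ?thesis
  proof (rule smf_eqI[OF L R])
    fix F assume "F \<in> Obj (hom_cat A B)"
    then show "fobj ?L F = fobj ?R F"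
      by (simp add: closed)
  next
    fix f assume f: "f \<in> Arr (hom_cat A B)"
    then have "mon_nat_trans A B f" by simp
    then interpret f: mon_nat_trans A B f .
    show "farr ?L f = farr ?R f"
      using sym_mon_functor.farr_simps(1)[OF L f] sym_mon_functor.farr_simps(1)[OF R f] f
      by (intro mnt_eqI[of A C]) (simp_all add: closed)
  next
    show "funit ?L = funit ?R"
      using sym_mon_functor.funit_simps[OF L] sym_mon_functor.funit_simps[OF R]
      by (intro mnt_eqI[of A C]) (simp_all add: closed)
  next
    fix F G assume FG: "F \<in> Obj (hom_cat A B)" "G \<in> Obj (hom_cat A B)"
    then show "ftens ?L (F, G) = ftens ?R (F, G)"
      using sym_mon_functor.ftens_simps[OF L FG] sym_mon_functor.ftens_simps[OF R FG]
      by (intro mnt_eqI[of A C]) (simp_all add: closed)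
  qed
qed

lemma hom_post_hom_unit:
  fixes A :: "('oa, 'ma) smcat"
  assumes A: "sym_mon_cat A" and B: "sym_mon_cat B" and C: "sym_mon_cat C"
  shows "hom_post A B C (hom_unit B C) = hom_unit (hom_cat A B) (hom_cat A C)" (is "?L = ?R")
proof -
  interpret C: sym_mon_cat C by fact
  have L: "sym_mon_functor (hom_cat A B) (hom_cat A C) ?L"
    by (intro sym_mon_functor_hom_post sym_mon_functor_hom_unit A B C)
  have R: "sym_mon_functor (hom_cat A B) (hom_cat A C) ?R"
    by (intro sym_mon_functor_hom_unit sym_mon_cat_hom_cat A B C)
  note simps = smf_comp_hom_unit[OF _ C] sym_mon_functor_hom_unit[OF A B] sym_mon_functor_hom_tens mon_nat_trans_functors mon_nat_trans.ncomp_simps sym_mon_functor.fobj_simp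
  show ?thesis
  proof (rule smf_eqI[OF L R])
    fix F assume "F \<in> Obj (hom_cat A B)"
    then show "fobj ?L F = fobj ?R F"
      by (simp add: simps)
  next
    fix f assume f: "f \<in> Arr (hom_cat A B)"
    then show "farr ?L f = farr ?R f"
      using sym_mon_functor.farr_simps(1)[OF L f] sym_mon_functor.farr_simps(1)[OF R f]
      by (intro mnt_eqI[of A C]) (simp_all add: simps)
  next
    show "funit ?L = funit ?R"
      using sym_mon_functor.funit_simps[OF L] sym_mon_functor.funit_simps[OF R]
      by (intro mnt_eqI[of A C]) (simp_all add: simps)
  next
    fix F G assume FG: "F \<in> Obj (hom_cat A B)" "G \<in> Obj (hom_cat A B)"
    then show "ftens ?L (F, G) = ftens ?R (F, G)"
      using sym_mon_functor.ftens_simps[OF L FG] sym_mon_functor.ftens_simps[OF R FG]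
      by (intro mnt_eqI[of A C]) (simp_all add: simps)
  qed
qed

section \<open>Rn on objects and its compatibilities\<close>

context smc_pair
begin

lemma sym_mon_functor_Rn_obj: "sym_mon_functor T C F \<Longrightarrow> sym_mon_functor A (hom_cat B C) (Rn_obj A B C F)"
  unfolding Rn_obj_def
  by (intro sym_mon_functor_comp[OF sym_mon_functor_eta] sym_mon_functor_hom_post B.sym_mon_cat_axioms)

lemma Rn_obj_simps [simp]:
  assumes F: "sym_mon_functor T C F"
  shows "a \<in> Obj A \<Longrightarrow> fobj (Rn_obj A B C F) a = smf_comp B C F (eta_at A B a)"
    "f \<in> Arr A \<Longrightarrow> farr (Rn_obj A B C F) f = whisker_l B C F (farr (eta A B) f)"
    "b \<in> Obj B \<Longrightarrow> ncomp (funit (Rn_obj A B C F)) b = farr F (cl (TAlpha b)) \<cdot>\<^bsub>C\<^esub> funit F"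
    "a \<in> Obj A \<Longrightarrow> a' \<in> Obj A \<Longrightarrow> b \<in> Obj B \<Longrightarrow> ncomp (ftens (Rn_obj A B C F) (a, a')) b =
      farr F (cl (TGamma a a' b)) \<cdot>\<^bsub>C\<^esub> ftens F (WGen a b, WGen a' b)"
  using assms sym_mon_functor_eta_at mnt_eta_arr mnt_eta_unit mnt_eta_tens
  by (simp_all add: Rn_obj_def)

lemma Rn_obj_hom_tens:
  assumes H: "sym_mon_functor T C H" and K: "sym_mon_functor T C K"
  shows "Rn_obj A B C (hom_tens T C H K) = hom_tens A (hom_cat B C) (Rn_obj A B C H) (Rn_obj A B C K)"
  unfolding Rn_obj_def
  by (simp add: hom_post_hom_tens[OF B.sym_mon_cat_axioms H K]
      smf_comp_hom_tens[OF sym_mon_functor_eta] sym_mon_functor_hom_post[OF B.sym_mon_cat_axioms] H K)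

lemma Rn_obj_hom_unit:
  assumes C: "sym_mon_cat C"
  shows "Rn_obj A B C (hom_unit T C) = hom_unit A (hom_cat B C)"
  unfolding Rn_obj_def
  by (simp add: hom_post_hom_unit[OF B.sym_mon_cat_axioms T.sym_mon_cat_axioms C]
      smf_comp_hom_unit[OF sym_mon_functor_eta sym_mon_cat_hom_cat[OF B.sym_mon_cat_axioms C]])

lemma Rn_obj_comp:
  assumes F: "sym_mon_functor T C F" and P: "sym_mon_functor C D P"
  shows "Rn_obj A B D (smf_comp T D P F) =
    smf_comp A (hom_cat B D) (hom_post B C D P) (Rn_obj A B C F)"
  unfolding Rn_obj_def
  by (simp add: hom_post_comp[OF B.sym_mon_cat_axioms F P]
     smf_comp_assoc[OF sym_mon_functor_eta sym_mon_functor_hom_post[OF B.sym_mon_cat_axioms F]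
       sym_mon_functor_hom_post[OF B.sym_mon_cat_axioms P]])

text \<open>Exhibits \<open>eta\<close> as Rn of a strict functor, so that En(eta) = 1 becomes an
  instance of En(Rn(G)) = G.\<close>

lemma Rn_obj_id: "Rn_obj A B T (smf_id T) = eta A B"
proof (rule smf_eqI[of A "hom_cat B T"])
  note id = sym_mon_functor_id[OF T.sym_mon_cat_axioms]
  note R = sym_mon_functor_Rn_obj[OF id]
  note E = sym_mon_functor_eta
  interpret R: curried_functor A B T "Rn_obj A B T (smf_id T)"
    by (intro curried_functorI R T.sym_mon_cat_axioms)
  interpret E: curried_functor A B T "eta A B"
    by (intro curried_functorI E T.sym_mon_cat_axioms)
  note [simp] = collapse(1) tensor_cat_cl(3) tensor_cat_cl_ends smf_comp_id[OF sym_mon_functor_eta_at] id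
  show "sym_mon_functor A (hom_cat B T) (Rn_obj A B T (smf_id T))" by (rule R)
  show "sym_mon_functor A (hom_cat B T) (eta A B)" by (rule E)
  show o: "fobj (Rn_obj A B T (smf_id T)) a = fobj (eta A B) a" if "a \<in> Obj A" for a
    using that by simp
  show "farr (Rn_obj A B T (smf_id T)) f = farr (eta A B) f" if f: "f \<in> Arr A" for f
    using R.F_nt(1)[OF f] E.F_nt(1)[OF f] f by (intro mnt_eqI[of B T]) simp_all
  show "funit (Rn_obj A B T (smf_id T)) = funit (eta A B)"
    using R.F_nt(2) E.F_nt(2) by (intro mnt_eqI[of B T]) (simp_all add: tensor_cat_cl(2))
  show "ftens (Rn_obj A B T (smf_id T)) (a, a') = ftens (eta A B) (a, a')" if a: "a \<in> Obj A" "a' \<in> Obj A" for a a'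
    using R.F_nt(3)[OF a] E.F_nt(3)[OF a] a by (intro mnt_eqI[of B T]) simp_all
qed

end

text \<open>The value at \<open>a\<close> is En(F) restricted along \<open>eta_at\<close>; since
  En(F) is strict no structure arrows are added, and the generators return F. Objects are compared
  first, as \<open>o\<close> identifies the ends of the transformations compared afterwards.\<close>

lemma (in curried_functor) Rn_obj_En_obj: "Rn_obj A B C (En_obj A B C F) = F"
proof (rule smf_eqI[of A "hom_cat B C"])
  note E = sym_mon_functor_En_obj
  interpret R: curried_functor A B C "Rn_obj A B C (En_obj A B C F)"
    by (intro curried_functorI C.sym_mon_cat_axioms sym_mon_functor_Rn_obj[OF E])
  note [simp] = E
  show "sym_mon_functor A (hom_cat B C) (Rn_obj A B C (En_obj A B C F))" by (rule sym_mon_functor_Rn_obj[OF E])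
  show "sym_mon_functor A (hom_cat B C) F" by (rule F.sym_mon_functor_axioms)
  show o: "fobj (Rn_obj A B C (En_obj A B C F)) a = fobj F a" if a: "a \<in> Obj A" for a
    using R.F_at[OF a] F_at[OF a] a by (intro smf_eqI[of B C]) simp_all
  show "farr (Rn_obj A B C (En_obj A B C F)) f = farr F f" if f: "f \<in> Arr A" for f
    using R.F_nt(1)[OF f] F_nt(1)[OF f] f o[of "Dom A f"] o[of "Cod A f"] by (intro mnt_eqI[of B C]) simp_all
  show "funit (Rn_obj A B C (En_obj A B C F)) = funit F"
    using R.F_nt(2) F_nt(2) o[of "Unit A"] by (intro mnt_eqI[of B C]) simp_all
  show "ftens (Rn_obj A B C (En_obj A B C F)) (a, a') = ftens F (a, a')" if a: "a \<in> Obj A" "a' \<in> Obj A" for a a'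
    using R.F_nt(3)[OF a] F_nt(3)[OF a] a o[of a] o[of a'] o[of "a \<otimes>\<^bsub>A\<^esub> a'"] by (intro mnt_eqI[of B C]) simp_all
qed

lemma curried_nt_simps:
  assumes "mon_nat_trans A (hom_cat B C) \<sigma>" "a \<in> Obj A"
  shows "mon_nat_trans B C (ncomp \<sigma> a)" "ndom (ncomp \<sigma> a) = fobj (ndom \<sigma>) a" "ncod (ncomp \<sigma> a) = fobj (ncod \<sigma>) a"
    "b \<in> Obj B \<Longrightarrow> ncomp (ncomp \<sigma> a) b \<in> Arr C"
    "b \<in> Obj B \<Longrightarrow> Dom C (ncomp (ncomp \<sigma> a) b) = fobj (fobj (ndom \<sigma>) a) b"
    "b \<in> Obj B \<Longrightarrow> Cod C (ncomp (ncomp \<sigma> a) b) = fobj (fobj (ncod \<sigma>) a) b"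
proof -
  show *: "mon_nat_trans B C (ncomp \<sigma> a)" "ndom (ncomp \<sigma> a) = fobj (ndom \<sigma>) a" "ncod (ncomp \<sigma> a) = fobj (ncod \<sigma>) a"
    using mon_nat_trans.ncomp_simps[OF assms] by simp_all
  show "b \<in> Obj B \<Longrightarrow> ncomp (ncomp \<sigma> a) b \<in> Arr C"
    "b \<in> Obj B \<Longrightarrow> Dom C (ncomp (ncomp \<sigma> a) b) = fobj (fobj (ndom \<sigma>) a) b"
    "b \<in> Obj B \<Longrightarrow> Cod C (ncomp (ncomp \<sigma> a) b) = fobj (fobj (ncod \<sigma>) a) b"
    using mon_nat_trans.ncomp_simps[OF *(1)] * by simp_all
qed

lemma curried_obj:
  assumes "sym_mon_functor A (hom_cat B C) F" "a \<in> Obj A"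
  shows "sym_mon_functor B C (fobj F a)" "b \<in> Obj B \<Longrightarrow> fobj (fobj F a) b \<in> Obj C"
proof -
  show *: "sym_mon_functor B C (fobj F a)"
    using sym_mon_functor.fobj_simp[OF assms] by simp
  show "b \<in> Obj B \<Longrightarrow> fobj (fobj F a) b \<in> Obj C"
    using sym_mon_functor.fobj_simp[OF *] .
qed

subsection \<open>Strict functors\<close>

text \<open>Only the structure arrows are required to be identities; the equalities of objects
  follow by comparing sources and targets, see \<open>strict_smf_objs\<close>.\<close>

definition strict_smf :: "('oa, 'ma) smcat \<Rightarrow> ('ob, 'mb) smcat \<Rightarrow> ('oa, 'ma, 'ob, 'mb) smfun \<Rightarrow> bool" where
  "strict_smf A B F \<longleftrightarrow> funit F = Id B (Unit B) \<and>
    (\<forall>a\<in>Obj A. \<forall>b\<in>Obj A. ftens F (a, b) = Id B (fobj F a \<otimes>\<^bsub>B\<^esub> fobj F b))"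

lemma strict_smf_objs:
  assumes F: "sym_mon_functor A B F" and s: "strict_smf A B F"
  shows "fobj F (Unit A) = Unit B"
    "a \<in> Obj A \<Longrightarrow> b \<in> Obj A \<Longrightarrow> fobj F (a \<otimes>\<^bsub>A\<^esub> b) = fobj F a \<otimes>\<^bsub>B\<^esub> fobj F b"
proof -
  interpret F: sym_mon_functor A B F by fact
  show "fobj F (Unit A) = Unit B"
    using F.funit_simps(3) s by (simp add: strict_smf_def del: F.funit_simps)
  show "a \<in> Obj A \<Longrightarrow> b \<in> Obj A \<Longrightarrow> fobj F (a \<otimes>\<^bsub>A\<^esub> b) = fobj F a \<otimes>\<^bsub>B\<^esub> fobj F b"
    using F.ftens_simps(3)[of a b] s by (simp add: strict_smf_def del: F.ftens_simps)
qed

lemma strict_smf_comp: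
  assumes F: "sym_mon_functor A B F" and G: "sym_mon_functor B C G"
    and s: "strict_smf A B F" "strict_smf B C G"
  shows "strict_smf A C (smf_comp A C G F)"
proof -
  interpret F: sym_mon_functor A B F by fact
  interpret G: sym_mon_functor B C G by fact
  show ?thesis
    using s strict_smf_objs[OF G s(2)] unfolding strict_smf_def by simp
qed

text \<open>Source of equalities of functors: it suffices to exhibit a transformation all of whose
  components are identities.\<close>

lemma mnt_identity:
  assumes \<sigma>: "mon_nat_trans A B \<sigma>" and i: "\<And>a. a \<in> Obj A \<Longrightarrow> ncomp \<sigma> a = Id B (fobj (ndom \<sigma>) a)"
  shows "ncod \<sigma> = ndom \<sigma>" "\<sigma> = Id (hom_cat A B) (ndom \<sigma>)"
proof -
  interpret s: mon_nat_trans A B \<sigma> by fact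
  have o: "fobj (ncod \<sigma>) a = fobj (ndom \<sigma>) a" if "a \<in> Obj A" for a
    using s.ncomp_simps[OF that] that by (simp add: i)
  show e: "ncod \<sigma> = ndom \<sigma>"
  proof (rule smf_eqI[of A B])
    show "farr (ncod \<sigma>) f = farr (ndom \<sigma>) f" if "f \<in> Arr A" for f
      using s.ncomp_nat[of f] that by (simp add: i o)
    show "funit (ncod \<sigma>) = funit (ndom \<sigma>)"
      using s.ncomp_unit by (simp add: i)
    show "ftens (ncod \<sigma>) (a, b) = ftens (ndom \<sigma>) (a, b)" if "a \<in> Obj A" "b \<in> Obj A" for a b
      using s.ncomp_tens[of a b] that by (simp add: i o)
  qed (simp_all add: o s.F.sym_mon_functor_axioms s.G.sym_mon_functor_axioms)
  show "\<sigma> = Id (hom_cat A B) (ndom \<sigma>)"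
    by (rule mnt_eqI[of A B]) (simp_all add: \<sigma> i e mnt_Id s.F.sym_mon_functor_axioms)
qed

text \<open>The components of the structure arrows of [A,P] are structure arrows of P, so
  \<open>mnt_identity\<close> applies. In the final argument this lets a strict functor pass through
  two nested instances of En.\<close>

lemma strict_hom_post:
  fixes A :: "('oa, 'ma) smcat"
  assumes A: "sym_mon_cat A" and P: "sym_mon_functor B C P" and s: "strict_smf B C P"
  shows "strict_smf (hom_cat A B) (hom_cat A C) (hom_post A B C P)"
proof -
  interpret P: sym_mon_functor B C P by fact
  have "funit (hom_post A B C P) = Id (hom_cat A C) (hom_unit A C)"
    using mnt_identity(2)[OF mnt_hom_post_unit[OF A P]] s by (simp add: strict_smf_def)
  moreover have "ftens (hom_post A B C P) (H, K) = Id (hom_cat A C) (hom_tens A C (smf_comp A C P H) (smf_comp A C P K))"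
    if "sym_mon_functor A B H" "sym_mon_functor A B K" for H K
    using mnt_identity(2)[OF mnt_hom_post_tens[OF P that]] s that
    by (simp add: strict_smf_def sym_mon_functor.fobj_simp)
  ultimately show ?thesis
    by (simp add: strict_smf_def)
qed

section \<open>The counit \<epsilon> and strict functors out of the tensor\<close>

context smc_pair
begin

text \<open>Among the hypotheses of \<open>mnt_En\<close>, \<open>unit\<close> and
  \<open>tens\<close> are the recursion of \<open>eps_comp\<close>; at the generating arrows both
  sides agree because Rn(G) is G restricted to the generators.\<close>

lemma mnt_eps:
  assumes G: "sym_mon_functor T C G"
  shows "mon_nat_trans T C (eps A B C G)"
proof -
  interpret G: sym_mon_functor T C G by fact
  interpret R: curried_functor A B C "Rn_obj A B C G"
    by (intro curried_functorI G.B.sym_mon_cat_axioms sym_mon_functor_Rn_obj G)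
  note [simp] = G tensor_cat_cl(1,3) tensor_cat_cl_ends mnt_eta_arr
  have [simp]: "fobj G X \<in> Obj C" if "is_word A B X" for X
    using that G.fobj_simp by simp
  have [simp]: "ftens G (X, Y) \<in> Arr C" "Dom C (ftens G (X, Y)) = fobj G X \<otimes>\<^bsub>C\<^esub> fobj G Y"
    "Cod C (ftens G (X, Y)) = fobj G (X \<odot> Y)" if "is_word A B X" "is_word A B Y" for X Y
    using that G.ftens_simps by auto
  have [simp]: "fobj G (Unit T) = fobj G WUnit"
    by (simp add: tensor_cat_cl(2))
  show ?thesis
    unfolding eps_def by (rule R.mnt_En) simp_all
qed

lemma eps_simps [simp]:
  "ndom (eps A B C G) = En_obj A B C (Rn_obj A B C G)" "ncod (eps A B C G) = G"
  "is_word A B X \<Longrightarrow> ncomp (eps A B C G) X = eps_comp C G X"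
  by (simp_all add: eps_def tensor_cat_cl)

text \<open>Meant for the unit functor and for tensors of functors En(F): unitors and interchanges
  enter their structure, so they need not be strict, but they are strong.\<close>

lemma eps_comp_iso:
  assumes G: "sym_mon_functor T C G" and u: "is_iso C (funit G)"
    and t: "\<And>X Y. is_word A B X \<Longrightarrow> is_word A B Y \<Longrightarrow> is_iso C (ftens G (X, Y))"
  shows "is_word A B X \<Longrightarrow> is_iso C (eps_comp C G X)"
proof -
  interpret G: sym_mon_functor T C G by fact
  interpret e: mon_nat_trans T C "eps A B C G" by (rule mnt_eps[OF G])
  have [simp]: "Cod C (eps_comp C G X) = fobj G X" "eps_comp C G X \<in> Arr C" if "is_word A B X" for X
    using e.ncomp_simps[of X] that by (simp_all add: tensor_cat_cl(1))
  show "is_word A B X \<Longrightarrow> is_iso C (eps_comp C G X)"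
  proof (induction X)
    case (WTens X Y)
    then show ?case
      using G.ftens_simps[of X Y] t[of X Y] by (simp add: tensor_cat_cl(1))
  next
    case (WGen a b)
    then show ?case
      using G.fobj_simp[of "WGen a b"] by (simp add: tensor_cat_cl(1))
  qed (simp add: u)
qed

lemma eps_iso:
  assumes G: "sym_mon_functor T C G" and u: "is_iso C (funit G)"
    and t: "\<And>X Y. is_word A B X \<Longrightarrow> is_word A B Y \<Longrightarrow> is_iso C (ftens G (X, Y))"
  shows "is_iso (hom_cat T C) (eps A B C G)"
  by (rule hom_cat_is_iso[OF mnt_eps[OF G]]) (simp add: tensor_cat_cl(1) eps_comp_iso[OF assms])

lemma En_obj_Rn_obj:
  assumes G: "sym_mon_functor T C G" and s: "strict_smf T C G"
  shows "En_obj A B C (Rn_obj A B C G) = G"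
proof -
  interpret G: sym_mon_functor T C G by fact
  interpret e: mon_nat_trans T C "eps A B C G" by (rule mnt_eps[OF G])
  note [simp] = tensor_cat_cl(1,3)
  have U: "Unit T = WUnit" by (rule tensor_cat_cl)
  have [simp]: "fobj G WUnit = Unit C" "\<And>X Y. is_word A B X \<Longrightarrow> is_word A B Y \<Longrightarrow> fobj G (X \<odot> Y) = fobj G X \<otimes>\<^bsub>C\<^esub> fobj G Y"
    using strict_smf_objs[OF G s] by (simp_all add: U)
  have [simp]: "\<And>X. is_word A B X \<Longrightarrow> fobj G X \<in> Obj C"
    using G.fobj_simp by simp
  have "eps_comp C G X = Id C (fobj G X)" if "is_word A B X" for X
    using that s by (induction X) (auto simp: strict_smf_def)
  \<comment> \<open>The component just computed is an identity, and comparing its source with that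
    of \<epsilon> gives the equality of objects.\<close>
  moreover have "fobj (En_obj A B C (Rn_obj A B C G)) X = fobj G X" if "is_word A B X" for X
    using e.ncomp_simps(2)[of X] that calculation[OF that] by simp
  ultimately show ?thesis
    using mnt_identity(1)[OF mnt_eps[OF G]] by simp
qed

lemma En_obj_eta: "En_obj A B T (eta A B) = smf_id T"
  using En_obj_Rn_obj[OF sym_mon_functor_id[OF T.sym_mon_cat_axioms]] Rn_obj_id
  by (simp add: strict_smf_def)

end

context curried_functor
begin

lemma strict_En_obj: "strict_smf T C (En_obj A B C F)"
  by (simp add: strict_smf_def tensor_cat_cl(1))

lemma strict_comp_En_obj:
  assumes P: "sym_mon_functor C D P" and s: "strict_smf C D P"
  shows "smf_comp T D P (En_obj A B C F) =
    En_obj A B D (smf_comp A (hom_cat B D) (hom_post B C D P) F)"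
  using En_obj_Rn_obj[OF sym_mon_functor_comp[OF sym_mon_functor_En_obj P]
    strict_smf_comp[OF sym_mon_functor_En_obj P strict_En_obj s]]
  by (simp add: Rn_obj_comp[OF sym_mon_functor_En_obj P] Rn_obj_En_obj)

end

section \<open>The functors En and Rn\<close>

text \<open>A strong functor may be presented by the inverses \<open>u\<close> and \<open>t\<close>
  of its structure arrows, with the laws in oplax form. For En these are instances of \<epsilon>,
  and in this direction every composite starts at some En(H), where \<open>mnt_En_eqI\<close>
  applies.\<close>

lemma sym_mon_functorI_oplax:
  fixes A :: "('oa, 'ma) smcat" and B :: "('ob, 'mb) smcat" (structure)
  assumes A: "sym_mon_cat A" and B: "sym_mon_cat B"
    and ob: "\<And>a. a \<in> Obj A \<Longrightarrow> ob a \<in> Obj B"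
    and mo: "\<And>f. f \<in> Arr A \<Longrightarrow> mo f \<in> Arr B \<and> Dom B (mo f) = ob (Dom A f) \<and> Cod B (mo f) = ob (Cod A f)"
    and Id: "\<And>a. a \<in> Obj A \<Longrightarrow> mo (Id A a) = Id B (ob a)"
    and Comp: "\<And>f g. f \<in> Arr A \<Longrightarrow> g \<in> Arr A \<Longrightarrow> Dom A g = Cod A f \<Longrightarrow> mo (g \<cdot>\<^bsub>A\<^esub> f) = mo g \<cdot> mo f"
    and u: "is_iso B u" "Dom B u = ob (Unit A)" "Cod B u = Unit B"
    and t: "\<And>a b. a \<in> Obj A \<Longrightarrow> b \<in> Obj A \<Longrightarrow> is_iso B (t a b)"
      "\<And>a b. a \<in> Obj A \<Longrightarrow> b \<in> Obj A \<Longrightarrow> Dom B (t a b) = ob (a \<otimes>\<^bsub>A\<^esub> b)"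
      "\<And>a b. a \<in> Obj A \<Longrightarrow> b \<in> Obj A \<Longrightarrow> Cod B (t a b) = ob a \<otimes> ob b"
    and nat: "\<And>f g. f \<in> Arr A \<Longrightarrow> g \<in> Arr A \<Longrightarrow>
      t (Cod A f) (Cod A g) \<cdot> mo (f \<boxtimes>\<^bsub>A\<^esub> g) = (mo f \<boxtimes> mo g) \<cdot> t (Dom A f) (Dom A g)"
    and ass: "\<And>a b c. a \<in> Obj A \<Longrightarrow> b \<in> Obj A \<Longrightarrow> c \<in> Obj A \<Longrightarrow>
      (t a b \<boxtimes> Id B (ob c)) \<cdot> t (a \<otimes>\<^bsub>A\<^esub> b) c \<cdot> mo (ass A a b c) =
      ass B (ob a) (ob b) (ob c) \<cdot> (Id B (ob a) \<boxtimes> t b c) \<cdot> t a (b \<otimes>\<^bsub>A\<^esub> c)"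
    and run: "\<And>a. a \<in> Obj A \<Longrightarrow> mo (runit A a) = runit B (ob a) \<cdot> (Id B (ob a) \<boxtimes> u) \<cdot> t a (Unit A)"
    and lun: "\<And>a. a \<in> Obj A \<Longrightarrow> mo (lunit A a) = lunit B (ob a) \<cdot> (u \<boxtimes> Id B (ob a)) \<cdot> t (Unit A) a"
    and sy: "\<And>a b. a \<in> Obj A \<Longrightarrow> b \<in> Obj A \<Longrightarrow>
      t b a \<cdot> mo (symm A a b) = symm B (ob a) (ob b) \<cdot> t a b"
  shows "sym_mon_functor A B \<lparr>fobj = restrict ob (Obj A), farr = restrict mo (Arr A),
    funit = inv_arr B u, ftens = restrict (\<lambda>(a, b). inv_arr B (t a b)) (Obj A \<times> Obj A)\<rparr>"
proof -
  interpret A: sym_mon_cat A by fact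
  interpret B: sym_mon_cat B by fact
  note [simp] = ob mo u t B.is_iso_Arr[OF u(1)] B.is_iso_Arr[OF t(1)]
  let ?t = "\<lambda>(a, b). inv_arr B (t a b)"
  show ?thesis
  proof (rule sym_mon_functorI[OF A B])
    fix f g assume o: "f \<in> Arr A" "g \<in> Arr A"
    show "mo (f \<boxtimes>\<^bsub>A\<^esub> g) \<cdot> ?t (Dom A f, Dom A g) =
      ?t (Cod A f, Cod A g) \<cdot> (mo f \<boxtimes> mo g)"
      using B.inv_swap[OF nat[OF o]] o by simp
  next
    fix a b c assume o: "a \<in> Obj A" "b \<in> Obj A" "c \<in> Obj A"
    have "((t a b \<boxtimes> Id B (ob c)) \<cdot> t (a \<otimes>\<^bsub>A\<^esub> b) c) \<cdot> mo (ass A a b c) =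
      ass B (ob a) (ob b) (ob c) \<cdot> ((Id B (ob a) \<boxtimes> t b c) \<cdot> t a (b \<otimes>\<^bsub>A\<^esub> c))"
      using ass[OF o] o by simp
    from B.inv_swap[OF this] o
    show "mo (ass A a b c) \<cdot> ?t (a, b \<otimes>\<^bsub>A\<^esub> c) \<cdot>
        (Id B (ob a) \<boxtimes> ?t (b, c)) =
      ?t (a \<otimes>\<^bsub>A\<^esub> b, c) \<cdot>
        (?t (a, b) \<boxtimes> Id B (ob c)) \<cdot> ass B (ob a) (ob b) (ob c)"
      by (simp add: B.inv_Comp B.inv_TensM)
  next
    fix a assume o: "a \<in> Obj A"
    then show "mo (runit A a) \<cdot> ?t (a, Unit A) \<cdot> (Id B (ob a) \<boxtimes> inv_arr B u) = runit B (ob a)"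
      by (simp add: run B.TensM_Comp_simp)
    show "mo (lunit A a) \<cdot> ?t (Unit A, a) \<cdot> (inv_arr B u \<boxtimes> Id B (ob a)) = lunit B (ob a)"
      using o by (simp add: lun B.TensM_Comp_simp)
  next
    fix a b assume o: "a \<in> Obj A" "b \<in> Obj A"
    show "mo (symm A a b) \<cdot> ?t (a, b) =
      ?t (b, a) \<cdot> symm B (ob a) (ob b)"
      using B.inv_swap[OF sy[OF o]] o by simp
  qed (simp_all add: Id Comp)
qed

text \<open>Names the arrow part that is inlined in \<open>Rn\<close>, so that simp rules can refer
  to it.\<close>

definition Rn_arr :: "('oa, 'ma) smcat \<Rightarrow> ('ob, 'mb) smcat \<Rightarrow> ('oc, 'mc) smcat \<Rightarrow>
    (('oa, 'ob) word, ('oa, 'ma, 'ob, 'mb) texp set, 'oc, 'mc) mnt \<Rightarrow>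
    ('oa, 'ma, ('ob, 'mb, 'oc, 'mc) smfun, ('ob, 'mb, 'oc, 'mc) mnt) mnt" where
  "Rn_arr A B C \<sigma> = whisker_r A (hom_cat B C) (hom_post_nt B (tensor_cat A B) C \<sigma>) (eta A B)"

section \<open>Rn and En as functors between internal homs\<close>

context smc_pair
begin

lemma Rn_arr_simps [simp]:
  assumes "mon_nat_trans T C \<sigma>"
  shows "mon_nat_trans A (hom_cat B C) (Rn_arr A B C \<sigma>)"
    "ndom (Rn_arr A B C \<sigma>) = Rn_obj A B C (ndom \<sigma>)" "ncod (Rn_arr A B C \<sigma>) = Rn_obj A B C (ncod \<sigma>)"
    "a \<in> Obj A \<Longrightarrow> b \<in> Obj B \<Longrightarrow> ncomp (ncomp (Rn_arr A B C \<sigma>) a) b = ncomp \<sigma> (WGen a b)"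
proof -
  show "mon_nat_trans A (hom_cat B C) (Rn_arr A B C \<sigma>)"
    unfolding Rn_arr_def by (intro mnt_whisker_r[OF mnt_hom_post_nt[OF B.sym_mon_cat_axioms assms] sym_mon_functor_eta])
qed (simp_all add: Rn_arr_def hom_post_nt_def Rn_obj_def sym_mon_functor_eta_at)

lemma Rn_simps [simp]:
  "sym_mon_functor T C F \<Longrightarrow> fobj (Rn A B C) F = Rn_obj A B C F"
  "mon_nat_trans T C \<sigma> \<Longrightarrow> farr (Rn A B C) \<sigma> = Rn_arr A B C \<sigma>"
  "funit (Rn A B C) = Id (hom_cat A (hom_cat B C)) (hom_unit A (hom_cat B C))"
  "sym_mon_functor T C F \<Longrightarrow> sym_mon_functor T C G \<Longrightarrow> ftens (Rn A B C) (F, G) =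
    Id (hom_cat A (hom_cat B C)) (hom_tens A (hom_cat B C) (Rn_obj A B C F) (Rn_obj A B C G))"
  by (simp_all add: Rn_def Let_def Rn_arr_def)

text \<open>The structure arrows can be identities because \<open>Rn_obj\<close> preserves unit and
  tensor on the nose (\<open>Rn_obj_hom_unit\<close>, \<open>Rn_obj_hom_tens\<close>).\<close>

lemma sym_mon_functor_Rn:
  fixes C :: "('oc, 'mc) smcat"
  assumes C: "sym_mon_cat C"
  shows "sym_mon_functor (hom_cat T C) (hom_cat A (hom_cat B C)) (Rn A B C)"
proof -
  let ?S = "hom_cat A (hom_cat B C)" and ?H = "hom_cat T C"
  interpret C: sym_mon_cat C by fact
  interpret TC: sym_mon_cat ?H
    by (intro sym_mon_cat_hom_cat C T.sym_mon_cat_axioms)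
  have BC: "sym_mon_cat (hom_cat B C)"
    by (intro sym_mon_cat_hom_cat C B.sym_mon_cat_axioms)
  interpret H: sym_mon_cat ?S
    by (intro sym_mon_cat_hom_cat BC A.sym_mon_cat_axioms)
  note closed = mnt_Id mnt_Comp mnt_TensM mnt_ass mnt_runit mnt_lunit mnt_symm
    sym_mon_functor_hom_tens sym_mon_functor_hom_unit[OF T.sym_mon_cat_axioms C]
    sym_mon_functor_hom_unit[OF A.sym_mon_cat_axioms BC] mon_nat_trans_functors
    sym_mon_functor_Rn_obj Rn_obj_hom_tens Rn_obj_hom_unit[OF C]
  note simps = tensor_cat_cl(1) mon_nat_trans.ncomp_simps sym_mon_functor.fobj_simp curried_nt_simps curried_obj
  have "sym_mon_functor ?H ?S \<lparr>fobj = (\<lambda>F\<in>Obj ?H. Rn_obj A B C F),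
      farr = (\<lambda>\<sigma>\<in>Arr ?H. Rn_arr A B C \<sigma>),
      funit = Id ?S (hom_unit A (hom_cat B C)),
      ftens = restrict (\<lambda>(F, G). Id ?S (hom_tens A (hom_cat B C) (Rn_obj A B C F) (Rn_obj A B C G)))
        (Obj ?H \<times> Obj ?H)\<rparr>"
    by (rule sym_mon_functorI)
      (auto intro!: mnt_curried_eqI[of A B C] simp: closed simps TC.sym_mon_cat_axioms H.sym_mon_cat_axioms)
  then show ?thesis
    by (simp add: Rn_def Let_def Rn_arr_def)
qed

lemma En_arr_simps [simp]:
  "ndom (En_arr A B C \<sigma>) = En_obj A B C (ndom \<sigma>)" "ncod (En_arr A B C \<sigma>) = En_obj A B C (ncod \<sigma>)"
  "is_word A B X \<Longrightarrow> ncomp (En_arr A B C \<sigma>) X = en_nt C \<sigma> X"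
  by (simp_all add: En_arr_def tensor_cat_cl(1))

lemma sym_mon_functor_En_obj': "sym_mon_cat C \<Longrightarrow> sym_mon_functor A (hom_cat B C) F \<Longrightarrow> sym_mon_functor T C (En_obj A B C F)"
  using curried_functor.sym_mon_functor_En_obj[OF curried_functorI] .

lemma Rn_obj_En_obj': "sym_mon_cat C \<Longrightarrow> sym_mon_functor A (hom_cat B C) F \<Longrightarrow> Rn_obj A B C (En_obj A B C F) = F"
  using curried_functor.Rn_obj_En_obj[OF curried_functorI] .

lemma En_obj_at_gen:
  "sym_mon_cat C \<Longrightarrow> sym_mon_functor A (hom_cat B C) F \<Longrightarrow> a \<in> Obj A \<Longrightarrow> b \<in> Obj B \<Longrightarrow>
   fobj (En_obj A B C F) (WGen a b) = fobj (fobj F a) b"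
  using curried_functor.En_obj_simps(1)[OF curried_functorI, of C F "WGen a b"] by simp

lemma En_unit_iso:
  assumes C: "sym_mon_cat C"
  shows "is_iso (hom_cat T C) (eps A B C (hom_unit T C))"
proof -
  interpret C: sym_mon_cat C by fact
  show ?thesis
    by (rule eps_iso) (simp_all add: sym_mon_functor_hom_unit[OF T.sym_mon_cat_axioms C] tensor_cat_cl(1))
qed

lemma En_tens_iso:
  assumes C: "sym_mon_cat C" and F: "sym_mon_functor A (hom_cat B C) F" and G: "sym_mon_functor A (hom_cat B C) G"
  shows "is_iso (hom_cat T C) (eps A B C (hom_tens T C (En_obj A B C F) (En_obj A B C G)))"
proof -
  interpret F: curried_functor A B C F by (rule curried_functorI[OF C F])
  interpret G: curried_functor A B C G by (rule curried_functorI[OF C G])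
  show ?thesis
    by (rule eps_iso) (simp_all add: sym_mon_functor_hom_tens F.sym_mon_functor_En_obj G.sym_mon_functor_En_obj tensor_cat_cl(1))
qed

lemma En_simps [simp]:
  "sym_mon_functor A (hom_cat B C) F \<Longrightarrow> fobj (En A B C) F = En_obj A B C F"
  "mon_nat_trans A (hom_cat B C) \<sigma> \<Longrightarrow> farr (En A B C) \<sigma> = En_arr A B C \<sigma>"
  "funit (En A B C) = inv_arr (hom_cat T C) (eps A B C (hom_unit T C))"
  "sym_mon_functor A (hom_cat B C) F \<Longrightarrow> sym_mon_functor A (hom_cat B C) G \<Longrightarrow> ftens (En A B C) (F, G) =
    inv_arr (hom_cat T C) (eps A B C (hom_tens T C (En_obj A B C F) (En_obj A B C G)))"
  by (simp_all add: En_def Let_def)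

lemma sym_mon_functor_En:
  fixes C :: "('oc, 'mc) smcat"
  assumes C: "sym_mon_cat C"
  shows "sym_mon_functor (hom_cat A (hom_cat B C)) (hom_cat T C) (En A B C)"
proof -
  let ?S = "hom_cat A (hom_cat B C)" and ?H = "hom_cat T C"
  interpret C: sym_mon_cat C by fact
  have BC: "sym_mon_cat (hom_cat B C)"
    by (intro sym_mon_cat_hom_cat C B.sym_mon_cat_axioms)
  have S: "sym_mon_cat ?S"
    by (intro sym_mon_cat_hom_cat BC A.sym_mon_cat_axioms)
  have TC: "sym_mon_cat ?H"
    by (intro sym_mon_cat_hom_cat C T.sym_mon_cat_axioms)
  note UA = sym_mon_functor_hom_unit[OF A.sym_mon_cat_axioms BC]
    and UT = sym_mon_functor_hom_unit[OF T.sym_mon_cat_axioms C]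
    and UB = sym_mon_functor_hom_unit[OF B.sym_mon_cat_axioms C]
  note closed = mnt_Id mnt_Comp mnt_TensM mnt_ass mnt_runit mnt_lunit mnt_symm
    sym_mon_functor_hom_tens UA UT UB mon_nat_trans_functors
    sym_mon_functor_Rn_obj Rn_obj_hom_tens Rn_obj_hom_unit[OF C] Rn_obj_En_obj'[OF C]
    sym_mon_functor_En_obj'[OF C] mnt_En_arr[OF C] mnt_eps
  note simps = tensor_cat_cl(1) curried_nt_simps[of A B C] curried_obj[of A B C] En_obj_at_gen[OF C]
  \<comment> \<open>Each law is an equation between transformations out of some En(F), and the
    functor given to \<open>eqI\<close> is this F. At a generator every instance of \<epsilon> is an
    identity, so only pointwise structure is left to compare.\<close>
  have eqI: "\<sigma> = \<tau>" if "sym_mon_functor A (hom_cat B C) F" "mon_nat_trans T C \<sigma>" "mon_nat_trans T C \<tau>"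
      "ndom \<sigma> = En_obj A B C F" "ndom \<tau> = En_obj A B C F" "ncod \<sigma> = ncod \<tau>"
      "\<And>a b. a \<in> Obj A \<Longrightarrow> b \<in> Obj B \<Longrightarrow> ncomp \<sigma> (WGen a b) = ncomp \<tau> (WGen a b)" for \<sigma> \<tau> F
    by (rule curried_functor.mnt_En_eqI[OF curried_functorI[OF C that(1)] that(2-)])
  let ?t = "\<lambda>F G. eps A B C (hom_tens T C (En_obj A B C F) (En_obj A B C G))"
  have "sym_mon_functor ?S ?H
    \<lparr>fobj = (\<lambda>F\<in>Obj ?S. En_obj A B C F),
     farr = (\<lambda>\<sigma>\<in>Arr ?S. En_arr A B C \<sigma>),
     funit = inv_arr ?H (eps A B C (hom_unit T C)),
     ftens = restrict (\<lambda>(F, G). inv_arr ?H (?t F G))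
       (Obj ?S \<times> Obj ?S)\<rparr>"
  proof (rule sym_mon_functorI_oplax[OF S TC])
    fix F assume "F \<in> Obj ?S"
    then have F: "sym_mon_functor A (hom_cat B C) F" by simp
    show "En_arr A B C (Id ?S F) = Id ?H (En_obj A B C F)"
      by (rule eqI[OF F]) (simp_all add: F closed simps)
    show "En_arr A B C (runit ?S F) = runit ?H (En_obj A B C F) \<cdot>\<^bsub>?H\<^esub>
       (Id ?H (En_obj A B C F) \<boxtimes>\<^bsub>?H\<^esub> eps A B C (hom_unit T C)) \<cdot>\<^bsub>?H\<^esub> ?t F (Unit ?S)"
      by (rule eqI[of "hom_tens A (hom_cat B C) F (hom_unit A (hom_cat B C))"]) (simp_all add: F closed simps)
    show "En_arr A B C (lunit ?S F) = lunit ?H (En_obj A B C F) \<cdot>\<^bsub>?H\<^esub>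
       (eps A B C (hom_unit T C) \<boxtimes>\<^bsub>?H\<^esub> Id ?H (En_obj A B C F)) \<cdot>\<^bsub>?H\<^esub> ?t (Unit ?S) F"
      by (rule eqI[of "hom_tens A (hom_cat B C) (hom_unit A (hom_cat B C)) F"]) (simp_all add: F closed simps)
  next
    fix \<sigma> \<tau> assume "\<sigma> \<in> Arr ?S" "\<tau> \<in> Arr ?S"
    then have s: "mon_nat_trans A (hom_cat B C) \<sigma>" "mon_nat_trans A (hom_cat B C) \<tau>" by simp_all
    show "Dom ?S \<tau> = Cod ?S \<sigma> \<Longrightarrow>
       En_arr A B C (\<tau> \<cdot>\<^bsub>?S\<^esub> \<sigma>) = En_arr A B C \<tau> \<cdot>\<^bsub>?H\<^esub> En_arr A B C \<sigma>"
      by (rule eqI[of "ndom \<sigma>"]) (simp_all add: s closed simps)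
    show "?t (Cod ?S \<sigma>) (Cod ?S \<tau>) \<cdot>\<^bsub>?H\<^esub>
        En_arr A B C (\<sigma> \<boxtimes>\<^bsub>?S\<^esub> \<tau>) =
      (En_arr A B C \<sigma> \<boxtimes>\<^bsub>?H\<^esub> En_arr A B C \<tau>) \<cdot>\<^bsub>?H\<^esub>
        ?t (Dom ?S \<sigma>) (Dom ?S \<tau>)"
      by (rule eqI[of "hom_tens A (hom_cat B C) (ndom \<sigma>) (ndom \<tau>)"]) (simp_all add: s closed simps)
  next
    fix F G assume "F \<in> Obj ?S" "G \<in> Obj ?S"
    then have F: "sym_mon_functor A (hom_cat B C) F" "sym_mon_functor A (hom_cat B C) G" by simp_all
    show "is_iso ?H (?t F G)"
      by (rule En_tens_iso[OF C F])
    show "?t G F \<cdot>\<^bsub>?H\<^esub> En_arr A B C (symm ?S F G) =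
      symm ?H (En_obj A B C F) (En_obj A B C G) \<cdot>\<^bsub>?H\<^esub> ?t F G"
      by (rule eqI[of "hom_tens A (hom_cat B C) F G"]) (simp_all add: F closed simps)
    fix H assume "H \<in> Obj ?S"
    then have H: "sym_mon_functor A (hom_cat B C) H" by simp
    show "(?t F G \<boxtimes>\<^bsub>?H\<^esub> Id ?H (En_obj A B C H)) \<cdot>\<^bsub>?H\<^esub>
        ?t (F \<otimes>\<^bsub>?S\<^esub> G) H \<cdot>\<^bsub>?H\<^esub> En_arr A B C (ass ?S F G H) =
      ass ?H (En_obj A B C F) (En_obj A B C G) (En_obj A B C H) \<cdot>\<^bsub>?H\<^esub>
       (Id ?H (En_obj A B C F) \<boxtimes>\<^bsub>?H\<^esub> ?t G H) \<cdot>\<^bsub>?H\<^esub> ?t F (G \<otimes>\<^bsub>?S\<^esub> H)"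
      by (rule eqI[of "hom_tens A (hom_cat B C) F (hom_tens A (hom_cat B C) G H)"]) (simp_all add: F H closed simps)
  qed (simp_all add: closed En_unit_iso[OF C])
  then show ?thesis
    by (simp add: En_def Let_def)
qed

text \<open>On objects this is \<open>Rn_obj_comp\<close>. Since Rn is strict, the structure arrows
  of both composites come from the postcomposition functors, and their components are P^0 and
  instances of P^2.\<close>

lemma Rn_natural:
  fixes C :: "('oc, 'mc) smcat" and D :: "('od, 'md) smcat"
  assumes P: "sym_mon_functor C D P"
  shows "smf_comp (hom_cat T C) (hom_cat A (hom_cat B D)) (Rn A B D) (hom_post T C D P) =
    smf_comp (hom_cat T C) (hom_cat A (hom_cat B D)) (hom_post A (hom_cat B C) (hom_cat B D) (hom_post B C D P)) (Rn A B C)"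
    (is "?L = ?R")
proof -
  let ?S = "hom_cat A (hom_cat B D)" and ?H = "hom_cat T C"
  interpret P: sym_mon_functor C D P by fact
  note C = P.A.sym_mon_cat_axioms and D = P.B.sym_mon_cat_axioms
  have BC: "sym_mon_cat (hom_cat B C)" and BD: "sym_mon_cat (hom_cat B D)"
    by (intro sym_mon_cat_hom_cat C D B.sym_mon_cat_axioms)+
  note BP = sym_mon_functor_hom_post[OF B.sym_mon_cat_axioms P]
  note TP = sym_mon_functor_hom_post[OF T.sym_mon_cat_axioms P]
  note ABP = sym_mon_functor_hom_post[OF A.sym_mon_cat_axioms BP]
  have L: "sym_mon_functor ?H ?S ?L"
    by (rule sym_mon_functor_comp[OF TP sym_mon_functor_Rn[OF D]])
  have R: "sym_mon_functor ?H ?S ?R"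
    by (rule sym_mon_functor_comp[OF sym_mon_functor_Rn[OF C] ABP])
  note UA = sym_mon_functor_hom_unit[OF A.sym_mon_cat_axioms BC]
    and UT = sym_mon_functor_hom_unit[OF T.sym_mon_cat_axioms C]
    and UB = sym_mon_functor_hom_unit[OF B.sym_mon_cat_axioms C]
  note closed = sym_mon_functor_comp[OF _ P] mnt_whisker_l[OF _ P] mnt_whisker_l[OF _ BP] mnt_hom_post_unit[OF _ P] mnt_hom_post_tens[OF P]
    mnt_Id UA UB UT Rn_obj_comp[OF _ P] Rn_obj_hom_unit sym_mon_functor_hom_tens sym_mon_functor_Rn_obj mon_nat_trans_functors C D
    A.sym_mon_cat_axioms B.sym_mon_cat_axioms T.sym_mon_cat_axioms Rn_obj_hom_tens
    mnt_hom_post_unit[OF A.sym_mon_cat_axioms BP] mnt_hom_post_tens[OF BP]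
    sym_mon_functor_comp[OF sym_mon_functor_eta_at]
  note simps = tensor_cat_cl(1) curried_nt_simps[of A B C] curried_nt_simps[of A B D] curried_obj[of A B C] sym_mon_functor.fobj_simp mon_nat_trans.ncomp_simps
  show ?thesis
  proof (rule smf_eqI[OF L R])
    show o: "fobj ?L F = fobj ?R F" if "F \<in> Obj ?H" for F
      using that by (simp add: closed)
    show "farr ?L \<sigma> = farr ?R \<sigma>" if "\<sigma> \<in> Arr ?H" for \<sigma>
      using sym_mon_functor.farr_simps(1)[OF L that] sym_mon_functor.farr_simps(1)[OF R that] that
      by (intro mnt_curried_eqI[of A B D]) (simp_all add: closed simps)
    \<comment> \<open>Equal components do not suffice: the targets are the values of the two
      functors at the unit, which \<open>o\<close> identifies.\<close>
    show "funit ?L = funit ?R"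
      using sym_mon_functor.funit_simps(1)[OF L] sym_mon_functor.funit_simps(1)[OF R] o[of "hom_unit T C"]
      by (intro mnt_curried_eqI[of A B D]) (simp_all add: closed simps)
    show "ftens ?L (F, G) = ftens ?R (F, G)" if "F \<in> Obj ?H" "G \<in> Obj ?H" for F G
      using sym_mon_functor.ftens_simps(1)[OF L that] sym_mon_functor.ftens_simps(1)[OF R that] that o[of "hom_tens T C F G"]
      by (intro mnt_curried_eqI[of A B D]) (simp_all add: closed simps)
  qed
qed

text \<open>Beyond \<open>Rn_obj_En_obj\<close>, the monoidal structures are compared too. Rn is
  strict, so those of the composite are Rn applied to En^0 and En^2; these are inverses of instances
  of \<epsilon>, which are identities at the generators.\<close>

lemma Rn_En:
  fixes C :: "('oc, 'mc) smcat"
  assumes C: "sym_mon_cat C"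
  shows "smf_comp (hom_cat A (hom_cat B C)) (hom_cat A (hom_cat B C)) (Rn A B C) (En A B C) =
    smf_id (hom_cat A (hom_cat B C))" (is "?L = ?R")
proof -
  let ?S = "hom_cat A (hom_cat B C)" and ?H = "hom_cat T C"
  interpret C: sym_mon_cat C by fact
  have BC: "sym_mon_cat (hom_cat B C)"
    by (intro sym_mon_cat_hom_cat C B.sym_mon_cat_axioms)
  have S: "sym_mon_cat ?S"
    by (intro sym_mon_cat_hom_cat BC A.sym_mon_cat_axioms)
  interpret TC: sym_mon_cat ?H
    by (intro sym_mon_cat_hom_cat C T.sym_mon_cat_axioms)
  note En = sym_mon_functor_En[OF C]
  have L: "sym_mon_functor ?S ?S ?L"
    by (rule sym_mon_functor_comp[OF En sym_mon_functor_Rn[OF C]])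
  have R: "sym_mon_functor ?S ?S ?R"
    by (rule sym_mon_functor_id[OF S])
  note UA = sym_mon_functor_hom_unit[OF A.sym_mon_cat_axioms BC]
    and UT = sym_mon_functor_hom_unit[OF T.sym_mon_cat_axioms C]
  note En_ends = TC.inv_arr_simps(1-3)[OF En_unit_iso[OF C], simplified] TC.inv_arr_simps(1-3)[OF En_tens_iso[OF C], simplified]
  have unit: "ncomp (inv_arr ?H (eps A B C (hom_unit T C))) (WGen a b) = Id C (Unit C)"
    if "a \<in> Obj A" "b \<in> Obj B" for a b
  proof -
    have "ncomp (inv_arr ?H (eps A B C (hom_unit T C))) (WGen a b) = inv_arr C (ncomp (eps A B C (hom_unit T C)) (WGen a b))"
      using that by (intro hom_cat_inv_ncomp mnt_eps UT)
        (simp_all add: tensor_cat_cl(1), intro eps_comp_iso, simp_all add: UT tensor_cat_cl(1))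
    then show ?thesis
      using that by (simp add: tensor_cat_cl(1))
  qed
  have tens: "ncomp (inv_arr ?H (eps A B C (hom_tens T C (En_obj A B C F) (En_obj A B C G)))) (WGen a b) =
      Id C (fobj (fobj F a) b \<otimes>\<^bsub>C\<^esub> fobj (fobj G a) b)"
    if F: "sym_mon_functor A (hom_cat B C) F" and G: "sym_mon_functor A (hom_cat B C) G" and "a \<in> Obj A" "b \<in> Obj B" for F G a b
  proof -
    interpret F: curried_functor A B C F by (rule curried_functorI[OF C F])
    interpret G: curried_functor A B C G by (rule curried_functorI[OF C G])
    note E = sym_mon_functor_hom_tens[OF F.sym_mon_functor_En_obj G.sym_mon_functor_En_obj]
    have "ncomp (inv_arr ?H (eps A B C (hom_tens T C (En_obj A B C F) (En_obj A B C G)))) (WGen a b) =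
       inv_arr C (ncomp (eps A B C (hom_tens T C (En_obj A B C F) (En_obj A B C G))) (WGen a b))"
      using that(3-) by (intro hom_cat_inv_ncomp mnt_eps E)
        (simp_all add: tensor_cat_cl(1), intro eps_comp_iso, simp_all add: E tensor_cat_cl(1))
    then show ?thesis
      using that(3-) by (simp add: tensor_cat_cl(1))
  qed
  note closed = mnt_Id UA UT sym_mon_functor_En_obj'[OF C] Rn_obj_En_obj'[OF C] sym_mon_functor_hom_tens mon_nat_trans_functors
    mnt_En_arr[OF C] Rn_obj_hom_unit[OF C] Rn_obj_hom_tens En_ends
  note simps = tensor_cat_cl(1) curried_nt_simps[of A B C] curried_obj[of A B C] En_obj_at_gen[OF C] unit tens
  show ?thesis
  proof (rule smf_eqI[OF L R])
    show o: "fobj ?L F = fobj ?R F" if "F \<in> Obj ?S" for F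
      using that by (simp add: closed)
    show "farr ?L \<sigma> = farr ?R \<sigma>" if "\<sigma> \<in> Arr ?S" for \<sigma>
      using sym_mon_functor.farr_simps(1)[OF L that] sym_mon_functor.farr_simps(1)[OF R that] that
      by (intro mnt_curried_eqI[of A B C]) (simp_all add: closed simps)
    show "funit ?L = funit ?R"
      using sym_mon_functor.funit_simps(1)[OF L] sym_mon_functor.funit_simps(1)[OF R]
      by (intro mnt_curried_eqI[of A B C]) (simp_all add: closed simps)
    show "ftens ?L (F, G) = ftens ?R (F, G)" if "F \<in> Obj ?S" "G \<in> Obj ?S" for F G
      using sym_mon_functor.ftens_simps(1)[OF L that] sym_mon_functor.ftens_simps(1)[OF R that] that
      by (intro mnt_curried_eqI[of A B C]) (simp_all add: closed simps)
  qed
qed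

end

section \<open>The 2-cell from the composite of the two associativity arrows to the identity\<close>

theorem lemma19p7:
  fixes A :: "('oa, 'ma) smcat" and B :: "('ob, 'mb) smcat" and C :: "('oc, 'mc) smcat"
  assumes "sym_mon_cat A" and "sym_mon_cat B" and "sym_mon_cat C"
  shows "\<exists>\<tau>. mon_nat_trans (tensor_cat (tensor_cat A B) C) (tensor_cat (tensor_cat A B) C) \<tau> \<and>
    ndom \<tau> = smf_comp (tensor_cat (tensor_cat A B) C) (tensor_cat (tensor_cat A B) C)
      (assoc_fun A B C) (assoc_fun' A B C) \<and>
    ncod \<tau> = smf_id (tensor_cat (tensor_cat A B) C)"
proof -
  interpret A: sym_mon_cat A by fact
  interpret B: sym_mon_cat B by fact
  interpret C: sym_mon_cat C by fact
  let ?AB = "tensor_cat A B" and ?BC = "tensor_cat B C"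
  interpret AB: smc_pair A B ..
  interpret BC: smc_pair B C ..
  interpret AB_C: smc_pair ?AB C ..
  interpret A_BC: smc_pair A ?BC ..
  let ?D = "tensor_cat ?AB C" and ?E = "tensor_cat A ?BC"
  note D = AB_C.T.sym_mon_cat_axioms and E = A_BC.T.sym_mon_cat_axioms
  have CD: "sym_mon_cat (hom_cat C ?D)" and CE: "sym_mon_cat (hom_cat C ?E)"
    by (intro sym_mon_cat_hom_cat assms D E)+
  \<comment> \<open>\<open>L\<close> is the composite [B,eta] after eta inside
    \<open>assoc_fun\<close>, written as Rn(eta). The two associativity arrows are
    En(\<open>L'\<close>) and En(En(\<open>K\<close>)).\<close>
  define L where "L = Rn_obj A B (hom_cat C ?D) (eta ?AB C)"
  define L' where "L' = smf_comp A (hom_cat ?BC ?D) (En B C ?D) L"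
  define K where "K = smf_comp A (hom_cat B (hom_cat C ?E)) (Rn B C ?E) (eta A ?BC)"
  define P where "P = assoc_fun A B C"
  have L: "sym_mon_functor A (hom_cat B (hom_cat C ?D)) L"
    unfolding L_def by (rule AB.sym_mon_functor_Rn_obj[OF AB_C.sym_mon_functor_eta])
  have L': "sym_mon_functor A (hom_cat ?BC ?D) L'"
    unfolding L'_def by (rule sym_mon_functor_comp[OF L BC.sym_mon_functor_En[OF D]])
  have K: "sym_mon_functor A (hom_cat B (hom_cat C ?E)) K"
    unfolding K_def by (rule sym_mon_functor_comp[OF A_BC.sym_mon_functor_eta BC.sym_mon_functor_Rn[OF E]])
  have P_eq: "P = En_obj A ?BC ?D L'"
    by (simp add: P_def assoc_fun_def Let_def L'_def L_def Rn_obj_def)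
  interpret L': curried_functor A ?BC ?D L'
    by (rule A_BC.curried_functorI[OF D L'])
  interpret K: curried_functor A B "hom_cat C ?E" K
    by (rule AB.curried_functorI[OF CE K])
  have EnK: "sym_mon_functor ?AB (hom_cat C ?E) (En_obj A B (hom_cat C ?E) K)"
    by (rule K.sym_mon_functor_En_obj)
  interpret EnK: curried_functor ?AB C ?E "En_obj A B (hom_cat C ?E) K"
    by (rule AB_C.curried_functorI[OF E EnK])
  have P: "sym_mon_functor ?E ?D P" and sP: "strict_smf ?E ?D P"
    unfolding P_eq by (rule L'.sym_mon_functor_En_obj, rule L'.strict_En_obj)
  \<comment> \<open>Passing P through the outer En turns it into [C,P], which must be strict in turn
    in order to pass through the inner En.\<close>
  let ?CP = "hom_post C ?E ?D P"
  have CP: "sym_mon_functor (hom_cat C ?E) (hom_cat C ?D) ?CP"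
    by (rule sym_mon_functor_hom_post[OF assms(3) P])
  have sCP: "strict_smf (hom_cat C ?E) (hom_cat C ?D) ?CP"
    by (rule strict_hom_post[OF assms(3) P sP])
  note BCP = sym_mon_functor_hom_post[OF assms(2) CP]
  note BCP' = sym_mon_functor_hom_post[OF BC.T.sym_mon_cat_axioms P]
  \<comment> \<open>Naturality moves P inside Rn, where it meets eta in Rn(P). As P is
    En(\<open>L'\<close>), this is \<open>L'\<close>, that is En after \<open>L\<close>; hence Rn
    and En cancel and \<open>L\<close> is left.\<close>
  have "smf_comp A (hom_cat B (hom_cat C ?D)) (hom_post B (hom_cat C ?E) (hom_cat C ?D) ?CP) K =
    smf_comp A (hom_cat B (hom_cat C ?D)) (smf_comp (hom_cat ?BC ?E) (hom_cat B (hom_cat C ?D))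
      (hom_post B (hom_cat C ?E) (hom_cat C ?D) ?CP) (Rn B C ?E)) (eta A ?BC)"
    unfolding K_def by (rule smf_comp_assoc[OF A_BC.sym_mon_functor_eta BC.sym_mon_functor_Rn[OF E] BCP])
  also have "\<dots> = smf_comp A (hom_cat B (hom_cat C ?D)) (smf_comp (hom_cat ?BC ?E) (hom_cat B (hom_cat C ?D))
      (Rn B C ?D) (hom_post ?BC ?E ?D P)) (eta A ?BC)"
    by (simp only: BC.Rn_natural[OF P])
  also have "\<dots> = smf_comp A (hom_cat B (hom_cat C ?D)) (Rn B C ?D) (Rn_obj A ?BC ?D P)"
    unfolding Rn_obj_def
    by (rule smf_comp_assoc[OF A_BC.sym_mon_functor_eta BCP' BC.sym_mon_functor_Rn[OF D], symmetric])
  also have "Rn_obj A ?BC ?D P = L'"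
    unfolding P_eq by (rule L'.Rn_obj_En_obj)
  also have "smf_comp A (hom_cat B (hom_cat C ?D)) (Rn B C ?D) L' =
    smf_comp A (hom_cat B (hom_cat C ?D)) (smf_comp (hom_cat B (hom_cat C ?D)) (hom_cat B (hom_cat C ?D)) (Rn B C ?D) (En B C ?D)) L"
    unfolding L'_def by (rule smf_comp_assoc[OF L BC.sym_mon_functor_En[OF D] BC.sym_mon_functor_Rn[OF D]])
  also have "\<dots> = L"
    by (simp only: BC.Rn_En[OF D] smf_comp_id[OF L])
  finally have PK: "smf_comp A (hom_cat B (hom_cat C ?D)) (hom_post B (hom_cat C ?E) (hom_cat C ?D) ?CP) K = L" .
  have "smf_comp ?D ?D (assoc_fun A B C) (assoc_fun' A B C) = smf_comp ?D ?D P (En_obj ?AB C ?E (En_obj A B (hom_cat C ?E) K))"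
    by (simp add: P_def assoc_fun'_def Let_def K_def)
  also have "\<dots> = En_obj ?AB C ?D (smf_comp ?AB (hom_cat C ?D) ?CP (En_obj A B (hom_cat C ?E) K))"
    by (rule EnK.strict_comp_En_obj[OF P sP])
  also have "smf_comp ?AB (hom_cat C ?D) ?CP (En_obj A B (hom_cat C ?E) K) = En_obj A B (hom_cat C ?D) L"
    by (simp only: K.strict_comp_En_obj[OF CP sCP] PK)
  finally have dom: "smf_comp ?D ?D (assoc_fun A B C) (assoc_fun' A B C) = En_obj ?AB C ?D (En_obj A B (hom_cat C ?D) L)" .
  \<comment> \<open>The inner \<epsilon> is a 2-cell between functors from \<open>?AB\<close> to the
    internal hom [C,D]; the outer En turns it into one between endofunctors of \<open>?D\<close>.
    Its source is the composite by \<open>dom\<close>, since \<open>L\<close> is Rn(eta).\<close>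
  let ?\<tau> = "En_arr ?AB C ?D (eps A B (hom_cat C ?D) (eta ?AB C))"
  have "mon_nat_trans ?D ?D ?\<tau>"
    by (intro AB_C.mnt_En_arr[OF D] AB.mnt_eps AB_C.sym_mon_functor_eta)
  then show ?thesis
    by (intro exI[of _ ?\<tau>]) (simp add: dom L_def AB_C.En_obj_eta)
qed

end
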